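(* Let $\omega\in\mathbb{R}\setminus\{0\}$, $m\in\mathbb{Z}$, and let $\lambda$ be an eigenvalue of the angular ODE (with these $\omega,m$). If $u$ solves the homogeneous radial ODE $u''+(\omega^2-V)u=0$ (with these $\omega,m,\lambda$) and satisfies the mode boundary conditions, then $u\equiv0$. Equivalently, there is no nontrivial mode solution of the wave equation on sub-extremal Kerr with $\omega\in\mathbb{R}\setminus\{0\}$.
   Context: Fix $M>0$ and $a\in\mathbb{R}$ with $|a|<M$. Let $r_\pm:=M\pm\sqrt{M^2-a^2}$ and $\Delta(r):=r^2-2Mr+a^2=(r-r_+)(r-r_-)$. Let $r^*:(r_+,\infty)\to(-\infty,\infty)$ be a fixed increasing bijection with $\frac{dr^*}{dr}=\frac{r^2+a^2}{\Delta}$; functions of $r\in(r_+,\infty)$ are identified with functions of $r^*\in\mathbb{R}$, and a prime $'$ denotes $d/dr^*$. Complex powers $(r-r_\pm)^c$ mean $e^{c\log(r-r_\pm)}$ with the real logarithm. Angular ODE: for $\omega\in\mathbb{C}$, $m\in\mathbb{Z}$, $\lambda\in\mathbb{C}$, $\frac{1}{\sin\theta}\frac{d}{d\theta}\big(\sin\theta\frac{dS}{d\theta}\big)-\big(\frac{m^2}{\sin^2\theta}-a^2\omega^2\cos^2\theta\big)S+\lambda S=0$ on $(0,\pi)$, together with the requirement that $e^{im\phi}S(\theta)$ extends to a smooth function on $\mathbb{S}^2$. A nonzero such $S$ is an angular eigenfunction with eigenvalue $\lambda$. Radial ODE: given $\omega,m,\lambda$, set $V:=\frac{4Mram\omega-a^2m^2+\Delta(\lambda+a^2\omega^2)}{(r^2+a^2)^2}+\frac{\Delta}{(r^2+a^2)^4}\big(a^2\Delta+2Mr(r^2-a^2)\big)$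 (with $r=r(r^* )$), and consider $u''+(\omega^2-V)u=H$ ($H=0$: homogeneous). Mode boundary conditions for $u$: with $\xi:=\frac{i(am-2Mr_+\omega)}{r_+-r_-}$, (i) $(r-r_+)^{-\xi}u$, as a function of $r$, extends smoothly to $r=r_+$; (ii) there exist constants $C_0,C_1,\dots$ such that for every $N\ge1$, $u=e^{i\omega r^*}\sum_{i=0}^N C_i r^{-i}+O(r^{-N-1})$ as $r\to\infty$. *)

theory Defs
  imports "HOL-Analysis.Analysis"
begin

definition kerr_rp :: "real \<Rightarrow> real \<Rightarrow> real" where
  "kerr_rp M a = M + sqrt (M^2 - a^2)"

definition kerr_rm :: "real \<Rightarrow> real \<Rightarrow> real" where
  "kerr_rm M a = M - sqrt (M^2 - a^2)"

definition kerr_Delta :: "real \<Rightarrow> real \<Rightarrow> real \<Rightarrow> real" where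
  "kerr_Delta M a r = r^2 - 2*M*r + a^2"

definition tortoise :: "real \<Rightarrow> real \<Rightarrow> (real \<Rightarrow> real) \<Rightarrow> bool" where
  "tortoise M a rs \<longleftrightarrow>
     bij_betw rs {kerr_rp M a<..} UNIV \<and>
     strict_mono_on {kerr_rp M a<..} rs \<and>
     (\<forall>r>kerr_rp M a. (rs has_real_derivative (r^2 + a^2) / kerr_Delta M a r) (at r))"

definition rcpow :: "real \<Rightarrow> complex \<Rightarrow> complex" where
  "rcpow x c = exp (c * of_real (ln x))"

fun Ck_on :: "nat \<Rightarrow> 'a::real_normed_vector set \<Rightarrow> ('a \<Rightarrow> 'b::real_normed_vector) \<Rightarrow> bool" where
  "Ck_on 0 S f = continuous_on S f"
| "Ck_on (Suc k) S f =
     ((\<forall>x\<in>S. f differentiable (at x)) \<and>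
      (\<forall>v. Ck_on k S (\<lambda>x. frechet_derivative f (at x) v)))"

definition smooth_on :: "'a::real_normed_vector set \<Rightarrow> ('a \<Rightarrow> 'b::real_normed_vector) \<Rightarrow> bool" where
  "smooth_on S f \<longleftrightarrow> (\<forall>k. Ck_on k S f)"

definition unit_sphere2 :: "(real \<times> real \<times> real) set" where
  "unit_sphere2 = {(x, y, z). x^2 + y^2 + z^2 = 1}"

text \<open>S is an angular eigenfunction with eigenvalue lam: it solves the angular ODE on
  (0,pi), written literally as (1/sin)(d/dtheta)(sin dS/dtheta) - (...)S + lam S = 0,
  and e^{i m phi} S(theta) extends to a smooth function on S^2 (i.e. is the restriction
  of a smooth function on an open neighbourhood of S^2 in R^3).\<close>
definition angular_eigenfunction ::
    "real \<Rightarrow> complex \<Rightarrow> int \<Rightarrow> complex \<Rightarrow> (real \<Rightarrow> complex) \<Rightarrow> bool" where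
  "angular_eigenfunction a \<omega> m lam S \<longleftrightarrow>
     (\<exists>S1 T. \<forall>\<theta>\<in>{0<..<pi}.
        (S has_vector_derivative S1 \<theta>) (at \<theta>) \<and>
        ((\<lambda>t. of_real (sin t) * S1 t) has_vector_derivative T \<theta>) (at \<theta>) \<and>
        T \<theta> / of_real (sin \<theta>)
          - (of_int m ^ 2 / of_real ((sin \<theta>)^2) - of_real (a^2) * \<omega>^2 * of_real ((cos \<theta>)^2)) * S \<theta>
          + lam * S \<theta> = 0) \<and>
     (\<exists>U G. open U \<and> unit_sphere2 \<subseteq> U \<and> smooth_on U (G :: real \<times> real \<times> real \<Rightarrow> complex) \<and>
        (\<forall>\<theta>\<in>{0<..<pi}. \<forall>\<phi>::real.
           G (sin \<theta> * cos \<phi>, sin \<theta> * sin \<phi>, cos \<theta>) = exp (\<i> * of_int m * of_real \<phi>) * S \<theta>))"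

definition angular_eigenvalue :: "real \<Rightarrow> complex \<Rightarrow> int \<Rightarrow> complex \<Rightarrow> bool" where
  "angular_eigenvalue a \<omega> m lam \<longleftrightarrow>
     (\<exists>S. (\<exists>\<theta>\<in>{0<..<pi}. S \<theta> \<noteq> 0) \<and> angular_eigenfunction a \<omega> m lam S)"

definition kerr_V :: "real \<Rightarrow> real \<Rightarrow> complex \<Rightarrow> int \<Rightarrow> complex \<Rightarrow> real \<Rightarrow> complex" where
  "kerr_V M a \<omega> m lam r =
     (of_real (4*M*r*a) * of_int m * \<omega> - of_real (a^2) * of_int m ^ 2
        + of_real (kerr_Delta M a r) * (lam + of_real (a^2) * \<omega>^2)) / of_real ((r^2 + a^2)^2)
     + of_real (kerr_Delta M a r / (r^2 + a^2)^4
        * (a^2 * kerr_Delta M a r + 2*M*r*(r^2 - a^2)))"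

text \<open>u (a function of r^*) solves u'' + (omega^2 - V) u = H, with V evaluated at
  r = r(r^*); since rs is a bijection onto R we state it at r^* = rs r for all r > r_+.\<close>
definition radial_solution ::
    "real \<Rightarrow> real \<Rightarrow> complex \<Rightarrow> int \<Rightarrow> complex \<Rightarrow> (real \<Rightarrow> real) \<Rightarrow> (real \<Rightarrow> complex)
      \<Rightarrow> (real \<Rightarrow> complex) \<Rightarrow> bool" where
  "radial_solution M a \<omega> m lam rs H u \<longleftrightarrow>
     (\<exists>u1 u2. (\<forall>s. (u has_vector_derivative u1 s) (at s) \<and> (u1 has_vector_derivative u2 s) (at s)) \<and>
        (\<forall>r>kerr_rp M a. u2 (rs r) + (\<omega>^2 - kerr_V M a \<omega> m lam r) * u (rs r) = H (rs r)))"

definition kerr_xi :: "real \<Rightarrow> real \<Rightarrow> complex \<Rightarrow> int \<Rightarrow> complex" where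
  "kerr_xi M a \<omega> m =
     \<i> * (of_real a * of_int m - of_real (2 * M * kerr_rp M a) * \<omega>) / of_real (kerr_rp M a - kerr_rm M a)"

definition horizon_bc :: "real \<Rightarrow> real \<Rightarrow> complex \<Rightarrow> int \<Rightarrow> (real \<Rightarrow> real) \<Rightarrow> (real \<Rightarrow> complex) \<Rightarrow> bool" where
  "horizon_bc M a \<omega> m rs u \<longleftrightarrow>
     (\<exists>\<epsilon>>0. \<exists>G::real \<Rightarrow> complex. smooth_on (ball (kerr_rp M a) \<epsilon>) G \<and>
        (\<forall>r\<in>{kerr_rp M a<..<kerr_rp M a + \<epsilon>}.
           G r = rcpow (r - kerr_rp M a) (- kerr_xi M a \<omega> m) * u (rs r)))"

definition infinity_bc :: "complex \<Rightarrow> (real \<Rightarrow> real) \<Rightarrow> (real \<Rightarrow> complex) \<Rightarrow> bool" where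
  "infinity_bc \<omega> rs u \<longleftrightarrow>
     (\<exists>C::nat \<Rightarrow> complex. \<forall>N\<ge>1. \<exists>K.
        eventually (\<lambda>r. norm (u (rs r) - exp (\<i> * \<omega> * of_real (rs r)) * (\<Sum>i\<le>N. C i / of_real (r ^ i)))
                      \<le> K * (1 / r) ^ (N + 1)) at_top)"

definition mode_bc :: "real \<Rightarrow> real \<Rightarrow> complex \<Rightarrow> int \<Rightarrow> (real \<Rightarrow> real) \<Rightarrow> (real \<Rightarrow> complex) \<Rightarrow> bool" where
  "mode_bc M a \<omega> m rs u \<longleftrightarrow> horizon_bc M a \<omega> m rs u \<and> infinity_bc \<omega> rs u"

end

(*
  In the variable y = (r - r_+) / (r - r_-), write u = sqrt (r^2 + a^2) e^{i w r} (r - r_+)^xi (r - r_-)^zeta f(y) with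
  zeta = -1 + 2 i M w - xi.  The coefficients of f = sum a_n y^n satisfy the three-term recurrence
    (n+1)(n+1+2 xi) a_{n+1} + beta_n a_n + (n - i eps)(n + 2 xi) a_{n-1} = 0,    eps = 4 M w.
  Replacing a_n by a_n (1 + 2 xi)_n / (1 - i eps)_n yields the recurrence with outer coefficients
  (n+1)(n+1 - i eps) and (n + 2 xi)^2, that is, a second confluent Heun equation on 0 < y < 1.  Since lambda and w are
  real it has a conserved flux, equal to -(eps/2) |f~(0)|^2 at the horizon y = 0 and to w (r_+ - r_-) |f~(1)|^2 at
  infinity y = 1; there is no superradiant term.  The two have opposite signs, so f~(0) = 0, hence f(0) = 0 and f = 0.

  On functions the replacement is a fractional (Erdelyi-Kober) derivative of imaginary order, an integral over
  0 < t < 1 of f(t y) against t^{2 xi} (1 - t)^{-i (eps - 2 i xi)}.  It only involves real y, so no analytic continuation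
  and no integral over r (as in Whiting's transformation) is needed.
*)

theory Submission
  imports Defs "HOL-Real_Asymp.Real_Asymp"
begin

section \<open>Linear equations with purely imaginary coefficient\<close>

text \<open>The untransformed equation already has a conserved flux of the same shape. Its value at
  infinity is the same multiple of |f(1)|^2, but at the horizon it is (\<kappa>/2) |f(0)|^2 with
  \<kappa> = -2 i xi. Superradiance is the case where \<kappa> and w have the same sign, and then
  the identity gives nothing. The exchange of exponents puts -eps, whose sign is always opposite to
  w, in the place of \<kappa>, and leaves the middle coefficients of the recurrence alone. Up to a
  constant, the multiplier (1 + 2 xi)_n / (1 - i eps)_n is a Beta integral whose integrand contains
  (1 - t)^(-1 - i \<mu>), \<mu> = eps + \<kappa>, which is not integrable. So that exponent is
  raised by one, which makes the kernel unimodular, and \<theta> + 1 - i eps, \<theta> = y d/dy, is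
  applied afterwards. Since u is only smooth at the horizon there is no power series to work with:
  every coefficient identity is proved for integrals in ln y, by parts. Near y = 1 only bounds are
  transported; the first derivative loses a factor 1 - y, which the weight (1 - y)^2 of the flux
  absorbs.\<close>

lemma has_real_derivative_norm_power2:
  fixes X :: "real \<Rightarrow> complex"
  assumes "(X has_vector_derivative X') (at t)"
  shows "((\<lambda>t. (norm (X t))^2) has_real_derivative 2 * Re (cnj (X t) * X')) (at t)"
proof -
  have "((\<lambda>t. X t \<bullet> X t) has_derivative (\<lambda>h. X t \<bullet> (h *\<^sub>R X') + (h *\<^sub>R X') \<bullet> X t)) (at t)"
    using assms unfolding has_vector_derivative_def by (intro has_derivative_inner)
  moreover have "(\<lambda>h. X t \<bullet> (h *\<^sub>R X') + (h *\<^sub>R X') \<bullet> X t) = (*) (2 * Re (cnj (X t) * X'))"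
    by (auto simp: inner_complex_def algebra_simps)
  ultimately show ?thesis
    by (simp add: has_field_derivative_def power2_norm_eq_inner)
qed

text \<open>The term \<open>\<i> * \<phi> t * X t\<close> is orthogonal to \<open>X t\<close> in the
  plane, so only \<open>Y\<close> changes the norm, however large \<phi> is. This makes the estimate
  usable next to singular points.\<close>

lemma norm_growth_phase_ode:
  fixes X Y :: "real \<Rightarrow> complex" and \<phi> \<Psi> \<psi> :: "real \<Rightarrow> real"
  assumes "s1 \<le> s2"
    and dX: "\<And>t. t \<in> {s1..s2} \<Longrightarrow> (X has_vector_derivative (\<i> * \<phi> t * X t + Y t)) (at t)"
    and dP: "\<And>t. t \<in> {s1..s2} \<Longrightarrow> (\<Psi> has_real_derivative \<psi> t) (at t)"
    and le: "\<And>t. t \<in> {s1..s2} \<Longrightarrow> norm (Y t) \<le> \<psi> t"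
  shows "\<bar>norm (X s2) - norm (X s1)\<bar> \<le> \<Psi> s2 - \<Psi> s1"
proof (rule field_le_epsilon)
  fix d :: real assume d: "d > 0"
  \<comment> \<open>The norm is not differentiable at zeros of \<open>X\<close>; this regularisation
    is, and it differs from the norm by at most \<open>d\<close>.\<close>
  define N where "N t = sqrt ((norm (X t))^2 + d^2)" for t
  have pos: "(norm (X t))^2 + d^2 > 0" for t
    using d by (simp add: add_nonneg_pos)
  have Npos: "N t > 0" and XN: "norm (X t) \<le> N t" and NX: "N t \<le> norm (X t) + d" for t
    using pos[of t] d sqrt_add_le_add_sqrt[of "(norm (X t))^2" "d^2"]
    by (auto simp: N_def intro: real_le_rsqrt)
  have dN: "(N has_real_derivative Re (cnj (X t) * Y t) / N t) (at t)" if "t \<in> {s1..s2}" for t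
  proof -
    have "2 * Re (cnj (X t) * (\<i> * \<phi> t * X t + Y t)) = 2 * Re (cnj (X t) * Y t)"
      by (simp add: algebra_simps)
    then have "((\<lambda>t. (norm (X t))^2 + d^2) has_real_derivative 2 * Re (cnj (X t) * Y t)) (at t)"
      using has_real_derivative_norm_power2[OF dX[OF that]]
      using DERIV_add[OF _ DERIV_const] by fastforce
    from DERIV_chain2[OF DERIV_real_sqrt[OF pos[of t]] this]
    have "(N has_real_derivative inverse (N t) / 2 * (2 * Re (cnj (X t) * Y t))) (at t)"
      unfolding N_def .
    moreover have "inverse n / 2 * (2 * z) = z / n" for n z :: real
      by (simp add: field_simps)
    ultimately show ?thesis by (simp only:)
  qed
  have b: "\<bar>Re (cnj (X t) * Y t) / N t\<bar> \<le> \<psi> t" if "t \<in> {s1..s2}" for t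
  proof -
    have "\<bar>Re (cnj (X t) * Y t)\<bar> \<le> norm (X t) * norm (Y t)"
      using abs_Re_le_cmod[of "cnj (X t) * Y t"] by (simp add: norm_mult)
    also have "\<dots> \<le> N t * \<psi> t"
      using XN[of t] le[OF that] Npos[of t] by (intro mult_mono) auto
    finally show ?thesis using Npos[of t] by (simp add: field_simps abs_div)
  qed
  have "N s1 + \<Psi> s1 \<le> N s2 + \<Psi> s2"
  proof (rule DERIV_nonneg_imp_nondecreasing[OF \<open>s1 \<le> s2\<close>, of "\<lambda>t. N t + \<Psi> t"])
    fix t assume "s1 \<le> t" "t \<le> s2"
    then have t: "t \<in> {s1..s2}" by simp
    show "\<exists>y. ((\<lambda>t. N t + \<Psi> t) has_real_derivative y) (at t) \<and> 0 \<le> y"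
      using DERIV_add[OF dN[OF t] dP[OF t]] b[OF t] by (intro exI conjI) (assumption, linarith)
  qed
  moreover have "\<Psi> s1 - N s1 \<le> \<Psi> s2 - N s2"
  proof (rule DERIV_nonneg_imp_nondecreasing[OF \<open>s1 \<le> s2\<close>, of "\<lambda>t. \<Psi> t - N t"])
    fix t assume "s1 \<le> t" "t \<le> s2"
    then have t: "t \<in> {s1..s2}" by simp
    show "\<exists>y. ((\<lambda>t. \<Psi> t - N t) has_real_derivative y) (at t) \<and> 0 \<le> y"
      using DERIV_diff[OF dP[OF t] dN[OF t]] b[OF t] by (intro exI conjI) (assumption, linarith)
  qed
  ultimately show "\<bar>norm (X s2) - norm (X s1)\<bar> \<le> \<Psi> s2 - \<Psi> s1 + d"
    using XN[of s1] XN[of s2] NX[of s1] NX[of s2] by linarith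
qed

text \<open>On a unit interval far out both \<open>v\<close> and \<open>v1 + \<i> * w * v\<close>
  hardly vary, hence neither does \<open>v1\<close>; but the mean of \<open>v1\<close> there is
  \<open>v (s+1) - v s\<close>, which is small.\<close>

lemma deriv_tendsto_0_of_convergent:
  fixes v v1 v2 :: "real \<Rightarrow> complex" and w :: real
  assumes v: "\<And>s. (v has_vector_derivative v1 s) (at s)"
    and v1: "\<And>s. (v1 has_vector_derivative v2 s) (at s)"
    and lim: "(v \<longlongrightarrow> C) at_top"
    and ode: "((\<lambda>s. v2 s + \<i> * w * v1 s) \<longlongrightarrow> 0) at_top"
  shows "(v1 \<longlongrightarrow> 0) at_top"
proof (rule tendstoI)
  fix e0 :: real assume e0: "e0 > 0"
  \<comment> \<open>The final estimate adds \<open>2 * e\<close> from the increment of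
    \<open>v\<close> and \<open>e + 2 * \<bar>w\<bar> * e\<close> from the variation of
    \<open>v1\<close>; one more \<open>e\<close> makes it strict.\<close>
  define e where "e = e0 / (4 + 2 * \<bar>w\<bar>)"
  have e: "e > 0" using e0 by (simp add: e_def)
  have e0_eq: "e0 = 4 * e + 2 * \<bar>w\<bar> * e"
    by (simp add: e_def field_simps add_nonneg_eq_0_iff)
  obtain s0 where s0: "\<And>s. s \<ge> s0 \<Longrightarrow> dist (v s) C < e \<and> dist (v2 s + \<i> * w * v1 s) 0 < e"
    using eventually_conj[OF tendstoD[OF lim e] tendstoD[OF ode e]]
    by (auto simp: eventually_at_top_linorder)
  have "dist (v1 s) 0 < e0" if s: "s \<ge> s0" for s
  proof -
    have vv: "norm (v x - v y) \<le> 2 * e" if "x \<ge> s0" "y \<ge> s0" for x y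
      using s0[OF that(1)] s0[OF that(2)] dist_triangle2[of "v x" "v y" C] by (simp add: dist_norm)
    have inc: "norm (v1 x - v1 s) \<le> e + 2 * \<bar>w\<bar> * e" if x: "x \<in> {s..s+1}" for x
    proof -
      define q where "q t = v1 t + \<i> * w * v t" for t
      have dq: "(q has_vector_derivative (v2 t + \<i> * w * v1 t)) (at t within {s..x})" for t
        unfolding q_def
        by (rule has_vector_derivative_at_within)
           (intro has_vector_derivative_add v1 has_vector_derivative_mult_right v)
      have "norm (q x - q s) \<le> e * norm (x - s)"
      proof (rule differentiable_bound[of "{s..x}" q "\<lambda>t h. h *\<^sub>R (v2 t + \<i> * w * v1 t)"])
        show "onorm (\<lambda>h. h *\<^sub>R (v2 t + \<i> * w * v1 t)) \<le> e" if "t \<in> {s..x}" for t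
        proof (rule onorm_le)
          show "norm (h *\<^sub>R (v2 t + \<i> * w * v1 t)) \<le> e * norm h" for h
            using s0[of t] that s
              mult_right_mono[of "norm (v2 t + \<i> * w * v1 t)" e "norm h"]
            by (simp add: mult.commute)
        qed
      qed (use dq x in \<open>auto simp: has_vector_derivative_def\<close>)
      also have "\<dots> \<le> e" using mult_left_mono[of "norm (x - s)" 1 e] x e by simp
      finally have "norm (q x - q s) \<le> e" .
      moreover have "v1 x - v1 s = (q x - q s) - \<i> * w * (v x - v s)"
        by (simp add: q_def algebra_simps)
      ultimately have "norm (v1 x - v1 s) \<le> e + \<bar>w\<bar> * norm (v x - v s)"
        using norm_triangle_ineq4[of "q x - q s" "\<i> * w * (v x - v s)"] by (simp add: norm_mult)
      moreover have "\<bar>w\<bar> * norm (v x - v s) \<le> \<bar>w\<bar> * (2 * e)"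
        using vv[of x s] x s by (intro mult_left_mono) auto
      ultimately show ?thesis by simp
    qed
    have "norm (v (s+1) - v s - ((s+1) - s) *\<^sub>R v1 s) \<le> norm ((s+1) - s) * (e + 2 * \<bar>w\<bar> * e)"
      by (rule vector_differentiable_bound_linearization[of "{s..s+1}"])
         (use inc in \<open>auto intro: has_vector_derivative_at_within v simp: closed_segment_eq_real_ivl\<close>)
    then have "norm (v1 s) \<le> norm (v (s+1) - v s) + (e + 2 * \<bar>w\<bar> * e)"
      using norm_triangle_ineq4[of "v (s+1) - v s" "v (s+1) - v s - v1 s"] by simp
    then show ?thesis using vv[of "s+1" s] s e unfolding e0_eq by simp
  qed
  then show "eventually (\<lambda>s. dist (v1 s) 0 < e0) at_top"
    using eventually_at_top_linorder by blast
qed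

section \<open>Reality of the angular eigenvalue\<close>

lemma Ck_on_1_partial_continuous:
  assumes "Ck_on 1 S f"
  shows "\<And>x. x \<in> S \<Longrightarrow> f differentiable (at x)"
    and "continuous_on S (\<lambda>x. frechet_derivative f (at x) v)"
  using assms by (auto simp: eval_nat_numeral)

text \<open>Self-adjointness in Wronskian form: Im(conj(S) sin \<theta> S') vanishes at both poles,
  while its derivative is -Im lam sin \<theta> |S|^2, of one sign. Smoothness on the sphere serves
  to bound S' up to the poles.\<close>

lemma angular_eigenvalue_real:
  fixes a \<omega> :: real
  assumes "angular_eigenvalue a (of_real \<omega>) m lam"
  shows "Im lam = 0"
proof (rule ccontr)
  assume Im: "Im lam \<noteq> 0"
  obtain S \<theta>0 where \<theta>0: "\<theta>0 \<in> {0<..<pi}" "S \<theta>0 \<noteq> 0"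
    and ef: "angular_eigenfunction a (of_real \<omega>) m lam S"
    using assms unfolding angular_eigenvalue_def by blast
  obtain S1 T where ode: "\<And>\<theta>. \<theta> \<in> {0<..<pi} \<Longrightarrow>
        (S has_vector_derivative S1 \<theta>) (at \<theta>) \<and>
        ((\<lambda>t. of_real (sin t) * S1 t) has_vector_derivative T \<theta>) (at \<theta>) \<and>
        T \<theta> / of_real (sin \<theta>)
          - (of_int m ^ 2 / of_real ((sin \<theta>)^2) - of_real (a^2) * (of_real \<omega>)^2 * of_real ((cos \<theta>)^2)) * S \<theta>
          + lam * S \<theta> = 0"
    using ef unfolding angular_eigenfunction_def by blast
  obtain U G where U: "open U" "unit_sphere2 \<subseteq> U" "smooth_on U (G :: real \<times> real \<times> real \<Rightarrow> complex)"
    and G: "\<And>\<theta> \<phi>::real. \<theta>\<in>{0<..<pi} \<Longrightarrow>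
           G (sin \<theta> * cos \<phi>, sin \<theta> * sin \<phi>, cos \<theta>) = exp (\<i> * of_int m * of_real \<phi>) * S \<theta>"
    using ef unfolding angular_eigenfunction_def by blast
  define c :: "real \<Rightarrow> real \<times> real \<times> real" where "c \<theta> = (sin \<theta>, 0, cos \<theta>)" for \<theta>
  have SG: "S \<theta> = G (c \<theta>)" if "\<theta> \<in> {0<..<pi}" for \<theta>
    using G[OF that, of 0] by (simp add: c_def)
  have cU: "c \<theta> \<in> U" for \<theta>
    using U(2) by (auto simp: c_def unit_sphere2_def)
  have C1: "Ck_on 1 U G" using U(3) by (simp add: smooth_on_def)
  note Gd = Ck_on_1_partial_continuous(1)[OF C1 cU]
  have contc: "continuous_on A c" for A
    unfolding c_def by (intro continuous_intros)
  have contD: "continuous_on {0..pi} (\<lambda>\<theta>. frechet_derivative G (at (c \<theta>)) v)" for v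
    by (rule continuous_on_compose2[OF Ck_on_1_partial_continuous(2)[OF C1] contc]) (use cU in auto)
  have contG: "continuous_on {0..pi} (\<lambda>\<theta>. G (c \<theta>))"
    by (rule continuous_on_compose2[OF _ contc, of U])
       (use Ck_on_1_partial_continuous(1)[OF C1] cU in
         \<open>auto intro!: differentiable_imp_continuous_on differentiable_at_imp_differentiable_on\<close>)
  define e1 e3 :: "real \<times> real \<times> real" where "e1 = (1, 0, 0)" and "e3 = (0, 0, 1)"
  \<comment> \<open>The chain rule along the meridian \<phi> = 0. It agrees with \<open>S1\<close>
    inside the interval and is continuous up to the poles.\<close>
  define D where "D \<theta> = cos \<theta> *\<^sub>R frechet_derivative G (at (c \<theta>)) e1
      - sin \<theta> *\<^sub>R frechet_derivative G (at (c \<theta>)) e3" for \<theta>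
  have S1D: "S1 \<theta> = D \<theta>" if th: "\<theta> \<in> {0<..<pi}" for \<theta>
  proof -
    have "(c has_vector_derivative (cos \<theta> *\<^sub>R e1 - sin \<theta> *\<^sub>R e3)) (at \<theta>)"
      unfolding c_def e1_def e3_def
      by (auto intro!: derivative_eq_intros has_vector_derivative_Pair
          simp: has_real_derivative_iff_has_vector_derivative[symmetric])
    then have "((G \<circ> c) has_vector_derivative frechet_derivative G (at (c \<theta>)) (cos \<theta> *\<^sub>R e1 - sin \<theta> *\<^sub>R e3)) (at \<theta>)"
      using vector_derivative_diff_chain_within[of c _ \<theta> UNIV G]
        Gd[of \<theta>, unfolded frechet_derivative_works]
      by (simp add: has_derivative_at_withinI)
    moreover have "frechet_derivative G (at (c \<theta>)) (cos \<theta> *\<^sub>R e1 - sin \<theta> *\<^sub>R e3) = D \<theta>"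
      using linear_frechet_derivative[OF Gd[of \<theta>]]
      by (simp add: D_def linear_diff linear_cmul)
    ultimately have "((\<lambda>\<theta>. G (c \<theta>)) has_vector_derivative D \<theta>) (at \<theta>)" by (simp add: o_def)
    then have "(S has_vector_derivative D \<theta>) (at \<theta>)"
      by (rule has_vector_derivative_transform_within_open[of _ _ _ "{0<..<pi}"])
         (use th SG in auto)
    then show ?thesis using ode[OF th] vector_derivative_unique_at by blast
  qed
  define W where "W \<theta> = Im (cnj (G (c \<theta>)) * (of_real (sin \<theta>) * D \<theta>))" for \<theta>
  have contW: "continuous_on {0..pi} W"
    unfolding W_def D_def by (intro continuous_intros contG contD)
  have dW: "(W has_real_derivative - Im lam * (sin \<theta> * (norm (S \<theta>))^2)) (at \<theta>)"
    if th: "\<theta> \<in> {0<..<pi}" for \<theta>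
  proof -
    have s: "sin \<theta> > 0" using th by (auto intro: sin_gt_zero)
    have "((\<lambda>t. cnj (S t) * (of_real (sin t) * S1 t)) has_vector_derivative
        (cnj (S \<theta>) * T \<theta> + cnj (S1 \<theta>) * (of_real (sin \<theta>) * S1 \<theta>))) (at \<theta>)"
      using ode[OF th] by (intro has_vector_derivative_mult has_vector_derivative_cnj) auto
    then have "((\<lambda>t. Im (cnj (S t) * (of_real (sin t) * S1 t))) has_vector_derivative
        Im (cnj (S \<theta>) * T \<theta> + cnj (S1 \<theta>) * (of_real (sin \<theta>) * S1 \<theta>))) (at \<theta>)"
      by (rule bounded_linear.has_vector_derivative[OF bounded_linear_Im])
    moreover have "Im (cnj (S \<theta>) * T \<theta> + cnj (S1 \<theta>) * (of_real (sin \<theta>) * S1 \<theta>))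
        = - Im lam * (sin \<theta> * (norm (S \<theta>))^2)"
    proof -
      define q where "q = (of_int m)^2 / (sin \<theta>)^2 - a^2 * \<omega>^2 * (cos \<theta>)^2"
      have "T \<theta> / of_real (sin \<theta>) = (of_real q - lam) * S \<theta>"
        using ode[OF th] by (simp add: q_def algebra_simps)
      then have T: "T \<theta> = of_real (sin \<theta>) * ((of_real q - lam) * S \<theta>)"
        using s by (simp add: field_simps)
      show ?thesis unfolding T cmod_power2
        by (simp add: algebra_simps power2_eq_square)
    qed
    ultimately have "((\<lambda>t. Im (cnj (S t) * (of_real (sin t) * S1 t))) has_real_derivative
        - Im lam * (sin \<theta> * (norm (S \<theta>))^2)) (at \<theta>)"
      by (simp add: has_real_derivative_iff_has_vector_derivative)
    then show ?thesis
      by (rule has_field_derivative_transform_within_open[of _ _ _ "{0<..<pi}"])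
         (use th SG S1D in \<open>auto simp: W_def\<close>)
  qed
  have W0: "W 0 = 0" "W pi = 0" by (auto simp: W_def)
  \<comment> \<open>\<open>W\<close> is monotone and takes the value 0 at both ends.\<close>
  have "W \<theta> = 0" if th: "\<theta> \<in> {0<..<pi}" for \<theta>
  proof -
    have c1: "continuous_on {0..\<theta>} W" and c2: "continuous_on {\<theta>..pi} W"
      using contW th by (auto elim!: continuous_on_subset)
    have nn: "sin x * (norm (S x))^2 \<ge> 0" if "0 < x" "x < pi" for x
      using that by (simp add: sin_gt_zero less_imp_le)
    show ?thesis
    proof (cases "Im lam > 0")
      case True
      then have le: "- Im lam * (sin x * (norm (S x))^2) \<le> 0" if "0 < x" "x < pi" for x
        using nn[OF that] by (simp add: mult_nonneg_nonneg)
      have "\<exists>y. (W has_real_derivative y) (at x) \<and> y \<le> 0" if "0 < x" "x < pi" for x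
        using dW[of x] le[OF that] that by auto
      then have "W 0 \<ge> W \<theta>" "W \<theta> \<ge> W pi"
        using th
        by (auto intro!: DERIV_nonpos_imp_decreasing_open[OF _ _ c1] DERIV_nonpos_imp_decreasing_open[OF _ _ c2])
      then show ?thesis using W0 by simp
    next
      case False
      with Im have "- Im lam \<ge> 0" by simp
      then have ge: "- Im lam * (sin x * (norm (S x))^2) \<ge> 0" if "0 < x" "x < pi" for x
        using nn[OF that] by (metis mult_nonneg_nonneg)
      have "\<exists>y. (W has_real_derivative y) (at x) \<and> y \<ge> 0" if "0 < x" "x < pi" for x
        using dW[of x] ge[OF that] that by auto
      then have "W 0 \<le> W \<theta>" "W \<theta> \<le> W pi"
        using th
        by (auto intro!: DERIV_nonneg_imp_increasing_open[OF _ _ c1] DERIV_nonneg_imp_increasing_open[OF _ _ c2])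
      then show ?thesis using W0 by simp
    qed
  qed
  then have "((\<lambda>_. 0) has_real_derivative - Im lam * (sin \<theta>0 * (norm (S \<theta>0))^2)) (at \<theta>0)"
    using has_field_derivative_transform_within_open[OF dW[OF \<theta>0(1)], of "{0<..<pi}" "\<lambda>_. 0"] \<theta>0(1) by simp
  then have "- Im lam * (sin \<theta>0 * (norm (S \<theta>0))^2) = 0"
    using DERIV_unique DERIV_const by blast
  then show False using Im \<theta>0 sin_gt_zero[of \<theta>0] by simp
qed

section \<open>The Erdelyi-Kober transform\<close>

lemma absolutely_integrable_bounded_continuous_interval:
  fixes f :: "real \<Rightarrow> complex"
  assumes "continuous_on {0<..<1} f" and "\<And>t. t \<in> {0<..<1} \<Longrightarrow> norm (f t) \<le> B"
  shows "f absolutely_integrable_on {0<..<1::real}"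
proof (rule measurable_bounded_by_integrable_imp_absolutely_integrable)
  show "(\<lambda>_. B) integrable_on {0<..<1::real}"
    by (simp add: integrable_on_open_interval_real integrable_on_const)
qed (use assms in \<open>auto intro: continuous_imp_measurable_on_sets_lebesgue\<close>)

lemma integral_unit_interval_const: "integral {0<..<1::real} (\<lambda>_. B) = (B::real)"
  using integral_open_interval_real[of 0 1 "\<lambda>_. B"] by simp

lemma norm_integral_unit_interval_le:
  fixes f :: "real \<Rightarrow> complex"
  assumes "continuous_on {0<..<1} f" and B: "\<And>t. t \<in> {0<..<1} \<Longrightarrow> norm (f t) \<le> B"
  shows "norm (integral {0<..<1} f) \<le> B"
proof -
  have "f integrable_on {0<..<1}"
    using absolutely_integrable_bounded_continuous_interval[OF assms]
    by (rule set_lebesgue_integral_eq_integral(1))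
  then have "norm (integral {0<..<1} f) \<le> integral {0<..<1::real} (\<lambda>_. B)"
    by (rule integral_norm_bound_integral) (auto simp: B integrable_on_open_interval_real integrable_on_const)
  then show ?thesis by (simp add: integral_unit_interval_const)
qed

text \<open>The functions in question oscillate without limit at 0 and 1 apart from a factor t (1 -
  t); that factor forces the value and the limit 0 at both ends.\<close>

lemma continuous_on_unit_interval_of_bound:
  fixes h :: "real \<Rightarrow> complex"
  assumes "\<And>t. t \<in> {0<..<1} \<Longrightarrow> isCont h t"
    and B: "\<And>t. t \<in> {0..1} \<Longrightarrow> norm (h t) \<le> B * (t * (1 - t))"
  shows "continuous_on {0..1} h"
  unfolding continuous_on_def
proof
  fix x :: real assume x: "x \<in> {0..1}"
  show "(h \<longlongrightarrow> h x) (at x within {0..1})"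
  proof (cases "x = 0 \<or> x = 1")
    case True
    have "((\<lambda>t. B * (t * (1 - t))) \<longlongrightarrow> B * (x * (1 - x))) (at x within {0..1})"
      by (intro tendsto_intros)
    then have "((\<lambda>t. B * (t * (1 - t))) \<longlongrightarrow> 0) (at x within {0..1})" using True by auto
    moreover have "\<forall>\<^sub>F t in at x within {0..1}. norm (h t) \<le> B * (t * (1 - t))"
      using B by (auto simp: eventually_at_filter)
    ultimately have "(h \<longlongrightarrow> 0) (at x within {0..1})" by (rule Lim_null_comparison[rotated])
    then show ?thesis using B[of x] x True by auto
  next
    case False
    then have "isCont h x" using assms(1)[of x] x by auto
    then show ?thesis
      by (simp add: continuous_at_imp_continuous_at_within continuous_within[symmetric])
  qed
qed

text \<open>Integration by parts without boundary terms, in the form in which every identity for the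
  transform is obtained.\<close>

lemma integral_unit_interval_deriv_eq_0:
  fixes h h' :: "real \<Rightarrow> complex"
  assumes d: "\<And>t. t \<in> {0<..<1} \<Longrightarrow> (h has_vector_derivative h' t) (at t)"
    and B: "\<And>t. t \<in> {0<..<1} \<Longrightarrow> norm (h t) \<le> B * (t * (1 - t))"
    and "h 0 = 0" "h 1 = 0"
  shows "(h' has_integral 0) {0<..<1}"
proof -
  have "norm (h t) \<le> B * (t * (1 - t))" if "t \<in> {0..1}" for t
    using B[of t] assms(3,4) that by (cases "t = 0 \<or> t = 1") auto
  then have "continuous_on {0..1} h"
    using has_vector_derivative_continuous[OF d] by (rule continuous_on_unit_interval_of_bound[rotated])
  then have "(h' has_integral (h 1 - h 0)) {0..1}"
    using d by (intro fundamental_theorem_of_calculus_interior) auto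
  then show ?thesis
    using assms(3,4) has_integral_Icc_iff_Ioo[of h' 0 0 1] by simp
qed

text \<open>This is t^(i \<kappa>) (1 - t)^(-i \<mu>), written with a real phase so that its norm is
  1 for every t, including those where \<open>ln\<close> takes a default value.\<close>

definition kober_kernel :: "real \<Rightarrow> real \<Rightarrow> real \<Rightarrow> complex" where
  "kober_kernel \<kappa> \<mu> t = exp (\<i> * of_real (\<kappa> * ln t - \<mu> * ln (1 - t)))"

lemma norm_kober_kernel [simp]: "norm (kober_kernel \<kappa> \<mu> t) = 1"
  unfolding kober_kernel_def by (rule norm_exp_i_times)

lemma kober_kernel_has_vector_derivative:
  assumes "t \<in> {0<..<1}"
  shows "(kober_kernel \<kappa> \<mu> has_vector_derivative
      (\<i> * \<kappa> / of_real t + \<i> * \<mu> / (1 - of_real t)) * kober_kernel \<kappa> \<mu> t) (at t)"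
proof -
  have "((\<lambda>t. \<kappa> * ln t - \<mu> * ln (1 - t)) has_real_derivative (\<kappa> / t + \<mu> / (1 - t))) (at t)"
    using assms by (auto intro!: derivative_eq_intros simp: divide_inverse)
  from has_vector_derivative_mult_right[OF has_vector_derivative_of_real[OF this], of "\<i>"]
  have "((\<lambda>t. \<i> * of_real (\<kappa> * ln t - \<mu> * ln (1 - t))) has_vector_derivative
      \<i> * complex_of_real (\<kappa> / t + \<mu> / (1 - t))) (at t)" .
  from field_vector_diff_chain_at[OF this DERIV_exp] show ?thesis
    unfolding kober_kernel_def o_def by (simp add: algebra_simps)
qed

lemma continuous_on_kober_kernel: "continuous_on {0<..<1} (kober_kernel \<kappa> \<mu>)"
  unfolding kober_kernel_def by (intro continuous_intros) auto

text \<open>With y = exp \<sigma> the argument \<sigma> + ln t is the logarithm of t y, so dilations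
  become translations and \<theta> = y d/dy becomes d/d\<sigma>. On y^n the operator multiplies by
  the Beta value B(n + 1 + i \<kappa>, 1 - i \<mu>).\<close>

definition kober :: "real \<Rightarrow> real \<Rightarrow> (real \<Rightarrow> complex) \<Rightarrow> real \<Rightarrow> complex" where
  "kober \<kappa> \<mu> G \<sigma> = integral {0<..<1} (\<lambda>t. kober_kernel \<kappa> \<mu> t * G (\<sigma> + ln t))"

text \<open>The transform at \<sigma> only samples arguments below \<sigma>, so a bound on each
  half-line ending before 0 is enough; growth towards s = 0, which is y = 1, stays free.\<close>

definition left_tame :: "(real \<Rightarrow> complex) \<Rightarrow> bool" where
  "left_tame G \<longleftrightarrow> continuous_on {..<0} G \<and> (\<forall>c<0. \<exists>B. \<forall>s\<le>c. norm (G s) \<le> B)"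

lemma left_tameD:
  assumes "left_tame G" "c < 0"
  obtains B where "B \<ge> 0" "\<And>s. s \<le> c \<Longrightarrow> norm (G s) \<le> B"
  using assms norm_ge_zero order_trans unfolding left_tame_def by (metis order_refl)

lemma left_tame_add: "left_tame F \<Longrightarrow> left_tame G \<Longrightarrow> left_tame (\<lambda>s. F s + G s)"
  unfolding left_tame_def by (auto intro!: continuous_intros) (metis norm_add_rule_thm)

lemma left_tame_mult: "left_tame F \<Longrightarrow> left_tame G \<Longrightarrow> left_tame (\<lambda>s. F s * G s)"
proof -
  assume F: "left_tame F" and G: "left_tame G"
  have "\<exists>B. \<forall>s\<le>c. norm (F s * G s) \<le> B" if c: "c < 0" for c
  proof -
    obtain A B where "A \<ge> 0" "\<And>s. s \<le> c \<Longrightarrow> norm (F s) \<le> A" "\<And>s. s \<le> c \<Longrightarrow> norm (G s) \<le> B"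
      using left_tameD[OF F c] left_tameD[OF G c] by metis
    then show ?thesis by (intro exI[of _ "A * B"]) (auto simp: norm_mult intro!: mult_mono)
  qed
  with F G show ?thesis unfolding left_tame_def by (auto intro!: continuous_intros)
qed

lemma left_tame_const: "left_tame (\<lambda>_. c)"
  unfolding left_tame_def by auto

lemma left_tame_exp: "left_tame (\<lambda>s. of_real (exp s))"
  unfolding left_tame_def by (auto intro!: continuous_intros exI[of _ 1])

lemmas left_tame_intros = left_tame_add left_tame_mult left_tame_const left_tame_exp

lemma kober_integrand_continuous:
  assumes "left_tame G" "\<sigma> < 0"
  shows "continuous_on {0<..<1} (\<lambda>t. kober_kernel \<kappa> \<mu> t * G (\<sigma> + ln t))"
proof -
  have "continuous_on {0<..<1} (\<lambda>t. G (\<sigma> + ln t))"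
    by (rule continuous_on_compose2[of "{..<0}" G])
       (use assms in \<open>auto simp: left_tame_def add_neg_neg intro!: continuous_intros\<close>)
  then show ?thesis by (intro continuous_intros continuous_on_kober_kernel)
qed

lemma kober_integrable:
  assumes "left_tame G" "\<sigma> < 0"
  shows "(\<lambda>t. kober_kernel \<kappa> \<mu> t * G (\<sigma> + ln t)) integrable_on {0<..<1}"
proof -
  obtain B where "\<And>s. s \<le> \<sigma> \<Longrightarrow> norm (G s) \<le> B" using left_tameD[OF assms] by blast
  then have "(\<lambda>t. kober_kernel \<kappa> \<mu> t * G (\<sigma> + ln t)) absolutely_integrable_on {0<..<1}"
    by (intro absolutely_integrable_bounded_continuous_interval[of _ B] kober_integrand_continuous assms)
       (auto simp: norm_mult)
  then show ?thesis by (rule set_lebesgue_integral_eq_integral(1))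
qed

lemma kober_norm_le:
  assumes "left_tame G" "\<sigma> < 0" "\<And>s. s < \<sigma> \<Longrightarrow> norm (G s) \<le> B"
  shows "norm (kober \<kappa> \<mu> G \<sigma>) \<le> B"
  unfolding kober_def
  by (rule norm_integral_unit_interval_le[OF kober_integrand_continuous[OF assms(1,2)]])
     (use assms(3) in \<open>auto simp: norm_mult\<close>)

lemma kober_add:
  assumes "left_tame F" "left_tame G" "\<sigma> < 0"
  shows "kober \<kappa> \<mu> (\<lambda>s. F s + G s) \<sigma> = kober \<kappa> \<mu> F \<sigma> + kober \<kappa> \<mu> G \<sigma>"
  unfolding kober_def distrib_left
  by (intro integral_add kober_integrable assms)

lemma kober_cmult: "kober \<kappa> \<mu> (\<lambda>s. c * G s) \<sigma> = c * kober \<kappa> \<mu> G \<sigma>"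
  unfolding kober_def by (simp add: mult.left_commute[of _ c])

lemma has_vector_derivative_iff_quotient:
  fixes f :: "real \<Rightarrow> 'a::real_normed_vector"
  shows "(f has_vector_derivative f') (at x) \<longleftrightarrow> ((\<lambda>y. (f y - f x) /\<^sub>R (y - x) - f') \<longlongrightarrow> 0) (at x)"
proof -
  have "norm (f y - f x - (y - x) *\<^sub>R f') / norm (y - x) = norm ((f y - f x) /\<^sub>R (y - x) - f')" if "y \<noteq> x" for y
  proof -
    have "(f y - f x) /\<^sub>R (y - x) - f' = (f y - f x - (y - x) *\<^sub>R f') /\<^sub>R (y - x)"
      using that by (simp add: scaleR_diff_right)
    then show ?thesis by (simp add: divide_inverse mult.commute)
  qed
  then have "((\<lambda>y. norm (f y - f x - (y - x) *\<^sub>R f') / norm (y - x)) \<longlongrightarrow> 0) (at x)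
      \<longleftrightarrow> ((\<lambda>y. norm ((f y - f x) /\<^sub>R (y - x) - f')) \<longlongrightarrow> 0) (at x)"
    by (intro tendsto_cong) (auto simp: eventually_at_filter)
  then show ?thesis
    unfolding has_vector_derivative_def has_derivative_iff_norm tendsto_norm_zero_iff
    by (simp add: bounded_linear_scaleR_left)
qed

text \<open>Differentiation under the integral: the transform commutes with \<theta> because it is a
  superposition of translations in the logarithmic variable.\<close>

lemma kober_has_vector_derivative:
  assumes G0: "left_tame G0" and G1: "left_tame G1"
    and d: "\<And>s. s < 0 \<Longrightarrow> (G0 has_vector_derivative G1 s) (at s)"
    and \<sigma>: "\<sigma> < 0"
  shows "(kober \<kappa> \<mu> G0 has_vector_derivative kober \<kappa> \<mu> G1 \<sigma>) (at \<sigma>)"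
proof -
  \<comment> \<open>A point strictly between \<sigma> and 0, so that difference quotients at all
    nearby \<open>x\<close> fall into one half-line on which \<open>G1\<close> is bounded.\<close>
  define c where "c = \<sigma> / 2"
  have c: "c < 0" "\<sigma> < c" using \<sigma> by (auto simp: c_def)
  obtain B where B: "B \<ge> 0" "\<And>s. s \<le> c \<Longrightarrow> norm (G1 s) \<le> B" using left_tameD[OF G1 c(1)] by blast
  define R where "R x s = (G0 (x + s) - G0 (\<sigma> + s)) /\<^sub>R (x - \<sigma>) - G1 (\<sigma> + s)" for x s
  have lin: "(kober \<kappa> \<mu> G0 x - kober \<kappa> \<mu> G0 \<sigma>) /\<^sub>R (x - \<sigma>) - kober \<kappa> \<mu> G1 \<sigma>
      = integral {0<..<1} (\<lambda>t. kober_kernel \<kappa> \<mu> t * R x (ln t))"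
    and intR: "(\<lambda>t. kober_kernel \<kappa> \<mu> t * R x (ln t)) integrable_on {0<..<1}" if "x < 0" for x
  proof -
    have "((\<lambda>t. (kober_kernel \<kappa> \<mu> t * G0 (x + ln t) - kober_kernel \<kappa> \<mu> t * G0 (\<sigma> + ln t)) /\<^sub>R (x - \<sigma>)
          - kober_kernel \<kappa> \<mu> t * G1 (\<sigma> + ln t)) has_integral
        ((kober \<kappa> \<mu> G0 x - kober \<kappa> \<mu> G0 \<sigma>) /\<^sub>R (x - \<sigma>) - kober \<kappa> \<mu> G1 \<sigma>)) {0<..<1}"
      unfolding kober_def
      by (intro has_integral_diff has_integral_cmul integrable_integral kober_integrable G0 G1 \<sigma> that)
    moreover have "(\<lambda>t. (kober_kernel \<kappa> \<mu> t * G0 (x + ln t) - kober_kernel \<kappa> \<mu> t * G0 (\<sigma> + ln t)) /\<^sub>R (x - \<sigma>)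
          - kober_kernel \<kappa> \<mu> t * G1 (\<sigma> + ln t)) = (\<lambda>t. kober_kernel \<kappa> \<mu> t * R x (ln t))"
      by (auto simp: R_def algebra_simps)
    ultimately have "((\<lambda>t. kober_kernel \<kappa> \<mu> t * R x (ln t)) has_integral
        ((kober \<kappa> \<mu> G0 x - kober \<kappa> \<mu> G0 \<sigma>) /\<^sub>R (x - \<sigma>) - kober \<kappa> \<mu> G1 \<sigma>)) {0<..<1}" by simp
    then show "(kober \<kappa> \<mu> G0 x - kober \<kappa> \<mu> G0 \<sigma>) /\<^sub>R (x - \<sigma>) - kober \<kappa> \<mu> G1 \<sigma>
      = integral {0<..<1} (\<lambda>t. kober_kernel \<kappa> \<mu> t * R x (ln t))"
      "(\<lambda>t. kober_kernel \<kappa> \<mu> t * R x (ln t)) integrable_on {0<..<1}"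
      by (auto simp: has_integral_iff)
  qed
  \<comment> \<open>The mean value inequality bounds the quotient by \<open>B\<close>, and the
    subtracted derivative costs another \<open>B\<close>; this dominates uniformly in t.\<close>
  have Rbd: "norm (R x s) \<le> 2 * B" if x: "x \<le> c" "x \<noteq> \<sigma>" and s: "s < 0" for x s
  proof -
    have "norm (G0 (x + s) - G0 (\<sigma> + s)) \<le> B * norm ((x + s) - (\<sigma> + s))"
    proof (rule differentiable_bound[of "{..c}" G0 "\<lambda>t h. h *\<^sub>R G1 t"])
      show "onorm (\<lambda>h. h *\<^sub>R G1 t) \<le> B" if "t \<in> {..c}" for t
        by (rule onorm_le) (use B(2)[of t] that in \<open>auto simp: mult.commute[of B] intro: mult_left_mono\<close>)
    qed (use d c x s in \<open>auto simp: has_vector_derivative_def intro: has_derivative_at_withinI\<close>)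
    then have "norm ((G0 (x + s) - G0 (\<sigma> + s)) /\<^sub>R (x - \<sigma>)) \<le> B"
      using x by (simp add: divide_simps)
    then show ?thesis
      using norm_triangle_ineq4[of "(G0 (x + s) - G0 (\<sigma> + s)) /\<^sub>R (x - \<sigma>)" "G1 (\<sigma> + s)"] B(2)[of "\<sigma> + s"] c s
      unfolding R_def by linarith
  qed
  have Rlim: "(\<lambda>n. R (X n) s) \<longlonglongrightarrow> 0" if X: "X \<longlonglongrightarrow> \<sigma>" "\<And>n. X n \<noteq> \<sigma>" and s: "s < 0" for X s
  proof -
    have "((\<lambda>y. (G0 y - G0 (\<sigma> + s)) /\<^sub>R (y - (\<sigma> + s)) - G1 (\<sigma> + s)) \<longlongrightarrow> 0) (at (\<sigma> + s))"
      using d[of "\<sigma> + s"] \<sigma> s unfolding has_vector_derivative_iff_quotient by auto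
    moreover have "filterlim (\<lambda>n. X n + s) (at (\<sigma> + s)) sequentially"
      unfolding filterlim_at using X by (auto intro!: tendsto_intros)
    ultimately have "(\<lambda>n. (G0 (X n + s) - G0 (\<sigma> + s)) /\<^sub>R (X n + s - (\<sigma> + s)) - G1 (\<sigma> + s)) \<longlonglongrightarrow> 0"
      by (rule filterlim_compose)
    then show ?thesis by (simp add: R_def)
  qed
  have "((\<lambda>x. (kober \<kappa> \<mu> G0 x - kober \<kappa> \<mu> G0 \<sigma>) /\<^sub>R (x - \<sigma>) - kober \<kappa> \<mu> G1 \<sigma>) \<longlongrightarrow> 0) (at \<sigma>)"
    unfolding tendsto_at_iff_sequentially
  proof (intro allI impI)
    fix X :: "nat \<Rightarrow> real" assume X: "\<forall>i. X i \<in> UNIV - {\<sigma>}" "X \<longlonglongrightarrow> \<sigma>"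
    obtain N where N: "\<And>n. n \<ge> N \<Longrightarrow> X n < c"
      using order_tendstoD(2)[OF X(2) c(2)] by (auto simp: eventually_sequentially)
    define Y where "Y n = X (n + N)" for n
    have Y: "Y \<longlonglongrightarrow> \<sigma>" "\<And>n. Y n \<noteq> \<sigma>" "\<And>n. Y n < c"
      using X N LIMSEQ_ignore_initial_segment[OF X(2)] by (auto simp: Y_def[abs_def])
    have "(\<lambda>n. integral {0<..<1} (\<lambda>t. kober_kernel \<kappa> \<mu> t * R (Y n) (ln t))) \<longlonglongrightarrow> integral {0<..<1::real} (\<lambda>t. 0)"
    proof (rule dominated_convergence(2)[where h = "\<lambda>_. 2 * B"])
      show "(\<lambda>t. kober_kernel \<kappa> \<mu> t * R (Y n) (ln t)) integrable_on {0<..<1}" for n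
        using Y(3)[of n] c by (intro intR) auto
      show "(\<lambda>_. 2 * B) integrable_on {0<..<1::real}"
        by (simp add: integrable_on_open_interval_real integrable_on_const)
      show "norm (kober_kernel \<kappa> \<mu> t * R (Y n) (ln t)) \<le> 2 * B" if "t \<in> {0<..<1}" for n t
        using Rbd[of "Y n" "ln t"] Y(2,3)[of n] that by (simp add: norm_mult)
      show "(\<lambda>n. kober_kernel \<kappa> \<mu> t * R (Y n) (ln t)) \<longlonglongrightarrow> 0" if "t \<in> {0<..<1}" for t
        using tendsto_mult_right_zero[OF Rlim[OF Y(1,2)], of "ln t"] that by simp
    qed
    then have "(\<lambda>n. (kober \<kappa> \<mu> G0 (Y n) - kober \<kappa> \<mu> G0 \<sigma>) /\<^sub>R (Y n - \<sigma>) - kober \<kappa> \<mu> G1 \<sigma>) \<longlonglongrightarrow> 0"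
      using lin Y(3) c by (simp add: less_trans[of _ c 0])
    then show "((\<lambda>x. (kober \<kappa> \<mu> G0 x - kober \<kappa> \<mu> G0 \<sigma>) /\<^sub>R (x - \<sigma>) - kober \<kappa> \<mu> G1 \<sigma>) \<circ> X) \<longlonglongrightarrow> 0"
      unfolding Y_def o_def by (rule LIMSEQ_offset)
  qed
  then show ?thesis unfolding has_vector_derivative_iff_quotient .
qed

text \<open>On y^n this is the Beta recursion (a + b) B(a + 1, b) = a B(a, b) with a = n + 1 + i
  \<kappa> and b = 1 - i \<mu>. For general functions it is the vanishing integral of the
  t-derivative of t (1 - t) K(t) G0(\<sigma> + ln t).\<close>

lemma kober_exp_shift:
  assumes G0: "left_tame G0" and G1: "left_tame G1"
    and d: "\<And>s. s < 0 \<Longrightarrow> (G0 has_vector_derivative G1 s) (at s)"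
    and \<sigma>: "\<sigma> < 0"
  shows "kober \<kappa> \<mu> (\<lambda>s. of_real (exp s) * G1 s) \<sigma>
        + (2 - \<i> * of_real (\<mu> - \<kappa>)) * kober \<kappa> \<mu> (\<lambda>s. of_real (exp s) * G0 s) \<sigma>
      = of_real (exp \<sigma>) * (kober \<kappa> \<mu> G1 \<sigma> + (1 + \<i> * \<kappa>) * kober \<kappa> \<mu> G0 \<sigma>)"
proof -
  define K where "K = kober_kernel \<kappa> \<mu>"
  define h where "h t = of_real (t * (1 - t)) * (K t * G0 (\<sigma> + ln t))" for t :: real
  define h' where "h' t = ((1 + \<i> * \<kappa>) * (K t * G0 (\<sigma> + ln t)) + K t * G1 (\<sigma> + ln t))
     - ((2 - \<i> * of_real (\<mu> - \<kappa>)) * (of_real t * (K t * G0 (\<sigma> + ln t))) + of_real t * (K t * G1 (\<sigma> + ln t)))" for t :: real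
  obtain B where B: "B \<ge> 0" "\<And>s. s \<le> \<sigma> \<Longrightarrow> norm (G0 s) \<le> B" using left_tameD[OF G0 \<sigma>] by blast
  have dh: "(h has_vector_derivative h' t) (at t)" if t: "t \<in> {0<..<1}" for t
  proof -
    have t0: "t > 0" "t < 1" using t by auto
    have s: "\<sigma> + ln t < 0" using t0 \<sigma> ln_less_zero[of t] by linarith
    have "((\<lambda>t. \<sigma> + ln t) has_vector_derivative (1 / t)) (at t)"
      unfolding has_real_derivative_iff_has_vector_derivative[symmetric]
      using t0 by (auto intro!: derivative_eq_intros)
    from vector_diff_chain_at[OF this d[OF s]]
    have dG: "((\<lambda>t. G0 (\<sigma> + ln t)) has_vector_derivative (G1 (\<sigma> + ln t) / t)) (at t)"
      by (simp add: o_def scaleR_conv_of_real mult.commute)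
    have "((\<lambda>t. t * (1 - t)) has_real_derivative (1 - 2 * t)) (at t)"
      by (auto intro!: derivative_eq_intros)
    note dp = has_vector_derivative_of_real[OF this, where 'a = complex]
    have "(h has_vector_derivative
       of_real (t * (1 - t)) * (K t * (G1 (\<sigma> + ln t) / t) + (\<i> * \<kappa> / of_real t + \<i> * \<mu> / (1 - of_real t)) * K t * G0 (\<sigma> + ln t))
       + complex_of_real (1 - 2 * t) * (K t * G0 (\<sigma> + ln t))) (at t)"
      unfolding h_def K_def
      by (intro has_vector_derivative_mult dp kober_kernel_has_vector_derivative t dG)
    moreover have "of_real (t * (1 - t)) * (K t * (G1 (\<sigma> + ln t) / t) + (\<i> * \<kappa> / of_real t + \<i> * \<mu> / (1 - of_real t)) * K t * G0 (\<sigma> + ln t))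
       + complex_of_real (1 - 2 * t) * (K t * G0 (\<sigma> + ln t)) = h' t"
    proof -
      have nz: "complex_of_real t \<noteq> 0" "1 - complex_of_real t \<noteq> 0"
        using t0 by (auto simp: complex_eq_iff)
      have e1: "of_real (t * (1 - t)) * (K t * (G1 (\<sigma> + ln t) / t)) = (1 - complex_of_real t) * (K t * G1 (\<sigma> + ln t))"
        using nz by (simp add: field_simps)
      have e2: "complex_of_real (t * (1 - t)) * (\<i> * \<kappa> / of_real t + \<i> * \<mu> / (1 - of_real t))
          = \<i> * \<kappa> * (1 - of_real t) + \<i> * \<mu> * of_real t"
        using nz by (simp add: field_simps)
      have "p * (q + A * k * g) = p * q + (p * A) * (k * g)" for p q A k g :: complex
        by (simp add: algebra_simps)
      then show ?thesis unfolding h'_def by (simp only: e1 e2) (simp add: algebra_simps)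
    qed
    ultimately show ?thesis by simp
  qed
  have "(h' has_integral 0) {0<..<1}"
  proof (rule integral_unit_interval_deriv_eq_0[OF dh])
    show "norm (h t) \<le> B * (t * (1 - t))" if "t \<in> {0<..<1}" for t
      using that B(2)[of "\<sigma> + ln t"]
      by (auto simp: h_def K_def norm_mult abs_mult mult.commute[of B] simp del: of_real_mult of_real_diff
          intro!: mult_left_mono)
  qed (auto simp: h_def)
  moreover have "(h' has_integral
      (((1 + \<i> * \<kappa>) * kober \<kappa> \<mu> G0 \<sigma> + kober \<kappa> \<mu> G1 \<sigma>)
       - ((2 - \<i> * of_real (\<mu> - \<kappa>)) * (kober \<kappa> \<mu> (\<lambda>s. of_real (exp s) * G0 s) \<sigma> / of_real (exp \<sigma>))
          + kober \<kappa> \<mu> (\<lambda>s. of_real (exp s) * G1 s) \<sigma> / of_real (exp \<sigma>)))) {0<..<1}"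
  proof -
    have i: "((\<lambda>t. K t * G (\<sigma> + ln t)) has_integral kober \<kappa> \<mu> G \<sigma>) {0<..<1}"
      if "left_tame G" for G
      unfolding kober_def K_def by (intro integrable_integral kober_integrable that \<sigma>)
    have j: "((\<lambda>t. of_real t * (K t * G (\<sigma> + ln t))) has_integral
        (kober \<kappa> \<mu> (\<lambda>s. of_real (exp s) * G s) \<sigma> / of_real (exp \<sigma>))) {0<..<1}" if "left_tame G" for G
    proof -
      have "((\<lambda>t. K t * (of_real (exp (\<sigma> + ln t)) * G (\<sigma> + ln t)) / of_real (exp \<sigma>)) has_integral
        (kober \<kappa> \<mu> (\<lambda>s. of_real (exp s) * G s) \<sigma> / of_real (exp \<sigma>))) {0<..<1}"
        by (intro has_integral_divide i left_tame_intros that)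
      then show ?thesis
        by (rule has_integral_eq[rotated]) (auto simp: exp_add)
    qed
    show ?thesis unfolding h'_def
      by (intro has_integral_diff has_integral_add has_integral_mult_right i j G0 G1)
  qed
  ultimately have "((1 + \<i> * \<kappa>) * kober \<kappa> \<mu> G0 \<sigma> + kober \<kappa> \<mu> G1 \<sigma>)
       - ((2 - \<i> * of_real (\<mu> - \<kappa>)) * (kober \<kappa> \<mu> (\<lambda>s. of_real (exp s) * G0 s) \<sigma> / of_real (exp \<sigma>))
          + kober \<kappa> \<mu> (\<lambda>s. of_real (exp s) * G1 s) \<sigma> / of_real (exp \<sigma>)) = 0"
    using has_integral_unique by blast
  moreover have "complex_of_real (exp \<sigma>) \<noteq> 0" by simp
  ultimately show ?thesis by (simp add: field_simps)
qed

text \<open>The other Beta recursion, (a + b) B(a, b + 1) = b B(a, b), obtained from the derivative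
  of t (1 - t)^(n+1) K(t); a zero moment propagates upwards.\<close>

lemma kober_kernel_moment_0:
  assumes "integral {0<..<1} (kober_kernel \<kappa> \<mu>) = 0"
  shows "((\<lambda>t. of_real ((1 - t) ^ n) * kober_kernel \<kappa> \<mu> t) has_integral 0) {0<..<1}"
proof (induction n)
  case 0
  have "kober_kernel \<kappa> \<mu> integrable_on {0<..<1}"
    by (rule set_lebesgue_integral_eq_integral(1)[OF absolutely_integrable_bounded_continuous_interval[of _ 1]])
       (simp_all add: continuous_on_kober_kernel)
  then show ?case using assms by (simp add: has_integral_iff)
next
  case (Suc n)
  define K where "K = kober_kernel \<kappa> \<mu>"
  define h where "h t = of_real (t * (1 - t) ^ Suc n) * K t" for t :: real
  define h' where "h' t = (of_nat (n + 2) + \<i> * of_real (\<kappa> - \<mu>)) * (of_real ((1 - t) ^ Suc n) * K t)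
     + (\<i> * \<mu> - of_nat (Suc n)) * (of_real ((1 - t) ^ n) * K t)" for t :: real
  have "(h' has_integral 0) {0<..<1}"
  proof (rule integral_unit_interval_deriv_eq_0)
    fix t :: real assume t: "t \<in> {0<..<1}"
    have "((\<lambda>t. t * (1 - t) ^ Suc n) has_real_derivative ((1 - t) ^ Suc n - of_nat (Suc n) * t * (1 - t) ^ n)) (at t)"
      by (rule DERIV_cong[OF DERIV_mult[OF DERIV_ident DERIV_power_Suc[of "\<lambda>t. 1 - t" "-1"]]])
         (auto intro!: derivative_eq_intros simp: algebra_simps)
    then have "(h has_vector_derivative
        of_real (t * (1 - t) ^ Suc n) * ((\<i> * \<kappa> / of_real t + \<i> * \<mu> / (1 - of_real t)) * K t)
        + of_real ((1 - t) ^ Suc n - of_nat (Suc n) * t * (1 - t) ^ n) * K t) (at t)"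
      unfolding h_def K_def
      by (intro has_vector_derivative_mult has_vector_derivative_of_real kober_kernel_has_vector_derivative t)
    moreover have "of_real (t * (1 - t) ^ Suc n) * ((\<i> * \<kappa> / of_real t + \<i> * \<mu> / (1 - of_real t)) * K t)
        + of_real ((1 - t) ^ Suc n - of_nat (Suc n) * t * (1 - t) ^ n) * K t = h' t"
    proof -
      have nz: "complex_of_real t \<noteq> 0" "1 - complex_of_real t \<noteq> 0"
        using t by (auto simp: complex_eq_iff)
      have "of_real (t * (1 - t) ^ Suc n) * (\<i> * \<kappa> / of_real t + \<i> * \<mu> / (1 - of_real t))
          = of_real ((1 - t) ^ n) * (\<i> * \<kappa> * (1 - of_real t) + \<i> * \<mu> * of_real t)"
        using nz by (simp add: field_simps)
      then have "of_real (t * (1 - t) ^ Suc n) * ((\<i> * \<kappa> / of_real t + \<i> * \<mu> / (1 - of_real t)) * K t)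
          = of_real ((1 - t) ^ n) * (\<i> * \<kappa> * (1 - of_real t) + \<i> * \<mu> * of_real t) * K t"
        by (metis mult.assoc)
      then show ?thesis unfolding h'_def by (simp add: algebra_simps)
    qed
    ultimately show "(h has_vector_derivative h' t) (at t)" by simp
    have "(1 - t) ^ n \<le> 1" using t by (intro power_le_one) auto
    then have "t * (1 - t) ^ Suc n \<le> t * (1 - t)"
      using t mult_left_mono[of "(1 - t) ^ n" 1 "t * (1 - t)"] by (simp add: mult_ac)
    then show "norm (h t) \<le> 1 * (t * (1 - t))"
      using t by (simp add: h_def K_def norm_mult abs_mult norm_power del: of_real_mult of_real_diff of_real_power power_Suc)
  qed (auto simp: h_def)
  from has_integral_diff[OF this has_integral_mult_right[OF Suc, of "\<i> * \<mu> - of_nat (Suc n)"]]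
  have "((\<lambda>t. (of_nat (n + 2) + \<i> * of_real (\<kappa> - \<mu>)) * (of_real ((1 - t) ^ Suc n) * K t)) has_integral 0) {0<..<1}"
    by (simp add: h'_def K_def)
  \<comment> \<open>Its real part is n + 2, so the next moment can be solved for.\<close>
  moreover have nz: "of_nat (n + 2) + \<i> * complex_of_real (\<kappa> - \<mu>) \<noteq> 0"
    by (simp add: complex_eq_iff)
  ultimately show ?case
    using has_integral_mult_right[of _ 0 "{0<..<1}" "inverse (of_nat (n + 2) + \<i> * complex_of_real (\<kappa> - \<mu>))"]
    unfolding K_def by (fastforce simp: mult.assoc[symmetric])
qed

text \<open>If the integral vanished, so would all moments in powers of \<open>1 - t\<close>, and by the Weierstrass theorem the
  kernel would be orthogonal to \<open>t (1 - t)\<close> times its own conjugate.\<close>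

lemma kober_kernel_integral_nonzero: "integral {0<..<1} (kober_kernel \<kappa> \<mu>) \<noteq> 0"
proof
  assume 0: "integral {0<..<1} (kober_kernel \<kappa> \<mu>) = 0"
  define K where "K = kober_kernel \<kappa> \<mu>"
  have poly: "((\<lambda>t. of_real (g (1 - t)) * K t) has_integral 0) {0<..<1}"
    if pg: "real_polynomial_function g" for g
  proof -
    obtain a n where g: "g = (\<lambda>x. \<Sum>i\<le>n. a i * x ^ i)"
      using real_polynomial_function_imp_sum[OF pg] by blast
    have "((\<lambda>t. \<Sum>i\<le>n. of_real (a i) * (of_real ((1 - t) ^ i) * K t)) has_integral (\<Sum>i\<le>n. of_real (a i) * 0)) {0<..<1}"
      unfolding K_def by (intro has_integral_sum has_integral_mult_right kober_kernel_moment_0[OF 0]) auto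
    then show ?thesis
      by (simp add: g sum_distrib_right mult.assoc)
  qed
  define h where "h t = of_real (t * (1 - t)) * cnj (K t)" for t :: real
  have conth: "continuous_on {0..1} h"
  proof (rule continuous_on_unit_interval_of_bound)
    fix t :: real assume "t \<in> {0<..<1}"
    then have "isCont K t"
      unfolding K_def by (rule has_vector_derivative_continuous[OF kober_kernel_has_vector_derivative])
    then show "isCont h t" unfolding h_def by (intro continuous_intros)
  next
    show "norm (h t) \<le> 1 * (t * (1 - t))" if "t \<in> {0..1}" for t
      using that by (auto simp: h_def K_def norm_mult abs_mult simp del: of_real_mult of_real_diff)
  qed
  have contr: "continuous_on {0..1} (\<lambda>x. h (1 - x))"
    by (rule continuous_on_compose2[OF conth]) (auto intro!: continuous_intros)
  \<comment> \<open>The integral of \<open>h t * K t\<close> is that of t (1 - t), namely 1/6.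
    Errors of 1/24 in the real and in the imaginary part can change it by at most 1/12.\<close>
  obtain g1 where g1: "real_polynomial_function g1"
      "\<And>x::real. x \<in> {0..1} \<Longrightarrow> \<bar>Re (h (1 - x)) - g1 x\<bar> < 1/24"
    by (rule Stone_Weierstrass_real_polynomial_function[of "{0..1}" "\<lambda>x. Re (h (1 - x))" "1/24"])
       (auto intro!: continuous_intros contr)
  obtain g2 where g2: "real_polynomial_function g2"
      "\<And>x::real. x \<in> {0..1} \<Longrightarrow> \<bar>Im (h (1 - x)) - g2 x\<bar> < 1/24"
    by (rule Stone_Weierstrass_real_polynomial_function[of "{0..1}" "\<lambda>x. Im (h (1 - x))" "1/24"])
       (auto intro!: continuous_intros contr)
  define E where "E t = (h t - (of_real (g1 (1 - t)) + \<i> * of_real (g2 (1 - t)))) * K t" for t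
  have "((\<lambda>t. of_real (g1 (1 - t)) * K t + \<i> * (of_real (g2 (1 - t)) * K t)) has_integral 0 + \<i> * 0) {0<..<1}"
    by (intro has_integral_add has_integral_mult_right poly g1 g2)
  moreover have "((\<lambda>t. h t * K t) has_integral of_real (1 / 6)) {0<..<1}"
  proof -
    have "((\<lambda>t::real. t * (1 - t)) has_integral ((1^2/2 - 1^3/3) - (0^2/2 - 0^3/3))) {0..1}"
      by (rule fundamental_theorem_of_calculus[of 0 1 "\<lambda>t. t^2/2 - t^3/3"])
         (auto intro!: derivative_eq_intros simp: has_real_derivative_iff_has_vector_derivative[symmetric]
            power2_eq_square algebra_simps)
    then have "((\<lambda>t::real. t * (1 - t)) has_integral 1/6) {0<..<1}"
      using has_integral_Icc_iff_Ioo[of "\<lambda>t. t * (1 - t)" "1/6::real" 0 1] by simp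
    then have "((\<lambda>t::real. complex_of_real (t * (1 - t))) has_integral of_real (1/6)) {0<..<1}"
      by (rule has_integral_of_real)
    moreover have "h t * K t = of_real (t * (1 - t))" for t
    proof -
      have "cnj (K t) * K t = 1"
        using complex_norm_square[of "K t"] by (simp add: K_def mult.commute)
      then show ?thesis by (simp add: h_def mult.assoc)
    qed
    ultimately show ?thesis by simp
  qed
  ultimately have "(E has_integral of_real (1 / 6)) {0<..<1}"
    using has_integral_diff[of "\<lambda>t. h t * K t" "of_real (1/6)" "{0<..<1}"
        "\<lambda>t. of_real (g1 (1 - t)) * K t + \<i> * (of_real (g2 (1 - t)) * K t)" 0]
    by (simp add: E_def[abs_def] algebra_simps)
  moreover have "norm (integral {0<..<1} E) \<le> 1 / 12"
  proof (rule norm_integral_unit_interval_le)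
    have "continuous_on {0<..<1} (\<lambda>t. g (1 - t))" if "real_polynomial_function g" for g :: "real \<Rightarrow> real"
      by (rule continuous_on_compose2[of UNIV g])
         (use that in \<open>auto simp: real_polynomial_function_eq intro!: continuous_intros continuous_on_polymonial_function\<close>)
    note contg = this[OF g1(1)] this[OF g2(1)]
    show "continuous_on {0<..<1} E"
      unfolding E_def K_def
      by (intro continuous_intros continuous_on_kober_kernel continuous_on_subset[OF conth] contg) auto
    show "norm (E t) \<le> 1 / 12" if t: "t \<in> {0<..<1}" for t
    proof -
      have "norm (E t) = norm (h t - (of_real (g1 (1 - t)) + \<i> * of_real (g2 (1 - t))))"
        by (simp add: E_def K_def norm_mult)
      also have "\<dots> \<le> \<bar>Re (h t) - g1 (1 - t)\<bar> + \<bar>Im (h t) - g2 (1 - t)\<bar>"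
        by (rule order_trans[OF cmod_le]) simp
      finally show ?thesis using g1(2)[of "1 - t"] g2(2)[of "1 - t"] t by simp
    qed
  qed
  ultimately have "norm (complex_of_real (1 / 6)) \<le> 1 / 12" by (metis integral_unique)
  then show False unfolding norm_of_real by simp
qed

section \<open>Limits and bounds of the transform\<close>

lemma left_tame_of_limit:
  assumes "continuous_on {..<0} G" "(G \<longlongrightarrow> L) at_bot"
  shows "left_tame G"
  unfolding left_tame_def
proof (intro conjI allI impI)
  fix c :: real assume c: "c < 0"
  obtain N where N: "\<And>s. s \<le> N \<Longrightarrow> dist (G s) L < 1"
    using tendstoD[OF assms(2), of 1] by (auto simp: eventually_at_bot_linorder)
  have "compact (G ` {N..c})"
    using c by (intro compact_continuous_image continuous_on_subset[OF assms(1)]) auto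
  then have "bounded (G ` {N..c})" by (rule compact_imp_bounded)
  then obtain B where B: "\<And>s. s \<in> {N..c} \<Longrightarrow> norm (G s) \<le> B"
    unfolding bounded_iff by fast
  have "norm (G s) \<le> max B (1 + norm L)" if "s \<le> c" for s
  proof (cases "s \<le> N")
    case True
    then show ?thesis using N[of s] norm_triangle_ineq[of "G s - L" L] by (simp add: dist_norm)
  qed (use B[of s] that in auto)
  then show "\<exists>B. \<forall>s\<le>c. norm (G s) \<le> B" by blast
qed (fact assms)

lemma kober_tendsto_at_bot:
  assumes G: "left_tame G" and L: "(G \<longlongrightarrow> L) at_bot"
  shows "(kober \<kappa> \<mu> G \<longlongrightarrow> L * integral {0<..<1} (kober_kernel \<kappa> \<mu>)) at_bot"
proof (rule tendstoI)
  fix e :: real assume e: "e > 0"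
  obtain N where N: "\<And>s. s \<le> N \<Longrightarrow> dist (G s) L < e/2"
    using tendstoD[OF L, of "e/2"] e by (auto simp: eventually_at_bot_linorder)
  have "dist (kober \<kappa> \<mu> G \<sigma>) (L * integral {0<..<1} (kober_kernel \<kappa> \<mu>)) < e" if \<sigma>: "\<sigma> \<le> N" "\<sigma> < 0" for \<sigma>
  proof -
    have "kober \<kappa> \<mu> (\<lambda>s. G s + (- L)) \<sigma> = kober \<kappa> \<mu> G \<sigma> + kober \<kappa> \<mu> (\<lambda>_. - L) \<sigma>"
      by (rule kober_add[OF G left_tame_const \<sigma>(2)])
    also have "kober \<kappa> \<mu> (\<lambda>_. - L) \<sigma> = - (L * integral {0<..<1} (kober_kernel \<kappa> \<mu>))"
      by (simp add: kober_def mult.commute)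
    finally have "kober \<kappa> \<mu> G \<sigma> - L * integral {0<..<1} (kober_kernel \<kappa> \<mu>) = kober \<kappa> \<mu> (\<lambda>s. G s + (- L)) \<sigma>"
      by simp
    moreover have "norm (kober \<kappa> \<mu> (\<lambda>s. G s + (- L)) \<sigma>) \<le> e / 2"
      using N \<sigma> by (intro kober_norm_le left_tame_intros G) (auto simp: dist_norm intro: less_imp_le)
    ultimately show ?thesis using e by (simp add: dist_norm)
  qed
  then show "\<forall>\<^sub>F \<sigma> in at_bot. dist (kober \<kappa> \<mu> G \<sigma>) (L * integral {0<..<1} (kober_kernel \<kappa> \<mu>)) < e"
    unfolding eventually_at_bot_linorder by (intro exI[of _ "min N (-1)"]) auto
qed

lemma kober_linear3:
  assumes "left_tame F" "left_tame G" "left_tame H" "\<sigma> < 0"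
  shows "kober \<kappa> \<mu> (\<lambda>s. a * F s + b * G s + c * H s) \<sigma>
    = a * kober \<kappa> \<mu> F \<sigma> + b * kober \<kappa> \<mu> G \<sigma> + c * kober \<kappa> \<mu> H \<sigma>"
  using assms by (simp add: kober_add kober_cmult left_tame_intros)

lemma has_vector_derivative_exp_mult:
  assumes "(G has_vector_derivative G') (at s)"
  shows "((\<lambda>s. complex_of_real (exp s) * G s) has_vector_derivative of_real (exp s) * (G s + G')) (at s)"
proof -
  have "(exp has_real_derivative exp s) (at s)" by (rule DERIV_exp)
  from has_vector_derivative_mult[OF has_vector_derivative_of_real[OF this] assms]
  show ?thesis by (simp add: algebra_simps)
qed

lemma has_vector_derivative_zero_on_neg:
  fixes f :: "real \<Rightarrow> complex"
  assumes "\<And>s. s < 0 \<Longrightarrow> f s = 0" "(f has_vector_derivative f') (at \<sigma>)" "\<sigma> < 0"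
  shows "f' = 0"
proof -
  have "((\<lambda>_. 0) has_vector_derivative f') (at \<sigma>)"
    by (rule has_vector_derivative_transform_within_open[OF assms(2), of "{..<0}"]) (use assms in auto)
  then show ?thesis using vector_derivative_unique_at has_vector_derivative_const by blast
qed

text \<open>The average over dilations gains one power: the integral of (1 - t y)^(-2) over 0 < t <
  1 is 1/(1 - y). This controls the transform of the second derivative near y = 1.\<close>

lemma kober_norm_le_of_inverse_square:
  assumes G: "left_tame G" and \<sigma>: "\<sigma> < 0"
    and B: "\<And>s. s < 0 \<Longrightarrow> norm (of_real ((1 - exp s)^2) * G s) \<le> K"
  shows "norm (kober \<kappa> \<mu> G \<sigma>) \<le> K / (1 - exp \<sigma>)"
proof -
  define y where "y = exp \<sigma>"
  have y: "0 < y" "y < 1" using \<sigma> by (auto simp: y_def)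
  have ty: "1 - t * y > 0" if "t \<in> {0..1}" for t
  proof -
    have "t * y \<le> 1 * y" using that y by (intro mult_right_mono) auto
    then show ?thesis using y by linarith
  qed
  have "((\<lambda>t. K / (1 - t * y)^2) has_integral (K * 1 / (1 - 1 * y) - K * 0 / (1 - 0 * y))) {0..1}"
  proof (rule fundamental_theorem_of_calculus)
    fix t :: real assume t: "t \<in> {0..1}"
    have "((\<lambda>t. K * t / (1 - t * y)) has_real_derivative K / (1 - t * y)^2) (at t)"
      using ty[OF t] by (auto intro!: derivative_eq_intros simp: field_simps power2_eq_square)
    then show "((\<lambda>t. K * t / (1 - t * y)) has_vector_derivative K / (1 - t * y)^2) (at t within {0..1})"
      by (simp add: has_real_derivative_iff_has_vector_derivative has_vector_derivative_at_within)
  qed simp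
  then have I: "((\<lambda>t. K / (1 - t * y)^2) has_integral K / (1 - y)) {0<..<1}"
    using has_integral_Icc_iff_Ioo[of "\<lambda>t. K / (1 - t * y)^2" "K / (1 - y)" 0 1] by simp
  have "norm (kober \<kappa> \<mu> G \<sigma>) \<le> integral {0<..<1} (\<lambda>t. K / (1 - t * y)^2)"
    unfolding kober_def
  proof (rule integral_norm_bound_integral[OF kober_integrable[OF G \<sigma>]])
    show "(\<lambda>t. K / (1 - t * y)^2) integrable_on {0<..<1}" using I by blast
    fix t :: real assume t: "t \<in> {0<..<1}"
    then have "ln t < 0" by simp
    then have s: "\<sigma> + ln t < 0" using \<sigma> by linarith
    have e: "exp (\<sigma> + ln t) = t * y" using t by (simp add: exp_add y_def)
    have "(1 - t * y)^2 * norm (G (\<sigma> + ln t)) \<le> K"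
      using B[OF s] unfolding e norm_mult norm_of_real by simp
    then show "norm (kober_kernel \<kappa> \<mu> t * G (\<sigma> + ln t)) \<le> K / (1 - t * y)^2"
      using ty[of t] t by (simp add: norm_mult field_simps)
  qed
  then show ?thesis using I by (simp add: integral_unique y_def)
qed

text \<open>On power series in \<open>y = exp \<sigma>\<close> the operator \<open>\<theta> + 1 - \<i> \<epsilon>\<close> after \<open>kober \<kappa> (\<epsilon> + \<kappa>)\<close> multiplies the \<open>n\<close>-th coefficient by
  a constant times \<open>(1 + \<i>\<kappa>)\<^sub>n / (1 - \<i>\<epsilon>)\<^sub>n\<close>.  This exchanges two exponents in the three-term recurrence
  of the confluent Heun equation; below, that statement is composed with \<open>\<theta> + \<i>\<kappa>\<close>.\<close>

lemma kober_intertwining: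
  fixes F :: "nat \<Rightarrow> real \<Rightarrow> complex" and \<kappa> \<epsilon> :: real and b c :: complex
  defines "g \<equiv> \<lambda>k. kober \<kappa> (\<epsilon> + \<kappa>) (F k)"
  assumes tame: "\<And>k. k \<le> 4 \<Longrightarrow> left_tame (F k)"
    and d: "\<And>k s. k < 4 \<Longrightarrow> s < 0 \<Longrightarrow> (F k has_vector_derivative F (Suc k) s) (at s)"
    and ode: "\<And>s. s < 0 \<Longrightarrow> (F 2 s + \<i> * \<kappa> * F 1 s + 0 * F 0 s)
        + of_real (exp s) * (- 2 * F 2 s + b * F 1 s + c * F 0 s)
        + of_real (exp s) * (of_real (exp s) * (F 2 s + (2 + \<i> * \<kappa> - \<i> * \<epsilon>) * F 1 s + (1 - \<i> * \<epsilon>) * (1 + \<i> * \<kappa>) * F 0 s)) = 0"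
    and \<sigma>: "\<sigma> < 0"
  defines "f \<equiv> \<lambda>k. g (Suc k) \<sigma> + (1 - \<i> * \<epsilon>) * g k \<sigma>"
  shows "(f 3 - \<i> * \<epsilon> * f 2) + \<i> * \<kappa> * (f 2 - \<i> * \<epsilon> * f 1)
     + of_real (exp \<sigma>) * ((- 2 * f 3 + b * f 2 + c * f 1) + (1 + \<i> * \<kappa>) * (- 2 * f 2 + b * f 1 + c * f 0))
     + of_real (exp \<sigma>) * (of_real (exp \<sigma>) * ((f 3 + 2 * (1 + \<i> * \<kappa>) * f 2 + (1 + \<i> * \<kappa>)^2 * f 1)
        + (2 + \<i> * \<kappa>) * (f 2 + 2 * (1 + \<i> * \<kappa>) * f 1 + (1 + \<i> * \<kappa>)^2 * f 0))) = 0"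
proof -
  define S where "S = kober \<kappa> (\<epsilon> + \<kappa>)"
  define y where "y s = complex_of_real (exp s)" for s
  \<comment> \<open>\<open>P a b c j\<close> is \<theta>^j of the constant-coefficient operator a
    \<theta>^2 + b \<theta> + c applied to \<open>F 0\<close>, and \<open>Q\<close> is the same for
    the transform. The indices 0, 1, 2 below are the powers of y that multiply them in the
    equation.\<close>
  define P where "P a b c j s = a * F (j + 2) s + b * F (j + 1) s + c * F j s" for a b c and j :: nat and s
  define Q where "Q a b c j s = a * g (j + 2) s + b * g (j + 1) s + c * g j s" for a b c and j :: nat and s
  define P0 where "P0 = P 1 (\<i> * \<kappa>) 0"
  define P1 where "P1 = P (- 2) b c"
  define P2 where "P2 = P 1 (2 + \<i> * \<kappa> - \<i> * \<epsilon>) ((1 - \<i> * \<epsilon>) * (1 + \<i> * \<kappa>))"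
  define Q0 where "Q0 = Q 1 (\<i> * \<kappa>) 0"
  define Q1 where "Q1 = Q (- 2) b c"
  define Q2 where "Q2 = Q 1 (2 + \<i> * \<kappa> - \<i> * \<epsilon>) ((1 - \<i> * \<epsilon>) * (1 + \<i> * \<kappa>))"
  have tP: "left_tame (P a b c j)" if "j \<le> 2" for a b c j
    unfolding P_def using that by (intro left_tame_intros tame) auto
  have SP: "S (P a b c j) s = Q a b c j s" if "j \<le> 2" "s < 0" for a b c j s
    unfolding P_def Q_def S_def g_def using that by (intro kober_linear3 tame) auto
  have dP: "(P a b c j has_vector_derivative P a b c (Suc j) s) (at s)" if "j \<le> 1" "s < 0" for a b c j s
    unfolding P_def using that d[of "j + 2" s] d[of "j + 1" s] d[of j s]
    by (intro has_vector_derivative_add has_vector_derivative_mult_right) auto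
  have dS: "(S G has_vector_derivative S G' s) (at s)"
    if "left_tame G" "left_tame G'" "\<And>s. s < 0 \<Longrightarrow> (G has_vector_derivative G' s) (at s)" "s < 0" for G G' s
    unfolding S_def by (rule kober_has_vector_derivative[OF that])
  have ty: "left_tame y" unfolding y_def by (rule left_tame_exp)
  have dy: "((\<lambda>s. y s * G s) has_vector_derivative (y s * (G s + G'))) (at s)"
    if "(G has_vector_derivative G') (at s)" for G G' s
    unfolding y_def by (rule has_vector_derivative_exp_mult[OF that])
  \<comment> \<open>The form (\<theta> + 1 - i \<epsilon>) S(y G) = y (\<theta> + 1 + i \<kappa>) S
    G of the shift rule: here 2 - i (\<mu> - \<kappa>) is 2 - i \<epsilon>, and moving \<theta> past
    y removes 1.\<close>
  have shift: "S (\<lambda>s. y s * (G s + G' s)) s + (1 - \<i> * \<epsilon>) * S (\<lambda>s. y s * G s) s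
      = y s * (S G' s + (1 + \<i> * \<kappa>) * S G s)"
    if G: "left_tame G" "left_tame G'" and "\<And>s. s < 0 \<Longrightarrow> (G has_vector_derivative G' s) (at s)"
      and s: "s < 0" for G G' s
  proof -
    have "S (\<lambda>s. y s * (G s + G' s)) s = S (\<lambda>s. y s * G s) s + S (\<lambda>s. y s * G' s) s"
      unfolding S_def distrib_left by (intro kober_add left_tame_intros ty G s)
    then show ?thesis
      using kober_exp_shift[OF that, of \<kappa> "\<epsilon> + \<kappa>"] unfolding S_def y_def by (simp add: algebra_simps)
  qed
  \<comment> \<open>The y^2 term needs the shift rule twice. After the first use one factor y
    remains under the transform; \<open>h0\<close>, \<open>h1\<close>, \<open>h2\<close> are that
    remainder and its first two derivatives.\<close>
  define h0 where "h0 = S (\<lambda>s. y s * P2 0 s)"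
  define h1 where "h1 = S (\<lambda>s. y s * (P2 0 s + P2 1 s))"
  define h2 where "h2 = S (\<lambda>s. y s * ((P2 0 s + P2 1 s) + (P2 1 s + P2 2 s)))"
  have tP2: "left_tame (P2 j)" and tP1: "left_tame (P1 j)" and tP0: "left_tame (P0 j)" if "j \<le> 2" for j
    unfolding P0_def P1_def P2_def using tP[OF that] by auto
  have dP2: "(P2 j has_vector_derivative P2 (Suc j) s) (at s)"
    and dP1: "(P1 j has_vector_derivative P1 (Suc j) s) (at s)"
    if "j \<le> 1" "s < 0" for j s
    unfolding P1_def P2_def using dP[OF that] by auto
  have SP2: "S (P2 j) s = Q2 j s" and SP1: "S (P1 j) s = Q1 j s" and SP0: "S (P0 j) s = Q0 j s"
    if "j \<le> 2" "s < 0" for j s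
    unfolding P0_def P1_def P2_def Q0_def Q1_def Q2_def using SP[OF that] by auto
  have dQ: "(Q a b c j has_vector_derivative Q a b c (Suc j) s) (at s)" if "j \<le> 1" "s < 0" for a b c j s
  proof -
    have "(S (P a b c j) has_vector_derivative S (P a b c (Suc j)) s) (at s)"
      using that by (intro dS tP dP) auto
    then have "(S (P a b c j) has_vector_derivative Q a b c (Suc j) s) (at s)"
      using SP[of "Suc j" s] that by simp
    then show ?thesis
      by (rule has_vector_derivative_transform_within_open[of _ _ _ "{..<0}"]) (use that SP[of j] in auto)
  qed
  have tyP2: "left_tame (\<lambda>s. y s * P2 0 s)" "left_tame (\<lambda>s. y s * (P2 0 s + P2 1 s))"
    "left_tame (\<lambda>s. y s * ((P2 0 s + P2 1 s) + (P2 1 s + P2 2 s)))"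
    by (intro left_tame_intros ty tP2; simp)+
  have ds: "(P2 0 has_vector_derivative P2 1 s) (at s)" "(P2 1 has_vector_derivative P2 2 s) (at s)"
    "(P1 0 has_vector_derivative P1 1 s) (at s)" if "s < 0" for s
    using dP2[of 0 s] dP2[of 1 s] dP1[of 0 s] that by (simp_all add: numeral_2_eq_2)
  note dyP2 = dy[OF ds(1)]
  note dyP2' = dy[OF has_vector_derivative_add[OF ds(1,2)]]
  have dh0: "(h0 has_vector_derivative h1 s) (at s)" if "s < 0" for s
    unfolding h0_def h1_def by (rule dS[OF tyP2(1,2) dyP2 that])
  have dh1: "(h1 has_vector_derivative h2 s) (at s)" if "s < 0" for s
    unfolding h1_def h2_def by (rule dS[OF tyP2(2,3) dyP2' that])
  have yP1: "left_tame (\<lambda>s. y s * P1 0 s)" "left_tame (\<lambda>s. y s * (P1 0 s + P1 1 s))"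
    by (intro left_tame_intros ty tP1; simp)+
  have yyP2: "left_tame (\<lambda>s. y s * (y s * P2 0 s))"
    "left_tame (\<lambda>s. y s * (y s * P2 0 s + y s * (P2 0 s + P2 1 s)))"
    by (intro left_tame_intros ty tP2; simp)+
  define k1 where "k1 = S (\<lambda>s. y s * P1 0 s)"
  define k2 where "k2 = S (\<lambda>s. y s * (y s * P2 0 s))"
  \<comment> \<open>The transform of the whole differential equation.\<close>
  have Z: "Q0 0 s + k1 s + k2 s = 0" if s: "s < 0" for s
  proof -
    have "S (\<lambda>s. P0 0 s + y s * P1 0 s + y s * (y s * P2 0 s)) s = S (P0 0) s + k1 s + k2 s"
      unfolding S_def k1_def k2_def
      by (subst kober_add[OF left_tame_add[OF tP0 yP1(1)] yyP2(1) s], simp,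
          subst kober_add[OF tP0 yP1(1) s], simp, rule refl)
    moreover have "S (\<lambda>s. P0 0 s + y s * P1 0 s + y s * (y s * P2 0 s)) s = S (\<lambda>_. 0) s"
      unfolding S_def kober_def
    proof (rule integral_cong)
      fix t :: real assume "t \<in> {0<..<1}"
      then have "ln t < 0" by simp
      then have "s + ln t < 0" using s by linarith
      from ode[OF this]
      have "P0 0 (s + ln t) + y (s + ln t) * P1 0 (s + ln t) + y (s + ln t) * (y (s + ln t) * P2 0 (s + ln t)) = 0"
        by (simp add: P0_def P1_def P2_def P_def y_def numeral_2_eq_2)
      then show "kober_kernel \<kappa> (\<epsilon> + \<kappa>) t * (P0 0 (s + ln t) + y (s + ln t) * P1 0 (s + ln t)
           + y (s + ln t) * (y (s + ln t) * P2 0 (s + ln t))) = kober_kernel \<kappa> (\<epsilon> + \<kappa>) t * 0" by simp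
    qed
    moreover have "S (\<lambda>_. 0) s = 0" by (simp add: S_def kober_def)
    ultimately show ?thesis using SP0[of 0 s] s by simp
  qed
  have dk1: "(k1 has_vector_derivative S (\<lambda>s. y s * (P1 0 s + P1 1 s)) s) (at s)" if "s < 0" for s
    unfolding k1_def by (rule dS[OF yP1 dy[OF ds(3)] that])
  have dk2: "(k2 has_vector_derivative S (\<lambda>s. y s * (y s * P2 0 s + y s * (P2 0 s + P2 1 s))) s) (at s)"
    if "s < 0" for s
    unfolding k2_def by (rule dS[OF yyP2 dy[OF dyP2] that])
  \<comment> \<open>\<theta> + 1 - i \<epsilon> applied to \<open>Z\<close>; each of the last two
    terms releases one factor y.\<close>
  have Z1: "(Q0 1 s + (1 - \<i> * \<epsilon>) * Q0 0 s) + y s * ((Q1 1 s + (1 + \<i> * \<kappa>) * Q1 0 s) + (h1 s + (1 + \<i> * \<kappa>) * h0 s)) = 0"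
    if s: "s < 0" for s
  proof -
    have "((\<lambda>s. Q0 0 s + k1 s + k2 s) has_vector_derivative Q0 1 s + S (\<lambda>s. y s * (P1 0 s + P1 1 s)) s
        + S (\<lambda>s. y s * (y s * P2 0 s + y s * (P2 0 s + P2 1 s))) s) (at s)"
      using dQ[of 0 s 1 "\<i> * \<kappa>" 0] s
      by (intro has_vector_derivative_add dk1 dk2) (simp_all add: Q0_def)
    from has_vector_derivative_zero_on_neg[OF Z this s]
    have z: "Q0 1 s + S (\<lambda>s. y s * (P1 0 s + P1 1 s)) s
        + S (\<lambda>s. y s * (y s * P2 0 s + y s * (P2 0 s + P2 1 s))) s = 0" .
    have "S (\<lambda>s. y s * (P1 0 s + P1 1 s)) s + (1 - \<i> * \<epsilon>) * k1 s = y s * (Q1 1 s + (1 + \<i> * \<kappa>) * Q1 0 s)"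
      unfolding k1_def using shift[OF tP1 tP1 ds(3) s] SP1[of 0 s] SP1[of 1 s] s by simp
    moreover have "S (\<lambda>s. y s * (y s * P2 0 s + y s * (P2 0 s + P2 1 s))) s + (1 - \<i> * \<epsilon>) * k2 s
        = y s * (h1 s + (1 + \<i> * \<kappa>) * h0 s)"
      unfolding k2_def h0_def h1_def by (rule shift[OF tyP2(1,2) dyP2 s])
    moreover have "a1 + A + B = 0 \<Longrightarrow> a0 + l1 + l2 = 0 \<Longrightarrow> A + c * l1 = w * X \<Longrightarrow> B + c * l2 = w * Y
        \<Longrightarrow> (a1 + c * a0) + w * (X + Y) = 0" for a1 A B a0 l1 l2 c w X Y :: complex
      by algebra
    ultimately show ?thesis using z Z[OF s] by blast
  qed
  have m0: "h1 s + (1 - \<i> * \<epsilon>) * h0 s = y s * (Q2 1 s + (1 + \<i> * \<kappa>) * Q2 0 s)" if s: "s < 0" for s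
    unfolding h1_def h0_def using shift[OF tP2 tP2 ds(1) s] SP2[of 0 s] SP2[of 1 s] s by simp
  have dQ2: "((\<lambda>s. Q2 1 s + (1 + \<i> * \<kappa>) * Q2 0 s) has_vector_derivative (Q2 2 s + (1 + \<i> * \<kappa>) * Q2 1 s)) (at s)"
    and dQ1: "((\<lambda>s. Q1 1 s + (1 + \<i> * \<kappa>) * Q1 0 s) has_vector_derivative (Q1 2 s + (1 + \<i> * \<kappa>) * Q1 1 s)) (at s)"
    and dQ0: "((\<lambda>s. Q0 1 s + (1 - \<i> * \<epsilon>) * Q0 0 s) has_vector_derivative (Q0 2 s + (1 - \<i> * \<epsilon>) * Q0 1 s)) (at s)"
    if "s < 0" for s
  proof -
    have dq: "(Q a b c 0 has_vector_derivative Q a b c 1 s) (at s)" "(Q a b c 1 has_vector_derivative Q a b c 2 s) (at s)"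
      for a b c
      using dQ[of 0 s] dQ[of 1 s] that by (simp_all add: numeral_2_eq_2)
    show
      "((\<lambda>s. Q2 1 s + (1 + \<i> * \<kappa>) * Q2 0 s) has_vector_derivative (Q2 2 s + (1 + \<i> * \<kappa>) * Q2 1 s)) (at s)"
      "((\<lambda>s. Q1 1 s + (1 + \<i> * \<kappa>) * Q1 0 s) has_vector_derivative (Q1 2 s + (1 + \<i> * \<kappa>) * Q1 1 s)) (at s)"
      "((\<lambda>s. Q0 1 s + (1 - \<i> * \<epsilon>) * Q0 0 s) has_vector_derivative (Q0 2 s + (1 - \<i> * \<epsilon>) * Q0 1 s)) (at s)"
      unfolding Q0_def Q1_def Q2_def
      by (intro has_vector_derivative_add has_vector_derivative_mult_right dq)+
  qed
  \<comment> \<open>The derivative of \<open>m0\<close>.\<close>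
  have m1: "h2 \<sigma> + (1 - \<i> * \<epsilon>) * h1 \<sigma> = y \<sigma> * ((Q2 1 \<sigma> + (1 + \<i> * \<kappa>) * Q2 0 \<sigma>) + (Q2 2 \<sigma> + (1 + \<i> * \<kappa>) * Q2 1 \<sigma>))"
  proof -
    have "((\<lambda>s. (h1 s + (1 - \<i> * \<epsilon>) * h0 s) - y s * (Q2 1 s + (1 + \<i> * \<kappa>) * Q2 0 s)) has_vector_derivative
        (h2 \<sigma> + (1 - \<i> * \<epsilon>) * h1 \<sigma>) - y \<sigma> * ((Q2 1 \<sigma> + (1 + \<i> * \<kappa>) * Q2 0 \<sigma>) + (Q2 2 \<sigma> + (1 + \<i> * \<kappa>) * Q2 1 \<sigma>))) (at \<sigma>)"
      using \<sigma> by (intro has_vector_derivative_diff has_vector_derivative_add has_vector_derivative_mult_right dh0 dh1 dy dQ2)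
    from has_vector_derivative_zero_on_neg[OF _ this \<sigma>] m0 show ?thesis by simp
  qed
  have "((\<lambda>s. (Q0 1 s + (1 - \<i> * \<epsilon>) * Q0 0 s) + y s * ((Q1 1 s + (1 + \<i> * \<kappa>) * Q1 0 s) + (h1 s + (1 + \<i> * \<kappa>) * h0 s)))
     has_vector_derivative (Q0 2 \<sigma> + (1 - \<i> * \<epsilon>) * Q0 1 \<sigma>) + y \<sigma> * (((Q1 1 \<sigma> + (1 + \<i> * \<kappa>) * Q1 0 \<sigma>) + (h1 \<sigma> + (1 + \<i> * \<kappa>) * h0 \<sigma>))
        + ((Q1 2 \<sigma> + (1 + \<i> * \<kappa>) * Q1 1 \<sigma>) + (h2 \<sigma> + (1 + \<i> * \<kappa>) * h1 \<sigma>)))) (at \<sigma>)"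
    using \<sigma> by (intro has_vector_derivative_add dQ0 dy dQ1 dh0 dh1 has_vector_derivative_mult_right)
  from has_vector_derivative_zero_on_neg[OF Z1 this \<sigma>]
  have z1: "(Q0 2 \<sigma> + (1 - \<i> * \<epsilon>) * Q0 1 \<sigma>) + y \<sigma> * (((Q1 1 \<sigma> + (1 + \<i> * \<kappa>) * Q1 0 \<sigma>) + (h1 \<sigma> + (1 + \<i> * \<kappa>) * h0 \<sigma>))
        + ((Q1 2 \<sigma> + (1 + \<i> * \<kappa>) * Q1 1 \<sigma>) + (h2 \<sigma> + (1 + \<i> * \<kappa>) * h1 \<sigma>))) = 0" .
  \<comment> \<open>\<theta> - i \<epsilon> applied to \<open>Z1\<close>. Passing the outer factor y
    raises this operator to \<theta> + 1 - i \<epsilon>, just what \<open>m0\<close> and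
    \<open>m1\<close> need to release the second y.\<close>
  have *: "(Q0 2 \<sigma> + (1 - \<i> * \<epsilon>) * Q0 1 \<sigma>) - \<i> * \<epsilon> * (Q0 1 \<sigma> + (1 - \<i> * \<epsilon>) * Q0 0 \<sigma>)
     + y \<sigma> * ((Q1 2 \<sigma> + (1 + \<i> * \<kappa>) * Q1 1 \<sigma>) + (1 - \<i> * \<epsilon>) * (Q1 1 \<sigma> + (1 + \<i> * \<kappa>) * Q1 0 \<sigma>))
     + y \<sigma> * (y \<sigma> * ((Q2 2 \<sigma> + (1 + \<i> * \<kappa>) * Q2 1 \<sigma>) + (2 + \<i> * \<kappa>) * (Q2 1 \<sigma> + (1 + \<i> * \<kappa>) * Q2 0 \<sigma>))) = 0"
  proof -
    have "p1 + w * ((q0 + (l1 + k * l0)) + (q1 + (l2 + k * l1))) = 0 \<Longrightarrow> p0 + w * (q0 + (l1 + k * l0)) = 0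
       \<Longrightarrow> l1 + (1 - e) * l0 = w * n0 \<Longrightarrow> l2 + (1 - e) * l1 = w * (n0 + n1)
       \<Longrightarrow> (p1 - e * p0) + w * (q1 + (1 - e) * q0) + w * (w * (n1 + (1 + k) * n0)) = 0"
      for p1 p0 w q0 q1 l0 l1 l2 n0 n1 e k :: complex
      by algebra
    from this[OF z1 Z1[OF \<sigma>] m0[OF \<sigma>] m1] show ?thesis by (simp add: add.assoc[symmetric])
  qed
  have F: "f k = g (Suc k) \<sigma> + (1 - \<i> * \<epsilon>) * g k \<sigma>" for k by (simp add: f_def)
  have q2: "Q a b c 2 \<sigma> = a * g 4 \<sigma> + b * g 3 \<sigma> + c * g 2 \<sigma>"
    and q1: "Q a b c 1 \<sigma> = a * g 3 \<sigma> + b * g 2 \<sigma> + c * g 1 \<sigma>"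
    and q0: "Q a b c 0 \<sigma> = a * g 2 \<sigma> + b * g 1 \<sigma> + c * g 0 \<sigma>" for a b c
    by (simp_all add: Q_def eval_nat_numeral)
  have f: "f 0 = g 1 \<sigma> + (1 - \<i> * \<epsilon>) * g 0 \<sigma>" "f 1 = g 2 \<sigma> + (1 - \<i> * \<epsilon>) * g 1 \<sigma>"
    "f 2 = g 3 \<sigma> + (1 - \<i> * \<epsilon>) * g 2 \<sigma>" "f 3 = g 4 \<sigma> + (1 - \<i> * \<epsilon>) * g 3 \<sigma>"
    by (simp_all add: F eval_nat_numeral)
  \<comment> \<open>Polynomials in \<theta> commute, so the factor \<theta> + 1 - i \<epsilon> can
    be moved onto g, where it forms f, and \<theta> + i \<kappa> can be split off on the
    left.\<close>
  have "((x4 + (1 - e) * x3) - e * (x3 + (1 - e) * x2)) + k * ((x3 + (1 - e) * x2) - e * (x2 + (1 - e) * x1))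
     + w * ((- 2 * (x4 + (1 - e) * x3) + b * (x3 + (1 - e) * x2) + c * (x2 + (1 - e) * x1))
         + (1 + k) * (- 2 * (x3 + (1 - e) * x2) + b * (x2 + (1 - e) * x1) + c * (x1 + (1 - e) * x0)))
     + w * (w * (((x4 + (1 - e) * x3) + 2 * (1 + k) * (x3 + (1 - e) * x2) + (1 + k)^2 * (x2 + (1 - e) * x1))
        + (2 + k) * ((x3 + (1 - e) * x2) + 2 * (1 + k) * (x2 + (1 - e) * x1) + (1 + k)^2 * (x1 + (1 - e) * x0))))
    = ((1 * x4 + k * x3 + 0 * x2) + (1 - e) * (1 * x3 + k * x2 + 0 * x1)) - e * ((1 * x3 + k * x2 + 0 * x1) + (1 - e) * (1 * x2 + k * x1 + 0 * x0))
     + w * (((- 2 * x4 + b * x3 + c * x2) + (1 + k) * (- 2 * x3 + b * x2 + c * x1))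
        + (1 - e) * ((- 2 * x3 + b * x2 + c * x1) + (1 + k) * (- 2 * x2 + b * x1 + c * x0)))
     + w * (w * (((1 * x4 + (2 + k - e) * x3 + ((1 - e) * (1 + k)) * x2) + (1 + k) * (1 * x3 + (2 + k - e) * x2 + ((1 - e) * (1 + k)) * x1))
        + (2 + k) * ((1 * x3 + (2 + k - e) * x2 + ((1 - e) * (1 + k)) * x1) + (1 + k) * (1 * x2 + (2 + k - e) * x1 + ((1 - e) * (1 + k)) * x0))))"
    for x0 x1 x2 x3 x4 e k w :: complex
    by (simp add: algebra_simps power2_eq_square)
  note poly = this[of "g 4 \<sigma>" "\<i> * \<epsilon>" "g 3 \<sigma>" "g 2 \<sigma>" "\<i> * \<kappa>" "g 1 \<sigma>" "y \<sigma>" "g 0 \<sigma>"]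
  show ?thesis
    using * unfolding Q0_def Q1_def Q2_def q0 q1 q2 f poly y_def[symmetric] .
qed

section \<open>Solutions of the confluent Heun equation\<close>

text \<open>With \<open>y = exp s\<close> and \<open>\<theta> = d/ds\<close>, the equation \<open>(1 - y)^2 \<theta>^2 f + heun_B \<theta> f + heun_C f = 0\<close> is the three-term recurrence
  for the coefficients of \<open>f\<close> as a power series in \<open>y\<close>.\<close>

definition heun_B :: "real \<Rightarrow> real \<Rightarrow> real \<Rightarrow> real \<Rightarrow> complex" where
  "heun_B \<kappa> \<epsilon> \<delta> s = \<i> * \<kappa> + (- 2 + \<i> * of_real (\<epsilon> + 2 * \<delta> - 2 * \<kappa>)) * of_real (exp s)
     + (2 + \<i> * \<kappa> - \<i> * \<epsilon>) * (of_real (exp s))^2"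

definition heun_C :: "real \<Rightarrow> real \<Rightarrow> complex \<Rightarrow> real \<Rightarrow> complex" where
  "heun_C \<kappa> \<epsilon> c s = 0 + c * of_real (exp s) + ((1 - \<i> * \<epsilon>) * (1 + \<i> * \<kappa>)) * (of_real (exp s))^2"

section \<open>Coefficient functions quadratic in exp s\<close>

lemma quadratic_exp_has_vector_derivative:
  fixes a b c :: complex
  shows "((\<lambda>s. a + b * of_real (exp s) + c * (of_real (exp s))^2) has_vector_derivative
      0 + b * of_real (exp s) + (2 * c) * (of_real (exp s))^2) (at s)"
proof -
  have "(exp has_real_derivative exp s) (at s)" by (rule DERIV_exp)
  note e = has_vector_derivative_of_real[OF this, where 'a = complex]
  have "((\<lambda>s. a + b * of_real (exp s) + c * (of_real (exp s) * of_real (exp s))) has_vector_derivative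
      0 + b * of_real (exp s) + c * (of_real (exp s) * of_real (exp s) + of_real (exp s) * of_real (exp s))) (at s)"
    by (intro has_vector_derivative_add has_vector_derivative_const has_vector_derivative_mult_right
        has_vector_derivative_mult e)
  then show ?thesis by (simp add: power2_eq_square algebra_simps)
qed

lemma quadratic_exp_tendsto_at_bot:
  fixes a b c :: complex
  shows "((\<lambda>s. a + b * of_real (exp s) + c * (of_real (exp s))^2) \<longlongrightarrow> a) at_bot"
proof -
  have "((\<lambda>s. complex_of_real (exp s)) \<longlongrightarrow> of_real 0) at_bot"
    by (intro tendsto_of_real exp_at_bot)
  note e = this
  have "((\<lambda>s. a + b * of_real (exp s) + c * (of_real (exp s))^2) \<longlongrightarrow> a + b * of_real 0 + c * (of_real 0)^2) at_bot"
    by (intro tendsto_add tendsto_mult tendsto_power tendsto_const e)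
  then show ?thesis by simp
qed

lemma quadratic_exp_tendsto_at_left:
  fixes a b c :: complex
  shows "((\<lambda>s. a + b * of_real (exp s) + c * (of_real (exp s))^2) \<longlongrightarrow> a + b + c) (at_left 0)"
proof -
  have "((\<lambda>s. a + b * of_real (exp s) + c * (of_real (exp s))^2) \<longlongrightarrow>
      a + b * of_real (exp 0) + c * (of_real (exp 0))^2) (at_left 0)"
    by (intro tendsto_intros)
  then show ?thesis by simp
qed

lemma one_minus_exp_sq: "complex_of_real ((1 - exp s)^2) = 1 + (- 2) * of_real (exp s) + 1 * (of_real (exp s))^2"
  by (simp add: power2_eq_square algebra_simps)

lemma one_minus_exp_sq_nz: "s < 0 \<Longrightarrow> 1 + (- 2) * of_real (exp s) + 1 * (complex_of_real (exp s))^2 \<noteq> 0"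
  unfolding one_minus_exp_sq[symmetric] by simp

text \<open>Regularity from the equation: where A does not vanish, F = -N / A is as differentiable
  as the right-hand side, and the derivative solves the differentiated equation.\<close>

lemma quotient_has_vector_derivative:
  fixes F N A :: "real \<Rightarrow> complex"
  assumes "s < 0" "\<And>t. t < 0 \<Longrightarrow> A t * F t + N t = 0" "\<And>t. t < 0 \<Longrightarrow> A t \<noteq> 0"
    and N: "(N has_vector_derivative N') (at s)" and A: "(A has_vector_derivative A') (at s)"
  shows "(F has_vector_derivative (- (N' + A' * F s) / A s)) (at s)"
proof -
  have "A s \<noteq> 0" using assms by auto
  then have "((\<lambda>t. inverse (A t)) has_vector_derivative (A' * (- inverse (A s ^ Suc (Suc 0))))) (at s)"
    using field_vector_diff_chain_at[OF A DERIV_inverse] by (simp add: o_def)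
  from has_vector_derivative_mult[OF has_vector_derivative_minus[OF N] this]
  have "((\<lambda>t. - N t * inverse (A t)) has_vector_derivative
      (- N s * (A' * (- inverse (A s ^ Suc (Suc 0)))) + - N' * inverse (A s))) (at s)" .
  then have "(F has_vector_derivative (- N s * (A' * (- inverse (A s ^ Suc (Suc 0)))) + - N' * inverse (A s))) (at s)"
  proof (rule has_vector_derivative_transform_within_open[of _ _ _ "{..<0}"])
    fix t :: real assume "t \<in> {..<0}"
    then have "A t * F t = - N t" "A t \<noteq> 0" using assms(2)[of t] assms(3)[of t] by (auto simp: eq_neg_iff_add_eq_0)
    then show "- N t * inverse (A t) = F t" by (simp add: field_simps)
  qed (use assms in auto)
  moreover have "N s = - (A s * F s)" using assms(2)[OF assms(1)] by (simp add: eq_neg_iff_add_eq_0 add.commute)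
  ultimately show ?thesis using \<open>A s \<noteq> 0\<close> by (simp add: field_simps)
qed

lemma eventually_at_left_0: "eventually P (at_left (0::real)) \<longleftrightarrow> (\<exists>b<0. \<forall>y>b. y < 0 \<longrightarrow> P y)"
  by (rule eventually_at_left[of "- 1"]) simp

text \<open>Here s is ln y, so s to -infinity is the horizon and s to 0 from the left is infinity.
  For Kerr the parameters are \<kappa> = xi times -2 i, \<epsilon> = 4 M w and \<delta> = w (r_+ -
  r_-); the value of \<open>heun_B\<close> at y = 1 is 2 i \<delta>, so y = 1 is an irregular
  singular point when \<delta> is nonzero.\<close>

locale confluent_heun =
  fixes \<kappa> \<epsilon> \<delta> :: real and c :: complex and F0 F1 F2 :: "real \<Rightarrow> complex"
  assumes dF0: "\<And>s. s < 0 \<Longrightarrow> (F0 has_vector_derivative F1 s) (at s)"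
    and dF1: "\<And>s. s < 0 \<Longrightarrow> (F1 has_vector_derivative F2 s) (at s)"
    and ode: "\<And>s. s < 0 \<Longrightarrow> of_real ((1 - exp s)^2) * F2 s + (heun_B \<kappa> \<epsilon> \<delta> s * F1 s + heun_C \<kappa> \<epsilon> c s * F0 s) = 0"
begin

text \<open>Four derivatives are needed because the intertwining applies \<theta> + 1 - i \<epsilon>
  and then \<theta> - i \<epsilon> to a second-order equation. The third and fourth come from
  differentiating the equation; all limits at -infinity follow since its coefficients converge and
  the one of \<open>F0\<close> tends to 0.\<close>

lemma heun_derivative_ladder:
  assumes lim0: "(F0 \<longlongrightarrow> L) at_bot" and lim1: "(F1 \<longlongrightarrow> 0) at_bot"
  obtains F :: "nat \<Rightarrow> real \<Rightarrow> complex" where "F 0 = F0" "F 1 = F1" "F 2 = F2"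
    "\<And>k. k \<le> 4 \<Longrightarrow> left_tame (F k)"
    "\<And>k s. k < 4 \<Longrightarrow> s < 0 \<Longrightarrow> (F k has_vector_derivative F (Suc k) s) (at s)"
    "\<And>k. 0 < k \<Longrightarrow> k \<le> 4 \<Longrightarrow> (F k \<longlongrightarrow> 0) at_bot"
proof -
  define p where "p a b c s = a + b * of_real (exp s) + c * (of_real (exp s))^2" for a b c :: complex and s :: real
  define b1 where "b1 = - 2 + \<i> * complex_of_real (\<epsilon> + 2 * \<delta> - 2 * \<kappa>)"
  define b2 where "b2 = 2 + \<i> * complex_of_real \<kappa> - \<i> * complex_of_real \<epsilon>"
  define c2 where "c2 = (1 - \<i> * complex_of_real \<epsilon>) * (1 + \<i> * complex_of_real \<kappa>)"
  define A where "A = p 1 (- 2) 1"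
  define A1 where "A1 = p 0 (- 2) (2 * 1)"
  define A2 where "A2 = p 0 (- 2) (2 * (2 * 1))"
  define B where "B = p (\<i> * \<kappa>) b1 b2"
  define B1 where "B1 = p 0 b1 (2 * b2)"
  define B2 where "B2 = p 0 b1 (2 * (2 * b2))"
  define C where "C = p 0 c c2"
  define C1 where "C1 = p 0 c (2 * c2)"
  define C2 where "C2 = p 0 c (2 * (2 * c2))"
  have dp: "(p a b c has_vector_derivative p 0 b (2 * c) s) (at s)" for a b c s
    unfolding p_def by (rule quadratic_exp_has_vector_derivative)
  have lp: "(p a b c \<longlongrightarrow> a) at_bot" for a b c
    unfolding p_def by (rule quadratic_exp_tendsto_at_bot)
  have cp: "continuous_on {..<0} (p a b c)" for a b c
    using dp by (meson continuous_at_imp_continuous_on has_vector_derivative_continuous)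
  have dA: "(A has_vector_derivative A1 s) (at s)" and dA1: "(A1 has_vector_derivative A2 s) (at s)"
    and dB: "(B has_vector_derivative B1 s) (at s)" and dB1: "(B1 has_vector_derivative B2 s) (at s)"
    and dC: "(C has_vector_derivative C1 s) (at s)" and dC1: "(C1 has_vector_derivative C2 s) (at s)" for s
    unfolding A_def A1_def A2_def B_def B1_def B2_def C_def C1_def C2_def by (intro dp)+
  have lims: "(A \<longlongrightarrow> 1) at_bot" "(A1 \<longlongrightarrow> 0) at_bot" "(A2 \<longlongrightarrow> 0) at_bot"
    "(B \<longlongrightarrow> \<i> * \<kappa>) at_bot" "(B1 \<longlongrightarrow> 0) at_bot" "(B2 \<longlongrightarrow> 0) at_bot"
    "(C \<longlongrightarrow> 0) at_bot" "(C1 \<longlongrightarrow> 0) at_bot" "(C2 \<longlongrightarrow> 0) at_bot"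
    unfolding A_def A1_def A2_def B_def B1_def B2_def C_def C1_def C2_def by (intro lp)+
  have conts: "continuous_on {..<0} A" "continuous_on {..<0} A1" "continuous_on {..<0} A2"
    "continuous_on {..<0} B" "continuous_on {..<0} B1" "continuous_on {..<0} B2"
    "continuous_on {..<0} C" "continuous_on {..<0} C1" "continuous_on {..<0} C2"
    unfolding A_def A1_def A2_def B_def B1_def B2_def C_def C1_def C2_def by (intro cp)+
  have Anz: "A s \<noteq> 0" if "s < 0" for s
    unfolding A_def p_def using one_minus_exp_sq_nz[OF that] by simp
  have ode': "A s * F2 s + (B s * F1 s + C s * F0 s) = 0" if "s < 0" for s
    using ode[OF that] unfolding one_minus_exp_sq heun_B_def heun_C_def A_def B_def C_def p_def b1_def b2_def c2_def .
  define N1 where "N1 s = (B s * F2 s + B1 s * F1 s) + (C s * F1 s + C1 s * F0 s)" for s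
  define F3 where "F3 s = - (N1 s + A1 s * F2 s) / A s" for s
  define N2 where "N2 s = ((B s * F3 s + B1 s * F2 s) + (B1 s * F2 s + B2 s * F1 s))
     + ((C s * F2 s + C1 s * F1 s) + (C1 s * F1 s + C2 s * F0 s)) + (A1 s * F3 s + A2 s * F2 s)" for s
  define F4 where "F4 s = - (N2 s + A1 s * F3 s) / A s" for s
  have dN0: "((\<lambda>s. B s * F1 s + C s * F0 s) has_vector_derivative N1 s) (at s)" if "s < 0" for s
    unfolding N1_def using that by (intro has_vector_derivative_add has_vector_derivative_mult dB dC dF0 dF1)
  have dF2: "(F2 has_vector_derivative F3 s) (at s)" if "s < 0" for s
    unfolding F3_def by (rule quotient_has_vector_derivative[OF that ode' Anz dN0[OF that] dA])
  have dN1: "((\<lambda>s. N1 s + A1 s * F2 s) has_vector_derivative N2 s) (at s)" if "s < 0" for s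
    unfolding N2_def N1_def using that
    by (intro has_vector_derivative_add has_vector_derivative_mult dA1 dB dC dB1 dC1 dF0 dF1 dF2)
  have ode3: "A s * F3 s + (N1 s + A1 s * F2 s) = 0" if "s < 0" for s
    unfolding F3_def using Anz[OF that] by simp
  have dF3: "(F3 has_vector_derivative F4 s) (at s)" if "s < 0" for s
    unfolding F4_def by (rule quotient_has_vector_derivative[OF that ode3 Anz dN1[OF that] dA])
  have cont: "continuous_on {..<0} G" if "\<And>s. s < 0 \<Longrightarrow> (G has_vector_derivative G' s) (at s)" for G G' :: "real \<Rightarrow> complex"
    using that by (meson continuous_at_imp_continuous_on has_vector_derivative_continuous lessThan_iff)
  note cF = cont[OF dF0] cont[OF dF1] cont[OF dF2] cont[OF dF3]
  have cF4: "continuous_on {..<0} F4"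
    unfolding F4_def N2_def using Anz by (intro continuous_intros conts cF) auto
  have lim2: "(F2 \<longlongrightarrow> 0) at_bot"
  proof -
    have "((\<lambda>s. - (B s * F1 s + C s * F0 s) / A s) \<longlongrightarrow> - (\<i> * \<kappa> * 0 + 0 * L) / 1) at_bot"
      by (intro tendsto_intros lims lim0 lim1) auto
    moreover have "\<forall>\<^sub>F s in at_bot. - (B s * F1 s + C s * F0 s) / A s = F2 s"
      using eventually_gt_at_bot[of 0]
    proof eventually_elim
      case (elim s)
      then show ?case using ode'[of s] Anz[of s] by (simp add: field_simps add_eq_0_iff)
    qed
    ultimately show ?thesis using Lim_transform_eventually by fastforce
  qed
  have lim3: "(F3 \<longlongrightarrow> 0) at_bot"
  proof -
    have "(F3 \<longlongrightarrow> - (((\<i> * \<kappa> * 0 + 0 * 0) + (0 * 0 + 0 * L)) + 0 * 0) / 1) at_bot"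
      unfolding F3_def N1_def by (intro tendsto_intros lims lim0 lim1 lim2) auto
    then show ?thesis by simp
  qed
  have lim4: "(F4 \<longlongrightarrow> 0) at_bot"
  proof -
    have "(F4 \<longlongrightarrow> - ((((\<i> * \<kappa> * 0 + 0 * 0) + (0 * 0 + 0 * 0)) + ((0 * 0 + 0 * 0) + (0 * 0 + 0 * L)) + (0 * 0 + 0 * 0)) + 0 * 0) / 1) at_bot"
      unfolding F4_def N2_def by (intro tendsto_intros lims lim0 lim1 lim2 lim3) auto
    then show ?thesis by simp
  qed
  define F where "F k = (if k = 0 then F0 else if k = 1 then F1 else if k = 2 then F2 else if k = 3 then F3 else F4)" for k :: nat
  have k4: "k = 0 \<or> k = 1 \<or> k = 2 \<or> k = 3 \<or> k = 4" if "k \<le> 4" for k :: nat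
    using that by linarith
  note tames = left_tame_of_limit[OF cF(1) lim0] left_tame_of_limit[OF cF(2) lim1] left_tame_of_limit[OF cF(3) lim2]
     left_tame_of_limit[OF cF(4) lim3] left_tame_of_limit[OF cF4 lim4]
  show ?thesis
  proof (rule that[of F])
    show "left_tame (F k)" if "k \<le> 4" for k
      using k4[OF that] tames by (auto simp: F_def)
    show "(F k has_vector_derivative F (Suc k) s) (at s)" if "k < 4" "s < 0" for k s
      using k4[of k] that dF0 dF1 dF2 dF3 by (auto simp: F_def)
    show "(F k \<longlongrightarrow> 0) at_bot" if "0 < k" "k \<le> 4" for k
      using k4[OF that(2)] that(1) lim1 lim2 lim3 lim4 by (auto simp: F_def)
  qed (auto simp: F_def)
qed

text \<open>Uniqueness at the regular singular point y = 0, whose exponents 0 and -i \<kappa> both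
  have real part 0. Up to the rotation by \<kappa> the system has an integrable coefficient exp s,
  so a bound valid near -infinity can be halved again and again; a Gronwall estimate then carries
  the zero to every s < 0.\<close>

lemma heun_zero_of_limit_zero:
  assumes lim0: "(F0 \<longlongrightarrow> 0) at_bot" and lim1: "(F1 \<longlongrightarrow> 0) at_bot"
    and s: "s < 0"
  shows "F0 s = 0"
proof -
  define b1 where "b1 = - 2 + \<i> * complex_of_real (\<epsilon> + 2 * \<delta> - 2 * \<kappa>)"
  define c2 where "c2 = (1 - \<i> * complex_of_real \<epsilon>) * (1 + \<i> * complex_of_real \<kappa>)"
  \<comment> \<open>The factor 4 compensates (1 - exp t)^2 >= 1/4; the summand 1 keeps
    \<open>K\<close> positive.\<close>
  define K where "K = 4 * (norm (b1 + 2 * \<i> * \<kappa>) + norm (2 - \<i> * \<epsilon>) + norm c + norm c2) + 1"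
  have K: "K > 0" by (simp add: K_def add_nonneg_pos)
  \<comment> \<open>At y = 0 the equation is F2 + i \<kappa> F1 = 0. Removing (1 - y)^2 times this
    leaves only terms that carry a factor y.\<close>
  have Y: "norm (F2 t + \<i> * \<kappa> * F1 t) \<le> 2 * K * m * exp t" if t: "t \<le> - 1" and m: "norm (F0 t) \<le> m" "norm (F1 t) \<le> m" for t m
  proof -
    define y where "y = complex_of_real (exp t)"
    have et: "exp t \<le> 1 / 2"
    proof -
      have "exp t \<le> exp (- 1)" using t by simp
      also have "\<dots> \<le> 1 / 2" using exp_ge_add_one_self[of 1] by (simp add: exp_minus field_simps)
      finally show ?thesis .
    qed
    have ny: "norm y \<le> 1" and ny2: "norm y = exp t" using t by (auto simp: y_def)
    have A: "(1 - exp t)^2 \<ge> 1 / 4"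
      using power_mono[of "1/2" "1 - exp t" 2] et by (simp add: power2_eq_square)
    have "of_real ((1 - exp t)^2) * (F2 t + \<i> * \<kappa> * F1 t)
       = - (y * ((b1 + 2 * \<i> * \<kappa>) + (2 - \<i> * \<epsilon>) * y) * F1 t + y * (c + c2 * y) * F0 t)"
      using ode[of t] t unfolding one_minus_exp_sq heun_B_def heun_C_def y_def[symmetric] b1_def[symmetric] c2_def[symmetric]
      by (simp add: algebra_simps power2_eq_square eq_neg_iff_add_eq_0)
    from arg_cong[OF this, of norm] have "(1 - exp t)^2 * norm (F2 t + \<i> * \<kappa> * F1 t)
       = norm (y * ((b1 + 2 * \<i> * \<kappa>) + (2 - \<i> * \<epsilon>) * y) * F1 t + y * (c + c2 * y) * F0 t)"
      by (simp only: norm_minus_cancel norm_mult norm_of_real abs_power2)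
    also have "\<dots> \<le> exp t * (norm (b1 + 2 * \<i> * \<kappa>) + norm (2 - \<i> * \<epsilon>)) * m + exp t * (norm c + norm c2) * m"
    proof (rule norm_triangle_mono)
      have n1: "norm (u + v * y) \<le> norm u + norm v" for u v
        using norm_triangle_ineq[of u "v * y"] ny mult_left_mono[OF ny, of "norm v"] by (simp add: norm_mult)
      have n2: "norm (y * (u + v * y) * w) \<le> exp t * (norm u + norm v) * m" if "norm w \<le> m" for u v w
        unfolding norm_mult ny2 using n1[of u v] that
        by (intro mult_mono) (auto intro!: mult_nonneg_nonneg)
      show "norm (y * ((b1 + 2 * \<i> * \<kappa>) + (2 - \<i> * \<epsilon>) * y) * F1 t) \<le> exp t * (norm (b1 + 2 * \<i> * \<kappa>) + norm (2 - \<i> * \<epsilon>)) * m"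
        "norm (y * (c + c2 * y) * F0 t) \<le> exp t * (norm c + norm c2) * m"
        by (intro n2 m)+
    qed
    also have "\<dots> = (exp t * m) * ((K - 1) / 4)" by (simp add: K_def algebra_simps)
    also have "\<dots> \<le> (exp t * m) * (K / 4)"
      using m(1) by (intro mult_left_mono mult_nonneg_nonneg) (auto intro: order_trans[OF norm_ge_zero])
    finally have "(1 - exp t)^2 * norm (F2 t + \<i> * \<kappa> * F1 t) \<le> (exp t * m) * (K / 4)" .
    moreover have "1 / 4 * norm (F2 t + \<i> * \<kappa> * F1 t) \<le> (1 - exp t)^2 * norm (F2 t + \<i> * \<kappa> * F1 t)"
      by (intro mult_right_mono A norm_ge_zero)
    ultimately have "norm (F2 t + \<i> * \<kappa> * F1 t) \<le> K * m * exp t" by (simp add: mult_ac)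
    moreover have "0 \<le> K * m * exp t"
      using m(1) K by (intro mult_nonneg_nonneg) (auto intro: order_trans[OF norm_ge_zero])
    ultimately show ?thesis by simp
  qed
  obtain N0 where N0: "\<And>t. t \<le> N0 \<Longrightarrow> norm (F0 t) \<le> 1 \<and> norm (F1 t) \<le> 1"
  proof -
    have "\<forall>\<^sub>F t in at_bot. norm (F0 t) \<le> 1 \<and> norm (F1 t) \<le> 1"
      using tendstoD[OF lim0 zero_less_one] tendstoD[OF lim1 zero_less_one]
      by eventually_elim (auto simp: less_imp_le)
    then show ?thesis using that unfolding eventually_at_bot_linorder by fast
  qed
  \<comment> \<open>The last bound makes the integral of \<open>2 * K * m * exp t\<close> over the
    half-line up to \<open>N\<close> at most m / 2.\<close>
  define N where "N = min (min N0 (- 1)) (ln (1 / (4 * K)))"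
  have N: "N \<le> N0" "N \<le> - 1" "N \<le> ln (1 / (4 * K))" by (auto simp: N_def)
  have eN: "2 * K * exp N \<le> 1 / 2"
  proof -
    have "exp N \<le> 1 / (4 * K)" using N(3) K by (metis exp_le_cancel_iff exp_ln zero_less_divide_1_iff mult_pos_pos zero_less_numeral)
    then show ?thesis using K by (simp add: field_simps)
  qed
  have lim_le: "norm (X t) \<le> \<Psi> t"
    if "\<And>t1. t1 \<le> t \<Longrightarrow> \<bar>norm (X t) - norm (X t1)\<bar> \<le> \<Psi> t - \<Psi> t1" "(X \<longlongrightarrow> 0) at_bot" "(\<Psi> \<longlongrightarrow> 0) at_bot"
    for X :: "real \<Rightarrow> complex" and \<Psi> t
  proof -
    have "((\<lambda>t1. norm (X t1) + (\<Psi> t - \<Psi> t1)) \<longlongrightarrow> norm (0::complex) + (\<Psi> t - 0)) at_bot"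
      by (intro tendsto_intros that(2,3))
    moreover have "\<forall>\<^sub>F t1 in at_bot. norm (X t) \<le> norm (X t1) + (\<Psi> t - \<Psi> t1)"
      using eventually_le_at_bot[of t] by eventually_elim (use that(1) in force)
    ultimately show ?thesis using tendsto_lowerbound by fastforce
  qed
  \<comment> \<open>Integrate from -infinity, first for \<open>F1\<close> and then, with the
    improved bound on \<open>F1\<close>, for \<open>F0\<close>; both primitives equal their own
    derivative, so one \<Psi> serves twice.\<close>
  have half: "\<forall>t\<le>N. norm (F0 t) \<le> m / 2 \<and> norm (F1 t) \<le> m / 2"
    if m: "\<forall>t\<le>N. norm (F0 t) \<le> m \<and> norm (F1 t) \<le> m" for m
  proof -
    have m0: "m \<ge> 0" using m norm_ge_zero order_trans by blast
    define \<Psi> where "\<Psi> t = 2 * K * m * exp t" for t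
    have dPsi: "(\<Psi> has_real_derivative \<Psi> t) (at t)" for t
      unfolding \<Psi>_def by (auto intro!: derivative_eq_intros)
    have lPsi: "(\<Psi> \<longlongrightarrow> 0) at_bot"
      unfolding \<Psi>_def using tendsto_mult_right_zero[OF exp_at_bot] by blast
    have small: "\<Psi> t \<le> m / 2" if "t \<le> N" for t
    proof -
      have "\<Psi> t \<le> 2 * K * m * exp N" unfolding \<Psi>_def using that K m0 by (intro mult_left_mono) auto
      also have "\<dots> = (2 * K * exp N) * m" by simp
      also have "\<dots> \<le> 1 / 2 * m" using eN m0 by (intro mult_right_mono) auto
      finally show ?thesis by simp
    qed
    have b1: "norm (F1 t) \<le> \<Psi> t" if t: "t \<le> N" for t
    proof (rule lim_le[OF _ lim1 lPsi])
      fix t1 assume t1: "t1 \<le> t"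
      show "\<bar>norm (F1 t) - norm (F1 t1)\<bar> \<le> \<Psi> t - \<Psi> t1"
      proof (rule norm_growth_phase_ode[OF t1, where \<phi> = "\<lambda>_. - \<kappa>" and Y = "\<lambda>t. F2 t + \<i> * \<kappa> * F1 t"])
        show "(F1 has_vector_derivative (\<i> * of_real (- \<kappa>) * F1 r + (F2 r + \<i> * \<kappa> * F1 r))) (at r)" if "r \<in> {t1..t}" for r
          using dF1[of r] that t N by simp
        show "norm (F2 r + \<i> * \<kappa> * F1 r) \<le> \<Psi> r" if "r \<in> {t1..t}" for r
          unfolding \<Psi>_def using that t N m by (intro Y) auto
      qed (rule dPsi)
    qed
    have b0: "norm (F0 t) \<le> \<Psi> t" if t: "t \<le> N" for t
    proof (rule lim_le[OF _ lim0 lPsi])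
      fix t1 assume t1: "t1 \<le> t"
      show "\<bar>norm (F0 t) - norm (F0 t1)\<bar> \<le> \<Psi> t - \<Psi> t1"
      proof (rule norm_growth_phase_ode[OF t1, where \<phi> = "\<lambda>_. 0" and Y = F1])
        show "(F0 has_vector_derivative (\<i> * of_real 0 * F0 r + F1 r)) (at r)" if "r \<in> {t1..t}" for r
          using dF0[of r] that t N by simp
        show "norm (F1 r) \<le> \<Psi> r" if "r \<in> {t1..t}" for r
          using that t by (intro b1) auto
      qed (rule dPsi)
    qed
    show ?thesis using b0 b1 small by (meson order_trans)
  qed
  have pow: "\<forall>t\<le>N. norm (F0 t) \<le> (1/2)^n \<and> norm (F1 t) \<le> (1/2)^n" for n
  proof (induction n)
    case 0 then show ?case using N0 N by auto
  next
    case (Suc n) then show ?case using half[OF Suc] by simp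
  qed
  have zeroN: "F0 t = 0 \<and> F1 t = 0" if t: "t \<le> N" for t
  proof -
    have l: "(\<lambda>n. (1/2)^n) \<longlonglongrightarrow> (0::real)" by (rule LIMSEQ_realpow_zero) auto
    have "\<forall>\<^sub>F n in sequentially. norm (F0 t) \<le> (1/2)^n" "\<forall>\<^sub>F n in sequentially. norm (F1 t) \<le> (1/2)^n"
      using pow t by auto
    from this[THEN tendsto_lowerbound[OF l]] show ?thesis by simp
  qed
  show ?thesis
  proof (cases "s \<le> N")
    case False
    have comp: "continuous_on {N..s} (\<lambda>t. heun_B \<kappa> \<epsilon> \<delta> t / of_real ((1 - exp t)^2))"
      "continuous_on {N..s} (\<lambda>t. heun_C \<kappa> \<epsilon> c t / of_real ((1 - exp t)^2))"
      unfolding heun_B_def heun_C_def using s by (auto intro!: continuous_intros)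
    obtain KB where KB: "\<And>t. t \<in> {N..s} \<Longrightarrow> norm (heun_B \<kappa> \<epsilon> \<delta> t / of_real ((1 - exp t)^2)) \<le> KB"
      using compact_imp_bounded[OF compact_continuous_image[OF comp(1) compact_Icc]] unfolding bounded_iff by fast
    obtain KC where KC: "\<And>t. t \<in> {N..s} \<Longrightarrow> norm (heun_C \<kappa> \<epsilon> c t / of_real ((1 - exp t)^2)) \<le> KC"
      using compact_imp_bounded[OF compact_continuous_image[OF comp(2) compact_Icc]] unfolding bounded_iff by fast
    have KBC: "KB \<ge> 0" "KC \<ge> 0"
      using order_trans[OF norm_ge_zero KB[of N]] order_trans[OF norm_ge_zero KC[of N]] False by auto
    \<comment> \<open>From 2 x z <= x^2 + z^2: the cross terms contribute 1 and \<open>KC\<close>,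
      and the damping term contributes \<open>2 * KB\<close>.\<close>
    define Q where "Q = 1 + 2 * KB + KC"
    define E where "E t = (norm (F0 t))^2 + (norm (F1 t))^2" for t
    define E' where "E' t = 2 * Re (cnj (F0 t) * F1 t) + 2 * Re (cnj (F1 t) * F2 t)" for t
    have dE: "(E has_real_derivative E' t) (at t)" if "t < 0" for t
      unfolding E_def E'_def using that by (intro DERIV_add has_real_derivative_norm_power2 dF0 dF1)
    have E'le: "E' t \<le> Q * E t" if t: "t \<in> {N..s}" for t
    proof -
      define x where "x = norm (F0 t)"
      define z where "z = norm (F1 t)"
      have t0: "t < 0" using t s by auto
      have nz: "complex_of_real ((1 - exp t)^2) \<noteq> 0" using t0 by simp
      have "F2 t = - (heun_B \<kappa> \<epsilon> \<delta> t / of_real ((1 - exp t)^2) * F1 t + heun_C \<kappa> \<epsilon> c t / of_real ((1 - exp t)^2) * F0 t)"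
      proof -
        have "w * f2 + (b * f1 + d * f0) = 0 \<Longrightarrow> w \<noteq> 0 \<Longrightarrow> f2 = - (b / w * f1 + d / w * f0)" for w f2 b f1 d f0 :: complex
          by (simp add: field_simps add_eq_0_iff)
        from this[OF ode[OF t0] nz] show ?thesis .
      qed
      then have F2: "norm (F2 t) \<le> KB * z + KC * x"
        unfolding x_def z_def
        by (simp only: norm_minus_cancel)
           (intro norm_triangle_mono; simp only: norm_mult; intro mult_right_mono KB[OF t] KC[OF t] norm_ge_zero)
      have "Re (cnj (F0 t) * F1 t) \<le> x * z"
        using complex_Re_le_cmod[of "cnj (F0 t) * F1 t"] by (simp add: x_def z_def norm_mult)
      moreover have "Re (cnj (F1 t) * F2 t) \<le> z * (KB * z + KC * x)"
        using complex_Re_le_cmod[of "cnj (F1 t) * F2 t"] mult_left_mono[OF F2, of z]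
        by (simp add: z_def norm_mult)
      moreover have "2 * (x * z) \<le> x^2 + z^2" using sum_squares_bound[of x z] by simp
      moreover have "KC * (2 * (x * z)) \<le> KC * (x^2 + z^2)"
        using calculation(3) KBC by (intro mult_left_mono)
      moreover have "KB * x^2 \<ge> 0" using KBC by simp
      ultimately show ?thesis
        unfolding E'_def E_def Q_def x_def[symmetric] z_def[symmetric]
        by (simp add: algebra_simps power2_eq_square)
    qed
    have "E s * exp (- Q * s) \<le> E N * exp (- Q * N)"
    proof (rule DERIV_nonpos_imp_nonincreasing[of N s "\<lambda>t. E t * exp (- Q * t)"])
      fix t assume t: "N \<le> t" "t \<le> s"
      have "((\<lambda>t. E t * exp (- Q * t)) has_real_derivative (E' t - Q * E t) * exp (- Q * t)) (at t)"
        using dE[of t] t s by (auto intro!: derivative_eq_intros simp: algebra_simps)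
      moreover have "(E' t - Q * E t) * exp (- Q * t) \<le> 0"
        using E'le[of t] t by (intro mult_nonpos_nonneg) auto
      ultimately show "\<exists>y. ((\<lambda>t. E t * exp (- Q * t)) has_real_derivative y) (at t) \<and> y \<le> 0" by blast
    qed (use False in auto)
    moreover have "E N = 0" using zeroN[of N] by (simp add: E_def)
    ultimately have "E s \<le> 0" by (simp add: mult_le_0_iff)
    then show ?thesis by (simp add: E_def sum_power2_le_zero_iff)
  qed (use zeroN in auto)
qed

text \<open>At the irregular point y = 1 the derivative is controlled in two passes. Up to a
  rotation of unbounded speed, (1 - y)^2 times the derivative satisfies an equation with small
  forcing; starting from its limit 0, each integration towards s = 0 gains one factor 1 - y.\<close>

lemma heun_bounded_at_left:
  assumes \<delta>: "\<delta> \<noteq> 0"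
    and bdd: "\<forall>\<^sub>F s in at_left 0. norm (F0 s) \<le> K0"
    and slope: "((\<lambda>s. of_real ((1 - exp s)^2) * F1 s) \<longlongrightarrow> 0) (at_left 0)"
  obtains b K where "b < 0" "\<And>s. b \<le> s \<Longrightarrow> s < 0 \<Longrightarrow> norm (F0 s) \<le> K \<and> norm (F1 s) \<le> K
    \<and> norm (of_real ((1 - exp s)^2) * F2 s) \<le> K"
proof -
  define B where "B = heun_B \<kappa> \<epsilon> \<delta>"
  define C where "C = heun_C \<kappa> \<epsilon> c"
  define A where "A s = complex_of_real ((1 - exp s)^2)" for s
  define A1 where "A1 s = 0 + (- 2) * complex_of_real (exp s) + (2 * 1) * (of_real (exp s))^2" for s
  define B1 where "B1 s = 0 + (- 2 + \<i> * of_real (\<epsilon> + 2 * \<delta> - 2 * \<kappa>)) * of_real (exp s)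
     + (2 * (2 + \<i> * \<kappa> - \<i> * \<epsilon>)) * (of_real (exp s))^2" for s
  define C1 where "C1 s = 0 + c * of_real (exp s) + (2 * ((1 - \<i> * \<epsilon>) * (1 + \<i> * \<kappa>))) * (of_real (exp s))^2" for s
  have dA: "(A has_vector_derivative A1 s) (at s)" and dB: "(B has_vector_derivative B1 s) (at s)"
    and dC: "(C has_vector_derivative C1 s) (at s)" for s
    unfolding A_def A1_def B_def B1_def C_def C1_def heun_B_def heun_C_def one_minus_exp_sq
    by (rule quadratic_exp_has_vector_derivative)+
  have lB: "(B \<longlongrightarrow> \<i> * \<kappa> + (- 2 + \<i> * of_real (\<epsilon> + 2 * \<delta> - 2 * \<kappa>)) + (2 + \<i> * \<kappa> - \<i> * \<epsilon>)) (at_left 0)"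
    unfolding B_def heun_B_def by (rule quadratic_exp_tendsto_at_left)
  have lC: "(C \<longlongrightarrow> 0 + c + ((1 - \<i> * \<epsilon>) * (1 + \<i> * \<kappa>))) (at_left 0)"
    unfolding C_def heun_C_def by (rule quadratic_exp_tendsto_at_left)
  have lB1: "(B1 \<longlongrightarrow> 0 + (- 2 + \<i> * of_real (\<epsilon> + 2 * \<delta> - 2 * \<kappa>)) + (2 * (2 + \<i> * \<kappa> - \<i> * \<epsilon>))) (at_left 0)"
    unfolding B1_def by (rule quadratic_exp_tendsto_at_left)
  have lC1: "(C1 \<longlongrightarrow> 0 + c + (2 * ((1 - \<i> * \<epsilon>) * (1 + \<i> * \<kappa>)))) (at_left 0)"
    unfolding C1_def by (rule quadratic_exp_tendsto_at_left)
  have B0: "\<i> * \<kappa> + (- 2 + \<i> * of_real (\<epsilon> + 2 * \<delta> - 2 * \<kappa>)) + (2 + \<i> * \<kappa> - \<i> * \<epsilon>) = \<i> * complex_of_real (2 * \<delta>)"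
    by (simp add: algebra_simps)
  have B0nz: "\<i> * complex_of_real (2 * \<delta>) \<noteq> 0" using \<delta> by simp
  note lB = lB[unfolded B0]
  \<comment> \<open>Since B tends to 2 i \<delta>, which is nonzero, the slowly varying solution has
    F1 close to -(C / B) F0; \<open>R\<close> removes this part.\<close>
  define R where "R s = C s / B s" for s
  define R1 where "R1 s = (C1 s * B s - C s * B1 s) / (B s * B s)" for s
  have lR: "\<exists>l. (R \<longlongrightarrow> l) (at_left 0)" and lR1: "\<exists>l. (R1 \<longlongrightarrow> l) (at_left 0)"
    unfolding R_def R1_def
    using tendsto_divide[OF lC lB B0nz] B0nz
      tendsto_divide[OF tendsto_diff[OF tendsto_mult[OF lC1 lB] tendsto_mult[OF lC lB1]] tendsto_mult[OF lB lB]]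
    by (blast, auto)
  have bounded_ev: "\<exists>M. \<forall>\<^sub>F s in at_left 0. norm (f s) \<le> M" if "(f \<longlongrightarrow> l) (at_left 0)" for f :: "real \<Rightarrow> complex" and l
    using order_tendstoD(2)[OF tendsto_norm[OF that], of "norm l + 1"]
    by (intro exI[of _ "norm l + 1"]) (auto elim!: eventually_mono)
  obtain KR where KR: "\<forall>\<^sub>F s in at_left 0. norm (R s) \<le> KR" using lR bounded_ev by blast
  obtain KS where KS: "\<forall>\<^sub>F s in at_left 0. norm (R1 s) \<le> KS" using lR1 bounded_ev by blast
  obtain KB where KB: "\<forall>\<^sub>F s in at_left 0. norm (B s) \<le> KB" using lB bounded_ev by blast
  obtain KC where KC: "\<forall>\<^sub>F s in at_left 0. norm (C s) \<le> KC" using lC bounded_ev by blast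
  have Bnz: "\<forall>\<^sub>F s in at_left 0. B s \<noteq> 0"
    using tendsto_imp_eventually_ne[OF lB B0nz] .
  have sl: "\<forall>\<^sub>F s in at_left 0. norm (A s * F1 s) \<le> 1"
    using order_tendstoD(2)[OF tendsto_norm[OF slope], of 1] unfolding A_def by (auto elim!: eventually_mono)
  have ehalf: "\<forall>\<^sub>F s in at_left 0. exp s \<ge> (1/2 :: real)"
  proof -
    have "(exp \<longlongrightarrow> exp (0::real)) (at_left 0)" by (intro tendsto_intros)
    from order_tendstoD(1)[OF this, of "1/2"] show ?thesis by (auto elim!: eventually_mono)
  qed
  define K where "K = 1 + \<bar>K0\<bar> + \<bar>KR\<bar> + \<bar>KS\<bar> + \<bar>KB\<bar> + \<bar>KC\<bar>"
  have K1: "K \<ge> 1" by (simp add: K_def)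
  have "\<forall>\<^sub>F s in at_left 0. norm (F0 s) \<le> K \<and> norm (R s) \<le> K \<and> norm (R1 s) \<le> K \<and> norm (B s) \<le> K
     \<and> norm (C s) \<le> K \<and> norm (A s * F1 s) \<le> 1 \<and> B s \<noteq> 0 \<and> exp s \<ge> (1/2 :: real)"
    using bdd KR KS KB KC sl Bnz ehalf
    by eventually_elim (auto simp: K_def)
  then obtain b0 where b0: "b0 < 0" "\<And>s. b0 < s \<Longrightarrow> s < 0 \<Longrightarrow> norm (F0 s) \<le> K \<and> norm (R s) \<le> K \<and> norm (R1 s) \<le> K \<and> norm (B s) \<le> K
     \<and> norm (C s) \<le> K \<and> norm (A s * F1 s) \<le> 1 \<and> B s \<noteq> 0 \<and> exp s \<ge> (1/2 :: real)"
    unfolding eventually_at_left_0 by blast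
  define b where "b = b0 / 2"
  have b: "b < 0" "b0 < b" using b0(1) by (auto simp: b_def)
  define q where "q s = 1 - exp s" for s :: real
  have q: "0 < q s" "q s \<le> 1" if "s < 0" for s using that by (auto simp: q_def)
  have nA: "norm (A s) = (q s)^2" for s unfolding A_def q_def norm_of_real by simp
  have lq: "(q \<longlongrightarrow> 0) (at_left 0)"
  proof -
    have "(q \<longlongrightarrow> 1 - exp 0) (at_left 0)" unfolding q_def by (intro tendsto_intros)
    then show ?thesis by simp
  qed
  define G where "G s = A s * (F1 s + R s * F0 s)" for s
  define Y where "Y s = A s * (R1 s * F0 s + R s * F1 s)" for s
  \<comment> \<open>\<open>A1 - B\<close> equals \<i> \<phi> A with \<phi> real because the real
    parts of \<open>A1\<close> and \<open>B\<close> agree. This is why no growth or decay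
    appears.\<close>
  define \<phi> where "\<phi> s = - (\<kappa> + (\<epsilon> + 2 * \<delta> - 2 * \<kappa>) * exp s + (\<kappa> - \<epsilon>) * (exp s)^2) / (q s)^2" for s
  have dG: "(G has_vector_derivative (\<i> * \<phi> s * G s + Y s)) (at s)" if s: "b \<le> s" "s < 0" for s
  proof -
    have Bs: "B s \<noteq> 0" using b0(2)[of s] s b by auto
    have dR: "(R has_vector_derivative R1 s) (at s)"
    proof -
      have "((\<lambda>t. inverse (B t)) has_vector_derivative (B1 s * (- inverse (B s ^ Suc (Suc 0))))) (at s)"
        using field_vector_diff_chain_at[OF dB DERIV_inverse[OF Bs]] by (simp add: o_def)
      from has_vector_derivative_mult[OF dC this] show ?thesis
        unfolding R_def R1_def using Bs by (simp add: divide_inverse[symmetric] field_simps)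
    qed
    have "(G has_vector_derivative (A s * (F2 s + (R s * F1 s + R1 s * F0 s)) + A1 s * (F1 s + R s * F0 s))) (at s)"
      unfolding G_def using s by (intro has_vector_derivative_add has_vector_derivative_mult dA dR dF0 dF1)
    moreover have "A s * (F2 s + (R s * F1 s + R1 s * F0 s)) + A1 s * (F1 s + R s * F0 s) = \<i> * \<phi> s * G s + Y s"
    proof -
      have CB: "C s = B s * R s" using Bs by (simp add: R_def)
      have o: "A s * F2 s = - (B s * (F1 s + R s * F0 s))"
        using ode[OF s(2)] unfolding A_def[symmetric] B_def[symmetric] C_def[symmetric] CB
        by (simp add: algebra_simps eq_neg_iff_add_eq_0)
      have "complex_of_real ((q s)^2) \<noteq> 0" using q[OF s(2)] by simp
      then have "\<i> * \<phi> s * A s = - \<i> * complex_of_real (\<kappa> + (\<epsilon> + 2 * \<delta> - 2 * \<kappa>) * exp s + (\<kappa> - \<epsilon>) * (exp s)^2)"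
        unfolding A_def \<phi>_def q_def by (simp add: field_simps)
      also have "\<dots> = A1 s - B s"
        unfolding A1_def B_def heun_B_def by (simp add: algebra_simps)
      finally have "\<i> * \<phi> s * G s = (A1 s - B s) * (F1 s + R s * F0 s)"
        unfolding G_def mult.assoc[symmetric] by simp
      then show ?thesis unfolding Y_def distrib_left[of "A s"] o by (simp add: algebra_simps)
    qed
    ultimately show ?thesis by simp
  qed
  have RF: "norm (A s * (R s * F0 s)) \<le> (q s)^2 * K^2" if s: "b \<le> s" "s < 0" for s
    unfolding norm_mult nA power2_eq_square[of K] using b0(2)[of s] s b K1 by (intro mult_left_mono mult_mono) auto
  have lG: "(G \<longlongrightarrow> 0) (at_left 0)"
  proof (rule Lim_null_comparison)
    show "\<forall>\<^sub>F s in at_left 0. norm (G s) \<le> norm (A s * F1 s) + (q s)^2 * K^2"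
      unfolding eventually_at_left_0
    proof (intro exI[of _ b] conjI allI impI b)
      fix s assume "b < s" "s < 0"
      then show "norm (G s) \<le> norm (A s * F1 s) + (q s)^2 * K^2"
        unfolding G_def distrib_left using RF[of s] norm_triangle_ineq[of "A s * F1 s" "A s * (R s * F0 s)"] by simp
    qed
    have "((\<lambda>s. norm (A s * F1 s) + (q s)^2 * K^2) \<longlongrightarrow> norm (0::complex) + 0^2 * K^2) (at_left 0)"
      unfolding A_def by (intro tendsto_intros slope lq)
    then show "((\<lambda>s. norm (A s * F1 s) + (q s)^2 * K^2) \<longlongrightarrow> 0) (at_left 0)" by simp
  qed
  \<comment> \<open>\<open>G\<close> and \<Psi> both vanish at s = 0, so the growth estimate on the
    interval from s to t bounds \<open>G s\<close> as t tends to 0.\<close>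
  have bd: "norm (G s) \<le> - \<Psi> s"
    if \<Psi>: "\<And>t. (\<Psi> has_real_derivative \<psi> t) (at t)" and Y: "\<And>t. b \<le> t \<Longrightarrow> t < 0 \<Longrightarrow> norm (Y t) \<le> \<psi> t"
      and l: "(\<Psi> \<longlongrightarrow> 0) (at_left 0)" and s: "b \<le> s" "s < 0" for \<Psi> \<psi> s
  proof -
    have "((\<lambda>t. norm (G t) + (\<Psi> t - \<Psi> s)) \<longlongrightarrow> norm (0::complex) + (0 - \<Psi> s)) (at_left 0)"
      by (intro tendsto_intros lG l)
    moreover have "\<forall>\<^sub>F t in at_left 0. norm (G s) \<le> norm (G t) + (\<Psi> t - \<Psi> s)"
      unfolding eventually_at_left_0
    proof (intro exI[of _ s] conjI allI impI s)
      fix t assume t: "s < t" "t < 0"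
      have "\<bar>norm (G t) - norm (G s)\<bar> \<le> \<Psi> t - \<Psi> s"
        by (rule norm_growth_phase_ode[where \<phi> = \<phi> and Y = Y and \<psi> = \<psi>])
           (use t s in \<open>auto intro!: dG \<Psi> Y\<close>)
      then show "norm (G s) \<le> norm (G t) + (\<Psi> t - \<Psi> s)" by linarith
    qed
    ultimately have "norm (G s) \<le> norm (0::complex) + (0 - \<Psi> s)"
      by (rule tendsto_lowerbound) simp
    then show ?thesis by simp
  qed
  have Ybd: "norm (Y s) \<le> (q s)^2 * K^2 + K * norm (A s * F1 s)" if s: "b \<le> s" "s < 0" for s
  proof -
    have "Y s = A s * (R1 s * F0 s) + R s * (A s * F1 s)" by (simp add: Y_def algebra_simps)
    moreover have "norm (A s * (R1 s * F0 s)) \<le> (q s)^2 * K^2"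
      unfolding norm_mult nA power2_eq_square[of K] using b0(2)[of s] s b K1 by (intro mult_left_mono mult_mono) auto
    moreover have "norm (R s * (A s * F1 s)) \<le> K * norm (A s * F1 s)"
      unfolding norm_mult[of "R s"] using b0(2)[of s] s b by (intro mult_right_mono) auto
    ultimately show ?thesis by (metis norm_triangle_mono)
  qed
  have q2q: "(q s)^2 \<le> q s" if "s < 0" for s
    using q[OF that] by (simp add: power2_eq_square mult_left_le)
  have K2: "K \<le> K^2" "K^2 \<le> K^3" "K ^ 3 \<le> K ^ 4" "1 \<le> K^2"
    using K1 by (auto simp: self_le_power intro!: power_increasing)
  have AF1: "norm (A s * F1 s) \<le> norm (G s) + (q s)^2 * K^2" if s: "b \<le> s" "s < 0" for s
  proof -
    have "A s * F1 s = G s - A s * (R s * F0 s)" by (simp add: G_def algebra_simps)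
    then show ?thesis using norm_triangle_ineq4[of "G s" "A s * (R s * F0 s)"] RF[OF s] by simp
  qed
  \<comment> \<open>First pass: the forcing \<open>Y\<close> is merely bounded. The condition exp t
    >= 1/2 lets the derivative of \<open>q\<close> absorb it.\<close>
  have G1: "norm (G s) \<le> 4 * K^2 * q s" if s: "b \<le> s" "s < 0" for s
  proof -
    have "norm (G s) \<le> - ((\<lambda>s. - (4 * K^2 * q s)) s)"
    proof (rule bd[of _ "\<lambda>s. 4 * K^2 * exp s"])
      show "((\<lambda>s. - (4 * K^2 * q s)) has_real_derivative 4 * K^2 * exp t) (at t)" for t
        unfolding q_def by (auto intro!: derivative_eq_intros)
      show "((\<lambda>s. - (4 * K^2 * q s)) \<longlongrightarrow> 0) (at_left 0)"
        using tendsto_minus[OF tendsto_mult_right_zero[OF lq, of "4 * K^2"]] by simp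
      show "norm (Y t) \<le> 4 * K^2 * exp t" if t: "b \<le> t" "t < 0" for t
      proof -
        have "(q t)^2 * K^2 \<le> 1 * K^2" using q2q[OF t(2)] q[OF t(2)] by (intro mult_right_mono) auto
        moreover have "K * norm (A t * F1 t) \<le> K * 1" using b0(2)[of t] t b K1 by (intro mult_left_mono) auto
        moreover have "4 * K^2 * (1/2) \<le> 4 * K^2 * exp t" using b0(2)[of t] t b by (intro mult_left_mono) auto
        ultimately show ?thesis using Ybd[OF t] K2 by linarith
      qed
    qed (use s in auto)
    then show ?thesis by simp
  qed
  have AF1': "norm (A s * F1 s) \<le> 5 * K^2 * q s" if s: "b \<le> s" "s < 0" for s
    using AF1[OF s] G1[OF s] mult_right_mono[OF q2q[OF s(2)], of "K^2"] by (simp add: mult.commute[of "q s"])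
  \<comment> \<open>Second pass: \<open>A * F1\<close> is now of order \<open>q\<close>, hence so is
    \<open>Y\<close>, and \<open>G\<close> becomes of order \<open>q^2\<close>, the size of
    \<open>A\<close>; dividing by \<open>A\<close> bounds \<open>F1\<close>.\<close>
  have G2: "norm (G s) \<le> 6 * K ^ 3 * (q s)^2" if s: "b \<le> s" "s < 0" for s
  proof -
    have "norm (G s) \<le> - ((\<lambda>s. - (6 * K ^ 3 * (q s)^2)) s)"
    proof (rule bd[of _ "\<lambda>s. 12 * K ^ 3 * q s * exp s"])
      show "((\<lambda>s. - (6 * K ^ 3 * (q s)^2)) has_real_derivative 12 * K ^ 3 * q t * exp t) (at t)" for t
        unfolding q_def by (auto intro!: derivative_eq_intros)
      show "((\<lambda>s. - (6 * K ^ 3 * (q s)^2)) \<longlongrightarrow> 0) (at_left 0)"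
      proof -
        have "((\<lambda>s. - (6 * K ^ 3 * (q s)^2)) \<longlongrightarrow> - (6 * K ^ 3 * 0^2)) (at_left 0)"
          by (intro tendsto_intros lq)
        then show ?thesis by simp
      qed
      show "norm (Y t) \<le> 12 * K ^ 3 * q t * exp t" if t: "b \<le> t" "t < 0" for t
      proof -
        have "(q t)^2 * K^2 \<le> q t * K ^ 3" using q2q[OF t(2)] q[OF t(2)] K2 by (intro mult_mono) auto
        moreover have "K * norm (A t * F1 t) \<le> K * (5 * K^2 * q t)" using AF1'[OF t] K1 by (intro mult_left_mono) auto
        moreover have "K * (5 * K^2 * q t) = 5 * (q t * K ^ 3)" by (simp add: power2_eq_square power3_eq_cube)
        moreover have "12 * K ^ 3 * q t * (1/2) \<le> 12 * K ^ 3 * q t * exp t"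
          using b0(2)[of t] t b q[OF t(2)] K1 by (intro mult_left_mono) auto
        moreover have "12 * K ^ 3 * q t * (1/2) = 6 * (q t * K ^ 3)" by simp
        ultimately show ?thesis using Ybd[OF t] by linarith
      qed
    qed (use s in auto)
    then show ?thesis by simp
  qed
  have F1bd: "norm (F1 s) \<le> 7 * K ^ 3" if s: "b \<le> s" "s < 0" for s
  proof -
    have "(q s)^2 * norm (F1 s) \<le> 6 * K ^ 3 * (q s)^2 + (q s)^2 * K^2"
      using AF1[OF s] G2[OF s] by (simp add: norm_mult nA)
    also have "\<dots> \<le> 6 * K ^ 3 * (q s)^2 + (q s)^2 * K ^ 3"
      using K2 by (intro add_left_mono mult_left_mono) auto
    also have "\<dots> = (q s)^2 * (7 * K ^ 3)" by simp
    finally show ?thesis using q[OF s(2)] by (simp add: mult_le_cancel_left)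
  qed
  show ?thesis
  proof (rule that[OF b(1), of "8 * K ^ 4"])
    fix s assume s: "b \<le> s" "s < 0"
    have k4: "K * (7 * K ^ 3) = 7 * K ^ 4" "K * K = K^2" by (simp_all add: eval_nat_numeral)
    have "A s * F2 s = - (B s * F1 s + C s * F0 s)"
      using ode[OF s(2)] unfolding A_def B_def C_def by (simp only: eq_neg_iff_add_eq_0)
    then have "norm (A s * F2 s) = norm (B s * F1 s + C s * F0 s)" by (simp only: norm_minus_cancel)
    also have "\<dots> \<le> K * (7 * K ^ 3) + K * K"
      using b0(2)[of s] s b F1bd[OF s] K1
      by (intro norm_triangle_mono; simp only: norm_mult; intro mult_mono) auto
    finally have "norm (A s * F2 s) \<le> 8 * K ^ 4" using K2 unfolding k4 by simp
    moreover have "norm (F1 s) \<le> 8 * K ^ 4" using F1bd[OF s] K2 K1 by simp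
    moreover have "norm (F0 s) \<le> 8 * K ^ 4" using b0(2)[of s] s b K2 K1 by auto
    ultimately show "norm (F0 s) \<le> 8 * K ^ 4 \<and> norm (F1 s) \<le> 8 * K ^ 4
        \<and> norm (of_real ((1 - exp s)^2) * F2 s) \<le> 8 * K ^ 4"
      unfolding A_def by blast
  qed
qed

text \<open>The transform of a solution solves a second confluent Heun equation, whose conserved flux has definite sign
  at both ends.\<close>

lemma heun_limit_zero:
  assumes lim0: "(F0 \<longlongrightarrow> L) at_bot" and lim1: "(F1 \<longlongrightarrow> 0) at_bot"
    and bdd: "\<forall>\<^sub>F s in at_left 0. norm (F0 s) \<le> K0"
    and slope: "((\<lambda>s. of_real ((1 - exp s)^2) * F1 s) \<longlongrightarrow> 0) (at_left 0)"
    and Imc: "Im c = \<epsilon> / 2 - \<kappa> + \<delta>"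
    and sgn: "\<epsilon> * \<delta> > 0"
  shows "L = 0"
proof -
  have \<delta>: "\<delta> \<noteq> 0" using sgn by auto
  obtain F :: "nat \<Rightarrow> real \<Rightarrow> complex" where F: "F 0 = F0" "F 1 = F1" "F 2 = F2"
    and tame: "\<And>k. k \<le> 4 \<Longrightarrow> left_tame (F k)"
    and dF: "\<And>k s. k < 4 \<Longrightarrow> s < 0 \<Longrightarrow> (F k has_vector_derivative F (Suc k) s) (at s)"
    and limF: "\<And>k. 0 < k \<Longrightarrow> k \<le> 4 \<Longrightarrow> (F k \<longlongrightarrow> 0) at_bot"
  proof (rule heun_derivative_ladder[OF lim0 lim1])
    fix F :: "nat \<Rightarrow> real \<Rightarrow> complex"
    assume "F 0 = F0" "F 1 = F1" "F 2 = F2"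
      "\<And>k. k \<le> 4 \<Longrightarrow> left_tame (F k)"
      "\<And>k s. k < 4 \<Longrightarrow> s < 0 \<Longrightarrow> (F k has_vector_derivative F (Suc k) s) (at s)"
      "\<And>k. 0 < k \<Longrightarrow> k \<le> 4 \<Longrightarrow> (F k \<longlongrightarrow> 0) at_bot"
    then show thesis by (rule that)
  qed
  obtain b K where b: "b < 0" "\<And>s. b \<le> s \<Longrightarrow> s < 0 \<Longrightarrow> norm (F0 s) \<le> K \<and> norm (F1 s) \<le> K
    \<and> norm (of_real ((1 - exp s)^2) * F2 s) \<le> K"
  proof (rule heun_bounded_at_left[OF \<delta> bdd slope])
    fix b K assume "b < 0" "\<And>s. b \<le> s \<Longrightarrow> s < 0 \<Longrightarrow> norm (F0 s) \<le> K \<and> norm (F1 s) \<le> K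
      \<and> norm (of_real ((1 - exp s)^2) * F2 s) \<le> K"
    then show thesis by (rule that)
  qed
  \<comment> \<open>Bounds on all of s < 0, joined from tameness up to \<open>b\<close> and from the
    estimate near 0.\<close>
  obtain K' where K': "\<And>s. s < 0 \<Longrightarrow> norm (F 0 s) \<le> K'" "\<And>s. s < 0 \<Longrightarrow> norm (F 1 s) \<le> K'"
    "\<And>s. s < 0 \<Longrightarrow> norm (of_real ((1 - exp s)^2) * F 2 s) \<le> K'" "K' \<ge> 0"
  proof -
    obtain M0 where M0: "M0 \<ge> 0" "\<And>s. s \<le> b \<Longrightarrow> norm (F 0 s) \<le> M0" using left_tameD[OF tame[of 0] b(1)] by auto
    obtain M1 where M1: "M1 \<ge> 0" "\<And>s. s \<le> b \<Longrightarrow> norm (F 1 s) \<le> M1" using left_tameD[OF tame[of 1] b(1)] by auto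
    obtain M2 where M2: "M2 \<ge> 0" "\<And>s. s \<le> b \<Longrightarrow> norm (F 2 s) \<le> M2" using left_tameD[OF tame[of 2] b(1)] by auto
    have M2': "norm (of_real ((1 - exp s)^2) * F 2 s) \<le> M2" if "s \<le> b" for s
    proof -
      have "(1 - exp s)^2 \<le> 1" using that b(1) by (intro power_le_one) auto
      then have "(1 - exp s)^2 * norm (F 2 s) \<le> 1 * M2" using M2(2)[OF that] by (intro mult_mono) auto
      then show ?thesis unfolding norm_mult norm_of_real by simp
    qed
    show ?thesis
    proof (rule that[of "\<bar>K\<bar> + M0 + M1 + M2"])
      fix s :: real assume s: "s < 0"
      have T: "x \<le> \<bar>K\<bar> + M0 + M1 + M2" if "s \<le> b \<Longrightarrow> x \<le> m" "b \<le> s \<Longrightarrow> x \<le> K" "m \<le> M0 + M1 + M2" for x m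
        using that M0(1) M1(1) M2(1) by (cases "s \<le> b") auto
      show "norm (F 0 s) \<le> \<bar>K\<bar> + M0 + M1 + M2"
        by (rule T[OF M0(2)]) (use b(2)[of s] s F M1(1) M2(1) in auto)
      show "norm (F 1 s) \<le> \<bar>K\<bar> + M0 + M1 + M2"
        by (rule T[OF M1(2)]) (use b(2)[of s] s F M0(1) M2(1) in auto)
      show "norm (of_real ((1 - exp s)^2) * F 2 s) \<le> \<bar>K\<bar> + M0 + M1 + M2"
        by (rule T[OF M2']) (use b(2)[of s] s M0(1) M1(1) in \<open>simp_all add: F\<close>)
    qed (use M0 M1 M2 in simp)
  qed
  define g where "g k = kober \<kappa> (\<epsilon> + \<kappa>) (F k)" for k
  define f where "f k s = g (Suc k) s + (1 - \<i> * \<epsilon>) * g k s" for k s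
  have dg: "(g k has_vector_derivative g (Suc k) s) (at s)" if "k < 4" "s < 0" for k s
    unfolding g_def using that by (intro kober_has_vector_derivative tame dF) auto
  have df: "(f k has_vector_derivative f (Suc k) s) (at s)" if "k < 3" "s < 0" for k s
    unfolding f_def using that by (intro has_vector_derivative_add has_vector_derivative_mult_right dg) auto
  have df0: "(f 0 has_vector_derivative f 1 s) (at s)" and df1: "(f 1 has_vector_derivative f 2 s) (at s)"
    and df2: "(f 2 has_vector_derivative f 3 s) (at s)" if "s < 0" for s
    using df[of 0 s] df[of 1 s] df[of 2 s] that by (simp_all add: eval_nat_numeral)
  define I where "I = integral {0<..<1} (kober_kernel \<kappa> (\<epsilon> + \<kappa>))"
  have limg: "(g k \<longlongrightarrow> 0) at_bot" if "0 < k" "k \<le> 4" for k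
    using kober_tendsto_at_bot[OF tame limF] that unfolding g_def by fastforce
  have limg0: "(g 0 \<longlongrightarrow> L * I) at_bot"
    using kober_tendsto_at_bot[OF tame[of 0]] lim0 unfolding g_def F I_def by auto
  have limf: "(f k \<longlongrightarrow> 0) at_bot" if "0 < k" "k \<le> 3" for k
    using tendsto_add[OF limg[of "Suc k"] tendsto_mult[OF tendsto_const limg[of k]], of "1 - \<i> * \<epsilon>"] that
    unfolding f_def by simp
  have limf0: "(f 0 \<longlongrightarrow> (1 - \<i> * \<epsilon>) * (L * I)) at_bot"
    using tendsto_add[OF limg[of 1] tendsto_mult[OF tendsto_const limg0], of "1 - \<i> * \<epsilon>"]
    unfolding f_def by simp
  have limf': "(f 1 \<longlongrightarrow> 0) at_bot" "(f 2 \<longlongrightarrow> 0) at_bot" "(f 3 \<longlongrightarrow> 0) at_bot"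
    by (intro limf; simp)+
  define b1 where "b1 = - 2 + \<i> * complex_of_real (\<epsilon> + 2 * \<delta> - 2 * \<kappa>)"
  define y where "y s = complex_of_real (exp s)" for s
  define p where "p s = - 2 * f 2 s + b1 * f 1 s + c * f 0 s" for s
  define p' where "p' s = - 2 * f 3 s + b1 * f 2 s + c * f 1 s" for s
  define r where "r s = f 2 s + 2 * (1 + \<i> * \<kappa>) * f 1 s + (1 + \<i> * \<kappa>)^2 * f 0 s" for s
  define r' where "r' s = f 3 s + 2 * (1 + \<i> * \<kappa>) * f 2 s + (1 + \<i> * \<kappa>)^2 * f 1 s" for s
  \<comment> \<open>The left side of the transformed equation, with i \<kappa> replaced by -i
    \<epsilon> at y^0 and both exponents at y^2 equal to 1 + i \<kappa>.\<close>
  define e where "e s = (f 2 s - \<i> * \<epsilon> * f 1 s) + y s * p s + y s * (y s * r s)" for s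
  have e0: "e s = 0" if s: "s < 0" for s
  proof -
    have inter: "(f 3 t - \<i> * \<epsilon> * f 2 t) + \<i> * \<kappa> * (f 2 t - \<i> * \<epsilon> * f 1 t)
       + y t * (p' t + (1 + \<i> * \<kappa>) * p t) + y t * (y t * (r' t + (2 + \<i> * \<kappa>) * r t)) = 0" if t: "t < 0" for t
    proof -
      have "(F 2 s + \<i> * \<kappa> * F 1 s + 0 * F 0 s)
        + of_real (exp s) * (- 2 * F 2 s + b1 * F 1 s + c * F 0 s)
        + of_real (exp s) * (of_real (exp s) * (F 2 s + (2 + \<i> * \<kappa> - \<i> * \<epsilon>) * F 1 s + (1 - \<i> * \<epsilon>) * (1 + \<i> * \<kappa>) * F 0 s)) = 0"
        if "s < 0" for s
        using ode[OF that] unfolding F one_minus_exp_sq heun_B_def heun_C_def b1_def[symmetric]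
        by (simp add: algebra_simps power2_eq_square)
      from kober_intertwining[OF tame dF this t] show ?thesis
        unfolding f_def g_def p_def p'_def r_def r'_def y_def .
    qed
    \<comment> \<open>The intertwining only gives (\<theta> + i \<kappa>) e = 0. Hence the norm of
      \<open>e\<close> is constant, and it tends to 0 at the horizon.\<close>
    have de: "(e has_vector_derivative (\<i> * of_real (- \<kappa>) * e t + 0)) (at t)" if t: "t < 0" for t
    proof -
      have "(e has_vector_derivative (f 3 t - \<i> * \<epsilon> * f 2 t) + y t * (p t + p' t)
          + y t * (y t * r t + y t * (r t + r' t))) (at t)"
        unfolding e_def p_def p'_def r_def r'_def y_def
        by (intro has_vector_derivative_add has_vector_derivative_diff has_vector_derivative_mult_right
            has_vector_derivative_exp_mult df0[OF t] df1[OF t] df2[OF t])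
      moreover have "(f 3 t - \<i> * \<epsilon> * f 2 t) + y t * (p t + p' t) + y t * (y t * r t + y t * (r t + r' t))
          = \<i> * of_real (- \<kappa>) * e t + 0"
        using inter[OF t] unfolding e_def by (simp add: algebra_simps add_eq_0_iff eq_neg_iff_add_eq_0)
      ultimately show ?thesis by simp
    qed
    have ly: "(y \<longlongrightarrow> 0) at_bot"
    proof -
      have "(y \<longlongrightarrow> of_real 0) at_bot" unfolding y_def by (intro tendsto_of_real exp_at_bot)
      then show ?thesis by simp
    qed
    have "(e \<longlongrightarrow> (0 - \<i> * \<epsilon> * 0) + 0 * (- 2 * 0 + b1 * 0 + c * ((1 - \<i> * \<epsilon>) * (L * I)))
       + 0 * (0 * (0 + 2 * (1 + \<i> * \<kappa>) * 0 + (1 + \<i> * \<kappa>)^2 * ((1 - \<i> * \<epsilon>) * (L * I))))) at_bot"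
      unfolding e_def p_def r_def by (intro tendsto_intros ly limf' limf0)
    then have "((\<lambda>t. norm (e t)) \<longlongrightarrow> norm (0::complex)) at_bot" by (intro tendsto_norm) simp
    moreover have "\<forall>\<^sub>F t in at_bot. norm (e t) = norm (e s)"
      using eventually_le_at_bot[of s]
    proof eventually_elim
      case (elim t)
      have "\<bar>norm (e s) - norm (e t)\<bar> \<le> (\<lambda>_. 0) s - (\<lambda>_. 0) t"
        by (rule norm_growth_phase_ode[OF elim, of e "\<lambda>_. - \<kappa>" "\<lambda>_. 0" _ "\<lambda>_. 0"])
           (use s de in \<open>auto intro!: derivative_eq_intros\<close>)
      then show ?case by simp
    qed
    ultimately have "((\<lambda>t::real. norm (e s)) \<longlongrightarrow> norm (0::complex)) at_bot"
      by (rule Lim_transform_eventually)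
    then show ?thesis by (simp add: tendsto_const_iff)
  qed
  \<comment> \<open>The imaginary part of the coefficient of \<theta> in the transformed equation.
    It runs from -\<epsilon> at the horizon to 2 \<delta> at infinity, without \<kappa> at either
    end.\<close>
  define \<beta> where "\<beta> s = - \<epsilon> + (\<epsilon> - 2 * \<kappa> + 2 * \<delta>) * exp s + 2 * \<kappa> * (exp s)^2" for s
  define W where "W s = (1 - exp s)^2 * Im (cnj (f 0 s) * f 1 s) + \<beta> s / 2 * (norm (f 0 s))^2" for s
  \<comment> \<open>Conservation rests on two coincidences: the real part of the coefficient of
    \<theta> is the derivative of (1 - y)^2, and the imaginary part of the zeroth-order coefficient
    is half the derivative of \<beta>, which is where \<open>Imc\<close> enters.\<close>
  have dW: "(W has_real_derivative 0) (at s)" if s: "s < 0" for s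
  proof -
    have d1: "((\<lambda>s. Im (cnj (f 0 s) * f 1 s)) has_real_derivative Im (cnj (f 0 s) * f 2 s)) (at s)"
    proof -
      have "((\<lambda>s. cnj (f 0 s) * f 1 s) has_vector_derivative (cnj (f 0 s) * f 2 s + cnj (f 1 s) * f 1 s)) (at s)"
        by (intro has_vector_derivative_mult has_vector_derivative_cnj df0[OF s] df1[OF s])
      from bounded_linear.has_vector_derivative[OF bounded_linear_Im this] show ?thesis
        by (simp add: has_real_derivative_iff_has_vector_derivative)
    qed
    have d2: "((\<lambda>s. (1 - exp s)^2) has_real_derivative (- 2 * exp s * (1 - exp s))) (at s)"
      by (auto intro!: derivative_eq_intros)
    have d3: "((\<lambda>s. \<beta> s / 2) has_real_derivative ((\<epsilon> - 2 * \<kappa> + 2 * \<delta>) * exp s / 2 + 2 * \<kappa> * (exp s)^2)) (at s)"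
      unfolding \<beta>_def by (auto intro!: derivative_eq_intros simp: power2_eq_square field_simps)
    have "(W has_real_derivative
       (- 2 * exp s * (1 - exp s)) * Im (cnj (f 0 s) * f 1 s) + Im (cnj (f 0 s) * f 2 s) * (1 - exp s)^2
       + (((\<epsilon> - 2 * \<kappa> + 2 * \<delta>) * exp s / 2 + 2 * \<kappa> * (exp s)^2) * (norm (f 0 s))^2
          + (2 * Re (cnj (f 0 s) * f 1 s)) * (\<beta> s / 2))) (at s)"
      unfolding W_def by (intro DERIV_add DERIV_mult d1 d2 d3 has_real_derivative_norm_power2 df0[OF s])
    moreover have "(- 2 * exp s * (1 - exp s)) * Im (cnj (f 0 s) * f 1 s) + Im (cnj (f 0 s) * f 2 s) * (1 - exp s)^2
       + (((\<epsilon> - 2 * \<kappa> + 2 * \<delta>) * exp s / 2 + 2 * \<kappa> * (exp s)^2) * (norm (f 0 s))^2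
          + (2 * Re (cnj (f 0 s) * f 1 s)) * (\<beta> s / 2)) = 0"
    proof -
      define x where "x = exp s"
      define bt where "bt = complex_of_real (- 2 * x * (1 - x)) + \<i> * of_real (\<beta> s)"
      define ct where "ct = c * of_real x + (1 + \<i> * \<kappa>)^2 * (of_real x)^2"
      have "of_real ((1 - x)^2) * f 2 s = - (bt * f 1 s + ct * f 0 s)"
        using e0[OF s] unfolding e_def p_def r_def y_def b1_def bt_def ct_def \<beta>_def x_def[symmetric]
        by (simp add: algebra_simps power2_eq_square add_eq_0_iff eq_neg_iff_add_eq_0)
      moreover have "q * w2 = - (d * w1 + d' * w0) \<Longrightarrow> q * (n * w2) = - (d * (n * w1) + d' * (n * w0))"
        for q w2 d w1 d' w0 n :: complex
        by algebra
      ultimately have "of_real ((1 - x)^2) * (cnj (f 0 s) * f 2 s) = - (bt * (cnj (f 0 s) * f 1 s) + ct * (cnj (f 0 s) * f 0 s))"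
        by blast
      then have "Im (of_real ((1 - x)^2) * (cnj (f 0 s) * f 2 s)) = Im (- (bt * (cnj (f 0 s) * f 1 s) + ct * (cnj (f 0 s) * f 0 s)))"
        by simp
      moreover have "Im (of_real ((1 - x)^2) * (cnj (f 0 s) * f 2 s)) = (1 - x)^2 * Im (cnj (f 0 s) * f 2 s)"
        by (simp only: times_complex.sel Re_complex_of_real Im_complex_of_real mult_zero_left add_0_right)
      moreover have "Im (- (bt * (cnj (f 0 s) * f 1 s) + ct * (cnj (f 0 s) * f 0 s)))
        = - (Re bt * Im (cnj (f 0 s) * f 1 s) + Im bt * Re (cnj (f 0 s) * f 1 s)) - Im ct * (norm (f 0 s))^2"
        unfolding cmod_power2 by (simp add: power2_eq_square algebra_simps)
      moreover have "Re bt = - 2 * x * (1 - x)" "Im bt = \<beta> s" unfolding bt_def by simp_all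
      moreover have "Im ct = (\<epsilon> - 2 * \<kappa> + 2 * \<delta>) * x / 2 + 2 * \<kappa> * x^2"
      proof -
        have "Im ct = Im c * x + 2 * \<kappa> * x^2"
          unfolding ct_def by (simp add: power2_eq_square algebra_simps)
        then show ?thesis unfolding Imc by (simp add: field_simps)
      qed
      ultimately show ?thesis unfolding x_def[symmetric] by (simp add: algebra_simps)
    qed
    ultimately show ?thesis by simp
  qed
  have Wconst: "W s = W t" if "s < 0" "t < 0" for s t
  proof -
    obtain w where "\<And>x. x \<in> {..<0} \<Longrightarrow> W x = w"
      using has_field_derivative_zero_constant[of "{..<0}" W] dW
      by (metis convex_real_interval(4) has_field_derivative_at_within lessThan_iff)
    then show ?thesis using that by simp
  qed
  define W0 where "W0 = W (-1)"
  have W0: "W s = W0" if "s < 0" for s using Wconst[OF that, of "-1"] by (simp add: W0_def)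
  have "W0 = - \<epsilon> / 2 * (norm ((1 - \<i> * \<epsilon>) * (L * I)))^2"
  proof -
    have "(W \<longlongrightarrow> (1 - 0)^2 * Im (cnj ((1 - \<i> * \<epsilon>) * (L * I)) * 0)
        + (- \<epsilon> + (\<epsilon> - 2 * \<kappa> + 2 * \<delta>) * 0 + 2 * \<kappa> * 0^2) / 2 * (norm ((1 - \<i> * \<epsilon>) * (L * I)))^2) at_bot"
      unfolding W_def \<beta>_def by (intro tendsto_intros limf0 limf' exp_at_bot) auto
    moreover have "(W \<longlongrightarrow> W0) at_bot"
    proof (rule tendsto_eventually)
      show "\<forall>\<^sub>F s in at_bot. W s = W0"
        using eventually_gt_at_bot[of 0] by eventually_elim (rule W0)
    qed
    ultimately show ?thesis using tendsto_unique[OF trivial_limit_at_bot_linorder] by fastforce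
  qed
  \<comment> \<open>No limit of \<open>f 0\<close> at s = 0 is required: the Wronskian part tends to
    0, and the rest is nonnegative after multiplication by \<delta> because \<delta> \<beta> tends
    to 2 \<delta>^2 > 0.\<close>
  moreover have "\<delta> * W0 \<ge> 0"
  proof -
    have g0: "norm (g 0 s) \<le> K'" and g1: "norm (g 1 s) \<le> K'" and g2: "norm (g 2 s) \<le> K' / (1 - exp s)" if "s < 0" for s
      unfolding g_def using that K' by (auto intro!: kober_norm_le kober_norm_le_of_inverse_square tame)
    define n where "n = norm (1 - \<i> * complex_of_real \<epsilon>)"
    have n: "n \<ge> 0" by (simp add: n_def)
    have fb0: "norm (f 0 s) \<le> K' + n * K'" if "s < 0" for s
      unfolding f_def using that g0[OF that] g1[OF that] n
      by (intro norm_triangle_mono) (auto simp: norm_mult n_def[symmetric] intro!: mult_left_mono)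
    have fb1: "norm (f 1 s) \<le> K' / (1 - exp s) + n * K'" if "s < 0" for s
      unfolding f_def using that g1[OF that] g2[OF that] n
      by (intro norm_triangle_mono) (auto simp: norm_mult n_def[symmetric] numeral_2_eq_2 intro!: mult_left_mono)
    \<comment> \<open>\<open>f 0\<close> is bounded and \<open>f 1\<close> is of order 1 / (1 - y),
      so one factor 1 - y is left over.\<close>
    have "((\<lambda>s. (1 - exp s)^2 * Im (cnj (f 0 s) * f 1 s)) \<longlongrightarrow> 0) (at_left 0)"
    proof (rule Lim_null_comparison)
      show "\<forall>\<^sub>F s in at_left 0. norm ((1 - exp s)^2 * Im (cnj (f 0 s) * f 1 s))
          \<le> (1 - exp s) * (K' + n * K') * K' + (1 - exp s)^2 * (K' + n * K') * (n * K')"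
        unfolding eventually_at_left_0
      proof (intro exI[of _ "-1"] conjI allI impI)
        fix s :: real assume s: "s < 0"
        have q: "1 - exp s > 0" using s by simp
        have "\<bar>Im (cnj (f 0 s) * f 1 s)\<bar> \<le> norm (f 0 s) * norm (f 1 s)"
          using abs_Im_le_cmod[of "cnj (f 0 s) * f 1 s"] by (simp add: norm_mult)
        also have "\<dots> \<le> (K' + n * K') * (K' / (1 - exp s) + n * K')"
          using fb0[OF s] fb1[OF s] n K'(4) by (intro mult_mono) auto
        finally have "(1 - exp s)^2 * \<bar>Im (cnj (f 0 s) * f 1 s)\<bar> \<le> (1 - exp s)^2 * ((K' + n * K') * (K' / (1 - exp s) + n * K'))"
          by (intro mult_left_mono) auto
        also have "\<dots> = (1 - exp s) * (K' + n * K') * K' + (1 - exp s)^2 * (K' + n * K') * (n * K')"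
          using q by (simp add: power2_eq_square field_simps)
        finally show "norm ((1 - exp s)^2 * Im (cnj (f 0 s) * f 1 s))
          \<le> (1 - exp s) * (K' + n * K') * K' + (1 - exp s)^2 * (K' + n * K') * (n * K')"
          by (simp add: abs_mult)
      qed simp
      have "((\<lambda>s. (1 - exp s) * (K' + n * K') * K' + (1 - exp s)^2 * (K' + n * K') * (n * K')) \<longlongrightarrow>
         (1 - exp 0) * (K' + n * K') * K' + (1 - exp 0)^2 * (K' + n * K') * (n * K')) (at_left 0)"
        by (intro tendsto_intros)
      then show "((\<lambda>s. (1 - exp s) * (K' + n * K') * K' + (1 - exp s)^2 * (K' + n * K') * (n * K')) \<longlongrightarrow> 0) (at_left 0)"
        by simp
    qed
    then have l: "((\<lambda>s. \<delta> * ((1 - exp s)^2 * Im (cnj (f 0 s) * f 1 s))) \<longlongrightarrow> 0) (at_left 0)"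
      by (rule tendsto_mult_right_zero)
    have "((\<lambda>s. \<delta> * \<beta> s) \<longlongrightarrow> \<delta> * (- \<epsilon> + (\<epsilon> - 2 * \<kappa> + 2 * \<delta>) * exp 0 + 2 * \<kappa> * (exp 0)^2)) (at_left 0)"
      unfolding \<beta>_def by (intro tendsto_intros)
    moreover have "\<delta> * (- \<epsilon> + (\<epsilon> - 2 * \<kappa> + 2 * \<delta>) * exp 0 + 2 * \<kappa> * (exp 0)^2) > 0"
      using \<delta> by (auto simp: algebra_simps zero_less_mult_iff)
    ultimately have "\<forall>\<^sub>F s in at_left 0. \<delta> * \<beta> s > 0" by (rule order_tendstoD)
    then have "\<forall>\<^sub>F s in at_left 0. \<delta> * ((1 - exp s)^2 * Im (cnj (f 0 s) * f 1 s)) \<le> \<delta> * W0"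
      using eventually_at_left_real[of "-1" "0::real", simplified]
    proof eventually_elim
      case (elim s)
      have "\<delta> * W0 = \<delta> * ((1 - exp s)^2 * Im (cnj (f 0 s) * f 1 s)) + \<delta> * \<beta> s * ((norm (f 0 s))^2 / 2)"
      proof -
        have "\<delta> * (u + v / 2 * z) = \<delta> * u + \<delta> * v * (z / 2)" for u v z :: real
          by (simp add: distrib_left)
        then show ?thesis using W0[of s] elim unfolding W_def by metis
      qed
      then show ?case using elim by simp
    qed
    from tendsto_upperbound[OF l this] show ?thesis by simp
  qed
  ultimately have "\<epsilon> * \<delta> * (norm ((1 - \<i> * \<epsilon>) * (L * I)))^2 \<le> 0" by (simp add: mult_ac)
  then have "(1 - \<i> * \<epsilon>) * (L * I) = 0"
    using sgn by (metis mult_le_0_iff not_le norm_eq_zero power2_less_eq_zero_iff zero_less_power2)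
  moreover have "1 - \<i> * complex_of_real \<epsilon> \<noteq> 0" by (simp add: complex_eq_iff)
  moreover have "I \<noteq> 0" unfolding I_def by (rule kober_kernel_integral_nonzero)
  ultimately show ?thesis by simp
qed

lemma heun_solution_zero:
  assumes lim0: "(F0 \<longlongrightarrow> L) at_bot" and lim1: "(F1 \<longlongrightarrow> 0) at_bot"
    and bdd: "\<forall>\<^sub>F s in at_left 0. norm (F0 s) \<le> K0"
    and slope: "((\<lambda>s. of_real ((1 - exp s)^2) * F1 s) \<longlongrightarrow> 0) (at_left 0)"
    and Imc: "Im c = \<epsilon> / 2 - \<kappa> + \<delta>" and sgn: "\<epsilon> * \<delta> > 0" and "s < 0"
  shows "F0 s = 0"
proof -
  have "L = 0"
    by (rule heun_limit_zero[OF lim0 lim1 bdd slope Imc sgn])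
  with lim0 have "(F0 \<longlongrightarrow> 0) at_bot" by simp
  from heun_zero_of_limit_zero[OF this lim1 \<open>s < 0\<close>] show ?thesis .
qed

end

section \<open>Reduction of the radial equation\<close>

lemma kerr_horizons:
  assumes "M > 0" "\<bar>a\<bar> < M"
  defines "p \<equiv> kerr_rp M a" and "q \<equiv> kerr_rm M a"
  shows "p + q = 2 * M" "p * q = a^2" "q < p" "0 \<le> q"
    "kerr_Delta M a r = (r - p) * (r - q)"
proof -
  have "a^2 < M^2" using assms(2) by (metis abs_ge_zero power2_abs power_strict_mono pos2)
  then have s: "(sqrt (M^2 - a^2))^2 = M^2 - a^2" "sqrt (M^2 - a^2) > 0" by auto
  have "sqrt (M^2 - a^2) \<le> sqrt (M^2)" by (rule real_sqrt_le_mono) simp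
  then show "p + q = 2 * M" "q < p" "0 \<le> q"
    using s assms(1) by (auto simp: p_def q_def kerr_rp_def kerr_rm_def)
  then show pq: "p * q = a^2"
    using s by (simp add: p_def q_def kerr_rp_def kerr_rm_def algebra_simps power2_eq_square)
  have "(r - p) * (r - q) = r^2 - (p + q) * r + p * q" by (simp add: algebra_simps power2_eq_square)
  then show "kerr_Delta M a r = (r - p) * (r - q)"
    using pq \<open>p + q = 2 * M\<close> by (simp add: kerr_Delta_def)
qed

text \<open>Below \<open>p\<close> and \<open>q\<close> stand for the horizon radii \<open>r\<^sub>+\<close> and \<open>r\<^sub>-\<close>, \<open>k\<close> for \<open>\<xi> / \<i>\<close>, and \<open>w\<close> for the frequency.
  \<open>kerr_E\<close> is the reciprocal of the factor split off from \<open>u\<close>; \<open>kerr_N\<close> is \<open>\<Delta>\<close> times the logarithmic derivative of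
  that factor, and \<open>kerr_Lam\<close> its part without the square root.\<close>

definition kerr_Lam :: "real \<Rightarrow> real \<Rightarrow> real \<Rightarrow> real \<Rightarrow> real \<Rightarrow> complex" where
  "kerr_Lam p q k w r = \<i> * w * of_real ((r - p) * (r - q)) + \<i> * k * of_real (r - q)
     + (- 1 + \<i> * of_real ((p + q) * w) - \<i> * k) * of_real (r - p)"

definition kerr_N :: "real \<Rightarrow> real \<Rightarrow> real \<Rightarrow> real \<Rightarrow> real \<Rightarrow> complex" where
  "kerr_N p q k w r = kerr_Lam p q k w r + of_real ((r - p) * (r - q) * r / (r^2 + p * q))"

definition kerr_E :: "real \<Rightarrow> real \<Rightarrow> real \<Rightarrow> real \<Rightarrow> real \<Rightarrow> complex" where
  "kerr_E p q k w r = exp (- (\<i> * w * of_real r + \<i> * k * of_real (ln (r - p))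
     + (- 1 + \<i> * of_real ((p + q) * w) - \<i> * k) * of_real (ln (r - q)) + of_real (ln (r^2 + p * q) / 2)))"

lemma kerr_E_has_vector_derivative:
  assumes "0 \<le> q" "q < p" "p < r"
  shows "(kerr_E p q k w has_vector_derivative (- (kerr_N p q k w r / of_real ((r - p) * (r - q))) * kerr_E p q k w r)) (at r)"
proof -
  have \<rho>: "r^2 + p * q > 0" using assms by (simp add: add_pos_nonneg)
  define z where "z = - 1 + \<i> * complex_of_real ((p + q) * w) - \<i> * k"
  define h where "h r = - (\<i> * w * of_real r + \<i> * k * of_real (ln (r - p)) + z * of_real (ln (r - q)) + of_real (ln (r^2 + p * q) / 2))" for r :: real
  define h' where "h' = - (\<i> * w * of_real 1 + \<i> * k * of_real (1 / (r - p)) + z * of_real (1 / (r - q)) + of_real (r / (r^2 + p * q)))"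
  have "((\<lambda>r. ln (r^2 + p * q)) has_real_derivative 2 * r / (r^2 + p * q)) (at r)"
    using \<rho> by (auto intro!: derivative_eq_intros)
  note l2 = DERIV_cdivide[OF this, of 2]
  have "2 * r / X / 2 = r / X" for X :: real by simp
  note l2 = l2[unfolded this]
  have "((\<lambda>r. ln (r - p)) has_real_derivative 1 / (r - p)) (at r)" "((\<lambda>r. ln (r - q)) has_real_derivative 1 / (r - q)) (at r)"
    "((\<lambda>r. r) has_real_derivative 1) (at r)"
    using assms by (auto intro!: derivative_eq_intros)
  note d = this[THEN has_vector_derivative_of_real, where 'a = complex] l2[THEN has_vector_derivative_of_real, where 'a = complex]
  have "(h has_vector_derivative h') (at r)"
    unfolding h_def h'_def
    by (intro has_vector_derivative_minus has_vector_derivative_add has_vector_derivative_mult_right d)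
  from field_vector_diff_chain_at[OF this DERIV_exp]
  have "(kerr_E p q k w has_vector_derivative h' * kerr_E p q k w r) (at r)"
    unfolding kerr_E_def h_def z_def o_def by (simp add: mult.commute)
  moreover have "h' = - (kerr_N p q k w r / of_real ((r - p) * (r - q)))"
  proof -
    have nz: "complex_of_real (r - p) \<noteq> 0" "complex_of_real (r - q) \<noteq> 0" using assms by (simp_all del: of_real_diff)
    have "complex_of_real ((r - p) * (r - q) * r / (r^2 + p * q)) = of_real (r - p) * of_real (r - q) * of_real (r / (r^2 + p * q))"
      by (simp del: of_real_diff of_real_add)
    moreover have "x \<noteq> 0 \<Longrightarrow> y \<noteq> 0 \<Longrightarrow> - (c * 1 + d * (1 / x) + z * (1 / y) + g)
        = - ((c * (x * y) + d * y + z * x + x * y * g) / (x * y))" for x y c d g :: complex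
      by (simp add: field_simps)
    ultimately show ?thesis
      unfolding h'_def kerr_N_def kerr_Lam_def z_def[symmetric] of_real_mult[of "r - p" "r - q"] of_real_divide[of 1] of_real_1
      using nz by (simp only:)
  qed
  ultimately show ?thesis by simp
qed

text \<open>Both conclusions are stated for d/dr; with \<theta> = (r - p) (r - q) / (p - q) d/dr
  they say that \<open>f1\<close> is \<theta> \<open>f0\<close> and that \<open>f0\<close> satisfies
  a second-order equation. \<open>C\<close> collects what is left at order zero after the factor has
  been split off.\<close>

lemma kerr_radial_to_heun_derivs:
  fixes p q k w :: real and lam V U2 :: complex and u u1 :: "real \<Rightarrow> complex" and rs :: "real \<Rightarrow> real"
  assumes pq: "0 \<le> q" "q < p" "p < r"
    and rs: "(rs has_real_derivative (r^2 + p * q) / ((r - p) * (r - q))) (at r)"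
    and u: "(u has_vector_derivative u1 (rs r)) (at (rs r))"
    and u1: "(u1 has_vector_derivative U2) (at (rs r))"
    and ode: "U2 + (w^2 - V) * u (rs r) = 0"
    and V: "V = (of_real (2 * (p + q) * r * n * w - n^2) + of_real ((r - p) * (r - q)) * (lam + of_real (p * q * w^2)))
        / of_real ((r^2 + p * q)^2)
      + of_real ((r - p) * (r - q) / (r^2 + p * q) ^ 4 * (p * q * ((r - p) * (r - q)) + (p + q) * r * (r^2 - p * q)))"
  defines "C \<equiv> (kerr_Lam p q k w r)^2 + of_real ((r - p) * (r - q)) * (2 * \<i> * w * r - 1) + of_real (w^2 * (r^2 + p * q)^2)
       - of_real (2 * (p + q) * r * n * w) + of_real (n^2) - of_real ((r - p) * (r - q)) * (lam + of_real (p * q * w^2))"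
  defines "f0 \<equiv> \<lambda>r. u (rs r) * kerr_E p q k w r"
    and "f1 \<equiv> \<lambda>r. (of_real (r^2 + p * q) * u1 (rs r) - kerr_N p q k w r * u (rs r)) * kerr_E p q k w r / of_real (p - q)"
  shows "(f0 has_vector_derivative (of_real ((p - q) / ((r - p) * (r - q))) * f1 r)) (at r)"
    and "(f1 has_vector_derivative (of_real ((p - q) / ((r - p) * (r - q)))
       * (- (2 * kerr_Lam p q k w r * of_real (p - q) * f1 r + C * f0 r) / (of_real (p - q))^2))) (at r)"
proof -
  define D where "D = complex_of_real ((r - p) * (r - q))"
  define \<rho> where "\<rho> = complex_of_real (r^2 + p * q)"
  define b where "b = complex_of_real (p - q)"
  define U where "U = u (rs r)"
  define U1 where "U1 = u1 (rs r)"
  define N where "N = kerr_N p q k w r"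
  define E where "E = kerr_E p q k w r"
  define \<Lambda> where "\<Lambda> = kerr_Lam p q k w r"
  have rho: "r^2 + p * q > 0" using pq by (simp add: add_pos_nonneg)
  have nz: "D \<noteq> 0" "\<rho> \<noteq> 0" "b \<noteq> 0"
    using pq rho by (simp_all add: D_def \<rho>_def b_def del: of_real_diff of_real_add of_real_mult)
  have dE: "(kerr_E p q k w has_vector_derivative (- (N / D) * E)) (at r)"
    unfolding N_def D_def E_def by (rule kerr_E_has_vector_derivative[OF pq])
  have "((u \<circ> rs) has_vector_derivative ((r^2 + p * q) / ((r - p) * (r - q))) *\<^sub>R u1 (rs r)) (at r)"
    by (rule vector_diff_chain_at[OF rs[unfolded has_real_derivative_iff_has_vector_derivative] u])
  then have dU: "((\<lambda>r. u (rs r)) has_vector_derivative (\<rho> / D * U1)) (at r)"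
    unfolding o_def \<rho>_def D_def U1_def scaleR_conv_of_real of_real_divide .
  have "((u1 \<circ> rs) has_vector_derivative ((r^2 + p * q) / ((r - p) * (r - q))) *\<^sub>R U2) (at r)"
    by (rule vector_diff_chain_at[OF rs[unfolded has_real_derivative_iff_has_vector_derivative] u1])
  then have dU1: "((\<lambda>r. u1 (rs r)) has_vector_derivative (\<rho> / D * U2)) (at r)"
    unfolding o_def \<rho>_def D_def scaleR_conv_of_real of_real_divide .
  have "(f0 has_vector_derivative (U * (- (N / D) * E) + \<rho> / D * U1 * E)) (at r)"
    unfolding f0_def U_def E_def[symmetric]
    using has_vector_derivative_mult[OF dU dE] unfolding E_def by simp
  moreover have "U * (- (N / D) * E) + \<rho> / D * U1 * E = b / D * ((\<rho> * U1 - N * U) * E / b)"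
    using nz by (simp add: field_simps)
  ultimately show "(f0 has_vector_derivative (of_real ((p - q) / ((r - p) * (r - q))) * f1 r)) (at r)"
    unfolding f1_def U_def U1_def N_def E_def D_def b_def \<rho>_def of_real_divide by simp
  define g' where "g' = ((2 * r - p - q) * r + (r - p) * (r - q)) / (r^2 + p * q) - (r - p) * (r - q) * r * (2 * r) / (r^2 + p * q)^2"
  define N' where "N' = (2 * \<i> * w * r - 1) + of_real g'"
  have dN: "(kerr_N p q k w has_vector_derivative N') (at r)"
  proof -
    have "((\<lambda>r. (r - p) * (r - q)) has_real_derivative (2 * r - p - q)) (at r)"
      "((\<lambda>r. r - q) has_real_derivative 1) (at r)" "((\<lambda>r. r - p) has_real_derivative 1) (at r)"
      by (auto intro!: derivative_eq_intros)
    note dl = this[THEN has_vector_derivative_of_real, where 'a = complex]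
    have "((\<lambda>r. (r - p) * (r - q) * r) has_real_derivative ((2 * r - p - q) * r + (r - p) * (r - q))) (at r)"
      "((\<lambda>r. r^2 + p * q) has_real_derivative 2 * r) (at r)"
      by (auto intro!: derivative_eq_intros simp: algebra_simps)
    note DERIV_divide[OF this]
    moreover have "X \<noteq> 0 \<Longrightarrow> (n1 * X - n * d) / (X * X) = n1 / X - n * d / X^2" for X n1 n d :: real
      by (simp add: diff_divide_distrib power2_eq_square)
    ultimately have "((\<lambda>r. (r - p) * (r - q) * r / (r^2 + p * q)) has_real_derivative g') (at r)"
      unfolding g'_def using rho by simp
    from has_vector_derivative_of_real[OF this, where 'a = complex]
    have "(kerr_N p q k w has_vector_derivative (\<i> * w * of_real (2 * r - p - q) + \<i> * k * of_real 1
      + (- 1 + \<i> * of_real ((p + q) * w) - \<i> * k) * of_real 1) + of_real g') (at r)"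
      unfolding kerr_N_def kerr_Lam_def by (intro has_vector_derivative_add has_vector_derivative_mult_right dl)
    then show ?thesis unfolding N'_def by (simp add: algebra_simps)
  qed
  have "((\<lambda>r. r^2 + p * q) has_real_derivative 2 * r) (at r)" by (auto intro!: derivative_eq_intros)
  note d\<rho> = has_vector_derivative_of_real[OF this, where 'a = complex]
  have df1: "(f1 has_vector_derivative (((\<rho> * U1 - N * U) * (- (N / D) * E)
     + ((\<rho> * (\<rho> / D * U2) + of_real (2 * r) * U1) - (N * (\<rho> / D * U1) + N' * U)) * E) / b)) (at r)"
    unfolding f1_def \<rho>_def U_def U1_def N_def E_def b_def D_def
    by (intro has_vector_derivative_divide has_vector_derivative_mult has_vector_derivative_diff d\<rho> dU[unfolded D_def \<rho>_def U1_def]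
        dU1[unfolded D_def \<rho>_def] dN dE[unfolded D_def N_def E_def])
  have U2: "U2 = - (w^2 - V) * U" using ode by (simp add: U_def algebra_simps add_eq_0_iff eq_neg_iff_add_eq_0)
  have NL: "N = \<Lambda> + D * r / \<rho>" unfolding N_def kerr_N_def \<Lambda>_def D_def \<rho>_def by simp
  have key: "- D * N' - \<rho>^2 * (w^2 - V) + N^2 = 2 * \<Lambda> * N - C"
  proof -
    \<comment> \<open>The contribution of sqrt(r^2 + a^2) alone: it cancels the last summand of the
      potential, the only one over the fourth power of r^2 + a^2.\<close>
    have real: "- ((r - p) * (r - q)) * g' + ((r - p) * (r - q) * r / (r^2 + p * q))^2
       + (r - p) * (r - q) / (r^2 + p * q) ^ 2 * (p * q * ((r - p) * (r - q)) + (p + q) * r * (r^2 - p * q)) = 0"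
    proof -
      have g: "g' = (((2 * r - p - q) * r + (r - p) * (r - q)) * (r^2 + p * q) - (r - p) * (r - q) * r * (2 * r)) / (r^2 + p * q)^2"
      proof -
        have "X \<noteq> 0 \<Longrightarrow> x / X - z / X^2 = (x * X - z) / X^2" for x z X :: real
          by (simp add: field_simps power2_eq_square)
        then show ?thesis unfolding g'_def using rho by simp
      qed
      have "- ((r - p) * (r - q)) * (((2 * r - p - q) * r + (r - p) * (r - q)) * (r^2 + p * q) - (r - p) * (r - q) * r * (2 * r))
         + ((r - p) * (r - q) * r)^2 + (r - p) * (r - q) * (p * q * ((r - p) * (r - q)) + (p + q) * r * (r^2 - p * q)) = 0"
        by (simp add: algebra_simps power2_eq_square)
      moreover have "- d * (x / Z) + m / Z + d / Z * z = (- d * x + m + d * z) / Z" for d x m z Z :: real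
        by (simp add: add_divide_distrib diff_divide_distrib)
      ultimately show ?thesis unfolding g power_divide by (simp only: div_0)
    qed
    have c: "- D * of_real g' + (D * r / \<rho>)^2
       + of_real ((r - p) * (r - q) / (r^2 + p * q) ^ 2 * (p * q * ((r - p) * (r - q)) + (p + q) * r * (r^2 - p * q))) = 0"
      using arg_cong[OF real, of complex_of_real] unfolding D_def \<rho>_def
      by (simp only: of_real_add of_real_mult of_real_minus of_real_divide of_real_power of_real_0)
    have "\<rho>^2 * V = (of_real (2 * (p + q) * r * n * w - n^2) + D * (lam + of_real (p * q * w^2)))
       + of_real ((r - p) * (r - q) / (r^2 + p * q) ^ 2 * (p * q * ((r - p) * (r - q)) + (p + q) * r * (r^2 - p * q)))"
    proof -
      have "X \<noteq> 0 \<Longrightarrow> X^2 * (x / X ^ 4 * z) = x / X ^ 2 * z" for x z X :: real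
        by (simp add: field_simps eval_nat_numeral)
      from this[of "r^2 + p * q"]
      have "(r^2 + p * q)^2 * (x / (r^2 + p * q) ^ 4 * z) = x / (r^2 + p * q) ^ 2 * z" for x z :: real
        using rho by simp
      note e = arg_cong[OF this, of complex_of_real, unfolded of_real_mult[of "(r^2 + p * q)^2"]]
      have e2: "of_real ((r^2 + p * q)^2) * (x / of_real ((r^2 + p * q)^2)) = x" for x :: complex
        using rho by (simp del: of_real_power of_real_add)
      have "\<rho>^2 = of_real ((r^2 + p * q)^2)" by (simp add: \<rho>_def)
      then show ?thesis
        unfolding V D_def by (simp only: e e2 distrib_left[of "complex_of_real ((r^2 + p * q)^2)"])
    qed
    then have "- D * N' - \<rho>^2 * (w^2 - V) + N^2 - (2 * \<Lambda> * N - C)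
      = (- D * of_real g' + (D * r / \<rho>)^2
       + of_real ((r - p) * (r - q) / (r^2 + p * q) ^ 2 * (p * q * ((r - p) * (r - q)) + (p + q) * r * (r^2 - p * q))))"
    proof -
      assume v: "\<rho>^2 * V = (of_real (2 * (p + q) * r * n * w - n^2) + D * (lam + of_real (p * q * w^2)))
       + of_real ((r - p) * (r - q) / (r^2 + p * q) ^ 2 * (p * q * ((r - p) * (r - q)) + (p + q) * r * (r^2 - p * q)))"
      have "t^2 * v = (x1 - x2 + d * l) + s \<Longrightarrow>
         - d * (h + g) - t^2 * (w2 - v) + (L + e)^2 - (2 * L * (L + e) - (L^2 + d * h + w2 * t^2 - x1 + x2 - d * l))
         = - d * g + e^2 + s" for t v x1 x2 d l s h g w2 L e :: complex
        by algebra
      note gen = this[OF v[unfolded of_real_diff[of _ "n^2"]]]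
      have w2: "of_real (w^2 * (r^2 + p * q)^2) = of_real (w^2) * \<rho>^2" by (simp add: \<rho>_def)
      show ?thesis
        unfolding C_def NL N'_def D_def[symmetric] \<Lambda>_def[symmetric] w2 by (rule gen)
    qed
    then show ?thesis unfolding c by simp
  qed
  have "((\<rho> * U1 - N * U) * (- (N / D) * E)
     + ((\<rho> * (\<rho> / D * U2) + of_real (2 * r) * U1) - (N * (\<rho> / D * U1) + N' * U)) * E) / b
     = b / D * (- (2 * \<Lambda> * b * ((\<rho> * U1 - N * U) * E / b) + C * (U * E)) / b^2)"
  proof -
    have N\<rho>: "N * \<rho> = \<Lambda> * \<rho> + D * r" unfolding NL using nz by (simp add: field_simps)
    have "(\<rho> * U1 - N * U) * (- N) + (\<rho>^2 * U2 + D * (2 * r) * U1 - N * \<rho> * U1 - D * N' * U)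
       = - (2 * \<Lambda> * (\<rho> * U1 - N * U) + C * U)"
    proof -
      have "(\<rho> * U1 - N * U) * (- N) + (\<rho>^2 * U2 + D * (2 * r) * U1 - N * \<rho> * U1 - D * N' * U)
        = (D * (2 * r) - 2 * (N * \<rho>)) * U1 + (- D * N' - \<rho>^2 * (w^2 - V) + N^2) * U"
        unfolding U2 by (simp add: algebra_simps power2_eq_square)
      also have "\<dots> = - (2 * \<Lambda> * (\<rho> * U1 - N * U) + C * U)"
        unfolding key N\<rho> by (simp add: algebra_simps)
      finally show ?thesis .
    qed
    note eq = this
    have "(X * (- (N / D) * E) + ((\<rho> * (\<rho> / D * U2) + x * U1) - (N * (\<rho> / D * U1) + N' * U)) * E) / b
       = (X * (- N) + (\<rho>^2 * U2 + D * x * U1 - N * \<rho> * U1 - D * N' * U)) * (E / (D * b))" for X x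
      using nz by (simp add: field_simps power2_eq_square)
    moreover have "b / D * (- (2 * \<Lambda> * b * (X * E / b) + C * (U * E)) / b^2) = - (2 * \<Lambda> * X + C * U) * (E / (D * b))" for X
      using nz by (simp add: field_simps power2_eq_square)
    ultimately show ?thesis by (simp only: eq)
  qed
  with df1 show "(f1 has_vector_derivative (of_real ((p - q) / ((r - p) * (r - q)))
       * (- (2 * kerr_Lam p q k w r * of_real (p - q) * f1 r + C * f0 r) / (of_real (p - q))^2))) (at r)"
    unfolding f0_def f1_def b_def D_def \<Lambda>_def U_def U1_def N_def E_def \<rho>_def of_real_divide by simp
qed

text \<open>The solution r of exp s = (r - r_-) ^ (-1) times (r - r_+), that is, the radius at y =
  exp s.\<close>

definition kerr_r :: "real \<Rightarrow> real \<Rightarrow> real \<Rightarrow> real" where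
  "kerr_r p q s = q + (p - q) / (1 - exp s)"

lemma kerr_r_facts:
  assumes "q < p" "s < 0"
  shows "p < kerr_r p q s"
    and "exp s = (kerr_r p q s - p) / (kerr_r p q s - q)"
    and "1 - exp s = (p - q) / (kerr_r p q s - q)"
    and "(kerr_r p q has_real_derivative (kerr_r p q s - p) * (kerr_r p q s - q) / (p - q)) (at s)"
proof -
  define t where "t = 1 - exp s"
  have t: "0 < t" "t < 1" using assms by (auto simp: t_def)
  have es: "exp s = 1 - t" by (simp add: t_def)
  have rq: "kerr_r p q s - q = (p - q) / t" by (simp add: kerr_r_def t_def)
  have rp: "kerr_r p q s - p = (p - q) * (1 - t) / t"
    using t by (simp add: kerr_r_def t_def[symmetric] field_simps)
  show "p < kerr_r p q s" using rp t assms(1) by (smt (verit) divide_pos_pos mult_pos_pos)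
  show "exp s = (kerr_r p q s - p) / (kerr_r p q s - q)" "1 - exp s = (p - q) / (kerr_r p q s - q)"
    unfolding rp rq es using t assms(1) by (simp_all add: field_simps)
  have "((\<lambda>s. q + (p - q) / (1 - exp s)) has_real_derivative (p - q) * exp s / (1 - exp s)^2) (at s)"
    using t by (auto intro!: derivative_eq_intros simp: t_def power2_eq_square)
  moreover have "(p - q) * exp s / (1 - exp s)^2 = (kerr_r p q s - p) * (kerr_r p q s - q) / (p - q)"
    unfolding rp rq t_def[symmetric] es using t assms(1) by (simp add: field_simps power2_eq_square)
  ultimately show "(kerr_r p q has_real_derivative (kerr_r p q s - p) * (kerr_r p q s - q) / (p - q)) (at s)"
    unfolding kerr_r_def by simp
qed

lemma kerr_r_at_bot:
  assumes "q < p"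
  shows "filterlim (kerr_r p q) (at_right p) at_bot"
  unfolding filterlim_at
proof (intro conjI)
  have "((\<lambda>s. q + (p - q) / (1 - exp s)) \<longlongrightarrow> q + (p - q) / (1 - 0)) at_bot"
    by (intro tendsto_add tendsto_divide tendsto_diff tendsto_const exp_at_bot) simp
  then show "(kerr_r p q \<longlongrightarrow> p) at_bot" unfolding kerr_r_def by simp
  show "\<forall>\<^sub>F s in at_bot. kerr_r p q s \<in> {p<..} \<and> kerr_r p q s \<noteq> p"
    using eventually_gt_at_bot[of 0] by eventually_elim (use kerr_r_facts(1)[OF assms] in force)
qed

lemma kerr_r_at_left:
  assumes "q < p"
  shows "filterlim (kerr_r p q) at_top (at_left 0)"
proof -
  have "((\<lambda>s::real. 1 - exp s) \<longlongrightarrow> 1 - exp 0) (at_left 0)" by (intro tendsto_intros)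
  then have "filterlim (\<lambda>s::real. 1 - exp s) (at_right 0) (at_left 0)"
    unfolding filterlim_at by (auto simp: eventually_at_left_0 intro!: exI[of _ "-1"])
  then have "filterlim (\<lambda>s::real. inverse (1 - exp s)) at_top (at_left 0)"
    by (rule filterlim_compose[OF filterlim_inverse_at_top_right])
  then have "filterlim (\<lambda>s::real. q + (p - q) * inverse (1 - exp s)) at_top (at_left 0)"
    using assms by (intro filterlim_tendsto_add_at_top[OF tendsto_const]
        filterlim_tendsto_pos_mult_at_top[OF tendsto_const]) auto
  then show ?thesis unfolding kerr_r_def divide_inverse .
qed

text \<open>Writing p - q as (r - q) - (r - p) turns this into a polynomial identity in r - p and r
  - q. The value i \<kappa> at the horizon comes from the term i k (r - q), the value 2 i \<delta>
  at infinity from i w (r - p) (r - q).\<close>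

lemma heun_B_kerr:
  fixes p q k w s r :: real
  assumes "q < p" "s < 0"
  defines "r \<equiv> kerr_r p q s"
  shows "heun_B (2 * k) (2 * (p + q) * w) (w * (p - q)) s = 2 * of_real (p - q) * kerr_Lam p q k w r / (of_real (r - q))^2"
proof -
  note f = kerr_r_facts[OF assms(1,2), folded r_def]
  define x where "x = complex_of_real (r - q)"
  define z where "z = complex_of_real (r - p)"
  have x: "x \<noteq> 0" using f(1) assms(1) by (simp add: x_def del: of_real_diff)
  have ex: "complex_of_real (exp s) = z / x" unfolding f(2) x_def z_def by (rule of_real_divide)
  have bb: "complex_of_real (p - q) = x - z" by (simp add: x_def z_def)
  have D: "complex_of_real ((r - p) * (r - q)) = z * x" unfolding x_def z_def by (rule of_real_mult)
  have "A0 + A1 * (z / x) + A2 * (z / x)^2 = (A0 * x^2 + A1 * (z * x) + A2 * z^2) / x^2" for A0 A1 A2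
    using x by (simp add: field_simps power2_eq_square)
  note e = this
  have c: "(of_real (2 * (p + q) * w + 2 * (w * (p - q)) - 2 * (2 * k)) :: complex)
      = 2 * of_real ((p + q) * w) + 2 * (of_real w * (x - z)) - 4 * of_real k"
    unfolding bb[symmetric] by simp
  have d: "(of_real (2 * (p + q) * w) :: complex) = 2 * of_real ((p + q) * w)" "complex_of_real (2 * k) = 2 * of_real k" by simp_all
  show ?thesis
    unfolding heun_B_def ex e kerr_Lam_def D bb x_def[symmetric] z_def[symmetric] c d
    by (rule arg_cong[of _ _ "\<lambda>v. v / x^2"]) (simp add: algebra_simps power2_eq_square)
qed

text \<open>The accessory parameter, read off as the coefficient of (r - p) (r - q) in the
  polynomial of the next lemma. For real \<open>lam\<close> its imaginary part is \<epsilon>/2 -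
  \<kappa> + \<delta>, as the flux identity demands.\<close>

definition kerr_c :: "real \<Rightarrow> real \<Rightarrow> real \<Rightarrow> real \<Rightarrow> complex \<Rightarrow> complex" where
  "kerr_c p q k w lam = - 1 - lam - of_real (p * q * w^2) + of_real (2 * (p + q) * p * w^2)
     - of_real (2 * w * k * (p - q + 2 * (p + q))) + \<i> * of_real (2 * w * p - 2 * k)"

text \<open>The numerator is formally quartic in r. Its r^4 and r^3 terms cancel by the choice of
  the phase and of the exponent of r - r_-, and it vanishes at r = p because n - (p + q) p w = k (p
  - q), i.e. because xi is an exponent at the horizon; so only y and y^2 survive.\<close>

lemma heun_C_kerr:
  fixes p q k w s r n :: real
  assumes "q < p" "s < 0"
  defines "r \<equiv> kerr_r p q s" and "n \<equiv> k * (p - q) + (p + q) * p * w"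
  shows "heun_C (2 * k) (2 * (p + q) * w) (kerr_c p q k w lam) s
    = ((kerr_Lam p q k w r)^2 + of_real ((r - p) * (r - q)) * (2 * \<i> * w * r - 1) + of_real (w^2 * (r^2 + p * q)^2)
       - of_real (2 * (p + q) * r * n * w) + of_real (n^2) - of_real ((r - p) * (r - q)) * (lam + of_real (p * q * w^2)))
      / (of_real (r - q))^2"
proof -
  note f = kerr_r_facts[OF assms(1,2), folded r_def]
  define x where "x = complex_of_real (r - q)"
  define z where "z = complex_of_real (r - p)"
  have x: "x \<noteq> 0" using f(1) assms(1) by (simp add: x_def del: of_real_diff)
  have ex: "complex_of_real (exp s) = z / x" unfolding f(2) x_def z_def by (rule of_real_divide)
  have e: "0 + A1 * (z / x) + A2 * (z / x)^2 = (A1 * (z * x) + A2 * z^2) / x^2" for A1 A2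
    using x by (simp add: field_simps power2_eq_square)

  show ?thesis
    unfolding heun_C_def ex e x_def[symmetric]
  proof (rule arg_cong[of _ _ "\<lambda>v. v / x^2"])
    show "kerr_c p q k w lam * (z * x) + (1 - \<i> * of_real (2 * (p + q) * w)) * (1 + \<i> * of_real (2 * k)) * z^2
      = (kerr_Lam p q k w r)^2 + of_real ((r - p) * (r - q)) * (2 * \<i> * w * r - 1) + of_real (w^2 * (r^2 + p * q)^2)
       - of_real (2 * (p + q) * r * n * w) + of_real (n^2) - of_real ((r - p) * (r - q)) * (lam + of_real (p * q * w^2))"
      unfolding kerr_c_def kerr_Lam_def n_def x_def z_def
      by (simp add: algebra_simps power2_eq_square)
  qed
qed

text \<open>All exponents are imaginary except those of r - r_- and of the square root, so the norm
  is (r - q) / sqrt(r^2 + p q). A bound on \<open>u\<close> is thus a bound on the Heun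
  function.\<close>

lemma norm_kerr_E_le_1:
  assumes "0 \<le> q" "q < p" "p < r"
  shows "norm (kerr_E p q k w r) \<le> 1"
proof -
  have "(r - q)^2 \<le> r^2" using assms by (intro power_mono) auto
  then have "(r - q)^2 \<le> r^2 + p * q" using assms by (simp add: add_increasing2)
  then have "ln ((r - q)^2) \<le> ln (r^2 + p * q)" using assms by (subst ln_le_cancel_iff) (auto intro: add_pos_nonneg)
  then have "2 * ln (r - q) \<le> ln (r^2 + p * q)" using assms by (simp add: ln_realpow)
  then show ?thesis unfolding kerr_E_def norm_exp_eq_Re by simp
qed

text \<open>The boundary condition cancels the only singular factor (r - p)^xi, so \<open>f0\<close>
  is C^1 up to r = p; \<open>f1\<close> is a factor r - p times something bounded.\<close>

lemma horizon_limits: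
  fixes G :: "real \<Rightarrow> complex" and f0 f1 :: "real \<Rightarrow> complex"
  assumes pq: "0 \<le> q" "q < p" and e: "e > 0" and G: "smooth_on (ball p e) G"
    and GU: "\<And>r. r \<in> {p<..<p+e} \<Longrightarrow> G r = rcpow (r - p) (- (\<i> * of_real k)) * U r"
    and f0: "\<And>r. r > p \<Longrightarrow> f0 r = U r * kerr_E p q k w r"
    and df0: "\<And>r. r > p \<Longrightarrow> (f0 has_vector_derivative (of_real ((p - q) / ((r - p) * (r - q))) * f1 r)) (at r)"
  shows "\<exists>L. (f0 \<longlongrightarrow> L) (at_right p)" and "(f1 \<longlongrightarrow> 0) (at_right p)"
proof -
  have C1: "Ck_on 1 (ball p e) G" using G by (simp add: smooth_on_def)
  define G1 where "G1 r = frechet_derivative G (at r) 1" for r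
  have pin: "p \<in> ball p e" using e by simp
  have dG: "(G has_vector_derivative G1 r) (at r)" if "r \<in> ball p e" for r
  proof -
    note diff = Ck_on_1_partial_continuous(1)[OF C1 that]
    have "frechet_derivative G (at r) h = h *\<^sub>R G1 r" for h
      using linear_scale[OF linear_frechet_derivative[OF diff], of h 1] by (simp add: G1_def)
    then have "frechet_derivative G (at r) = (\<lambda>h. h *\<^sub>R G1 r)" by blast
    then show ?thesis
      using diff unfolding has_vector_derivative_def frechet_derivative_works by simp
  qed
  have contG1: "isCont G1 p"
    using Ck_on_1_partial_continuous(2)[OF C1, of 1] pin unfolding G1_def
    by (simp add: continuous_on_eq_continuous_at)
  have contG: "isCont G p" using has_vector_derivative_continuous[OF dG[OF pin]] .
  define z where "z = - 1 + \<i> * complex_of_real ((p + q) * w) - \<i> * k"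
  \<comment> \<open>The part of \<open>kerr_E\<close> that is regular across r = p.\<close>
  define N where "N r = exp (- (\<i> * w * of_real r + z * of_real (ln (r - q)) + of_real (ln (r^2 + p * q) / 2)))" for r :: real
  define l where "l r = - (\<i> * w * of_real 1 + z * of_real (1 / (r - q)) + of_real (r / (r^2 + p * q)))" for r :: real
  have \<rho>: "r^2 + p * q > 0" if "r \<ge> p" for r using pq that by (simp add: add_pos_nonneg)
  have dN: "(N has_vector_derivative l r * N r) (at r)" if r: "r \<ge> p" for r
  proof -
    have "((\<lambda>r. ln (r^2 + p * q)) has_real_derivative 2 * r / (r^2 + p * q)) (at r)"
      using \<rho>[OF r] by (auto intro!: derivative_eq_intros)
    note l2 = DERIV_cdivide[OF this, of 2]
    have "2 * r / X / 2 = r / X" for X :: real by simp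
    note l2 = l2[unfolded this]
    have "((\<lambda>r. ln (r - q)) has_real_derivative 1 / (r - q)) (at r)" "((\<lambda>r. r) has_real_derivative 1) (at r)"
      using r pq by (auto intro!: derivative_eq_intros)
    note d = this[THEN has_vector_derivative_of_real, where 'a = complex] l2[THEN has_vector_derivative_of_real, where 'a = complex]
    have "((\<lambda>r. - (\<i> * w * of_real r + z * of_real (ln (r - q)) + of_real (ln (r^2 + p * q) / 2))) has_vector_derivative l r) (at r)"
      unfolding l_def
      by (intro has_vector_derivative_minus has_vector_derivative_add has_vector_derivative_mult_right d)
    from field_vector_diff_chain_at[OF this DERIV_exp] show ?thesis
      unfolding N_def o_def by simp
  qed
  have contN: "isCont N p" using has_vector_derivative_continuous[OF dN] by simp
  have contl: "isCont l p"
    unfolding l_def using pq \<rho>[of p] by (intro continuous_intros) auto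
  have f0GN: "f0 r = G r * N r" if r: "r \<in> {p<..<p+e}" for r
  proof -
    have "kerr_E p q k w r = rcpow (r - p) (- (\<i> * of_real k)) * N r"
      unfolding kerr_E_def rcpow_def N_def z_def exp_add[symmetric] by (simp add: algebra_simps)
    then show ?thesis using f0[of r] GU[OF r] r by simp
  qed
  have f1GN: "f1 r = of_real ((r - p) * (r - q) / (p - q)) * (G r * (l r * N r) + G1 r * N r)" if r: "r \<in> {p<..<p+e}" for r
  proof -
    have rb: "r \<in> ball p e" using r by (auto simp: dist_real_def)
    have "((\<lambda>r. G r * N r) has_vector_derivative (G r * (l r * N r) + G1 r * N r)) (at r)"
      by (intro has_vector_derivative_mult dG[OF rb] dN) (use r in auto)
    then have "(f0 has_vector_derivative (G r * (l r * N r) + G1 r * N r)) (at r)"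
      by (rule has_vector_derivative_transform_within_open[of _ _ _ "{p<..<p+e}"]) (use r f0GN in auto)
    then have "of_real ((p - q) / ((r - p) * (r - q))) * f1 r = G r * (l r * N r) + G1 r * N r"
      using df0[of r] r vector_derivative_unique_at by (metis greaterThanLessThan_iff)
    moreover have "complex_of_real ((r - p) * (r - q) / (p - q)) * (of_real ((p - q) / ((r - p) * (r - q))) * x) = x" for x
    proof -
      have "(r - p) * (r - q) / (p - q) * ((p - q) / ((r - p) * (r - q))) = 1" using r pq by simp
      then show ?thesis unfolding mult.assoc[symmetric] of_real_mult[symmetric] by simp
    qed
    ultimately show ?thesis by metis
  qed
  have ev: "\<forall>\<^sub>F r in at_right p. r \<in> {p<..<p+e}"
    by (rule eventually_at_right_real) (use e in simp)
  note lims = contG[unfolded isCont_def, THEN filterlim_mono[OF _ order_refl at_le[OF subset_UNIV]]]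
     contN[unfolded isCont_def, THEN filterlim_mono[OF _ order_refl at_le[OF subset_UNIV]]]
     contG1[unfolded isCont_def, THEN filterlim_mono[OF _ order_refl at_le[OF subset_UNIV]]]
     contl[unfolded isCont_def, THEN filterlim_mono[OF _ order_refl at_le[OF subset_UNIV]]]
  have "((\<lambda>r. G r * N r) \<longlongrightarrow> G p * N p) (at_right p)" by (intro tendsto_intros lims)
  moreover have "\<forall>\<^sub>F r in at_right p. G r * N r = f0 r"
    using ev by eventually_elim (simp add: f0GN)
  ultimately show "\<exists>L. (f0 \<longlongrightarrow> L) (at_right p)" using Lim_transform_eventually by blast
  have "((\<lambda>r. of_real ((r - p) * (r - q) / (p - q)) * (G r * (l r * N r) + G1 r * N r)) \<longlongrightarrow>
      of_real ((p - p) * (p - q) / (p - q)) * (G p * (l p * N p) + G1 p * N p)) (at_right p)"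
    by (intro tendsto_intros lims) (use pq in auto)
  then have "((\<lambda>r. of_real ((r - p) * (r - q) / (p - q)) * (G r * (l r * N r) + G1 r * N r)) \<longlongrightarrow> 0) (at_right p)"
    by simp
  moreover have "\<forall>\<^sub>F r in at_right p. of_real ((r - p) * (r - q) / (p - q)) * (G r * (l r * N r) + G1 r * N r) = f1 r"
    using ev by eventually_elim (simp only: f1GN)
  ultimately show "(f1 \<longlongrightarrow> 0) (at_right p)" by (rule Lim_transform_eventually)
qed

section \<open>Behaviour at infinity\<close>

lemma kerr_V_tendsto_0: "(kerr_V M a \<omega> m lam \<longlongrightarrow> 0) at_top"
proof -
  have l: "((\<lambda>r. 4 * M * r * a / (r^2 + a^2)^2) \<longlongrightarrow> 0) at_top"
    "((\<lambda>r::real. 1 / (r^2 + a^2)^2) \<longlongrightarrow> 0) at_top"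
    "((\<lambda>r. kerr_Delta M a r / (r^2 + a^2)^2) \<longlongrightarrow> 0) at_top"
    "((\<lambda>r. kerr_Delta M a r / (r^2 + a^2)^4 * (a^2 * kerr_Delta M a r + 2 * M * r * (r^2 - a^2))) \<longlongrightarrow> 0) at_top"
    unfolding kerr_Delta_def by real_asymp+
  have "((\<lambda>r. (complex_of_real (4 * M * r * a / (r^2 + a^2)^2) * (of_int m * \<omega>) - of_real (1 / (r^2 + a^2)^2) * (of_real (a^2) * of_int m ^ 2)
     + of_real (kerr_Delta M a r / (r^2 + a^2)^2) * (lam + of_real (a^2) * \<omega>^2))
     + of_real (kerr_Delta M a r / (r^2 + a^2)^4 * (a^2 * kerr_Delta M a r + 2 * M * r * (r^2 - a^2)))) \<longlongrightarrow>
     (of_real 0 * (of_int m * \<omega>) - of_real 0 * (of_real (a^2) * of_int m ^ 2) + of_real 0 * (lam + of_real (a^2) * \<omega>^2)) + of_real 0) at_top"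
    by (intro tendsto_add tendsto_diff tendsto_mult tendsto_of_real l tendsto_const)
  then show ?thesis
    unfolding kerr_V_def[abs_def] by (simp add: add_divide_distrib diff_divide_distrib algebra_simps)
qed

text \<open>The expansion at infinity says nothing about u'. It is recovered from the equation: v =
  exp(-i w s) u converges and v'' + 2 i w v' = exp(-i w s) V u tends to 0, so v' tends to 0.\<close>

lemma infinity_derivative_decay:
  fixes u u1 u2 :: "real \<Rightarrow> complex" and \<omega> p :: real and rs :: "real \<Rightarrow> real" and V :: "real \<Rightarrow> complex"
  assumes u: "\<And>s. (u has_vector_derivative u1 s) (at s)"
    and u1: "\<And>s. (u1 has_vector_derivative u2 s) (at s)"
    and bij: "bij_betw rs {p<..} UNIV" and mono: "strict_mono_on {p<..} rs"
    and ode: "\<And>r. r > p \<Longrightarrow> u2 (rs r) + (\<omega>^2 - V r) * u (rs r) = 0"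
    and V: "(V \<longlongrightarrow> 0) at_top"
    and bc: "infinity_bc (of_real \<omega>) rs u"
  shows "\<exists>K. \<forall>\<^sub>F r in at_top. norm (u (rs r)) \<le> K"
    and "((\<lambda>r. u1 (rs r) - \<i> * \<omega> * u (rs r)) \<longlongrightarrow> 0) at_top"
proof -
  define x where "x s = exp (- (\<i> * \<omega>) * of_real s)" for s :: real
  have nx: "norm (x s) = 1" for s unfolding x_def by (simp add: norm_exp_eq_Re)
  have xx: "x s * exp (\<i> * \<omega> * of_real s) = 1" for s
    unfolding x_def exp_add[symmetric] by simp
  have dx: "(x has_vector_derivative (- (\<i> * \<omega>)) * x s) (at s)" for s
  proof -
    have "((\<lambda>s. - (\<i> * \<omega>) * complex_of_real s) has_vector_derivative - (\<i> * \<omega>) * of_real 1) (at s)"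
      by (intro has_vector_derivative_mult_right has_vector_derivative_of_real DERIV_ident)
    from field_vector_diff_chain_at[OF this DERIV_exp] show ?thesis
      unfolding x_def o_def by simp
  qed
  define v where "v s = x s * u s" for s
  define v1 where "v1 s = x s * (u1 s - \<i> * \<omega> * u s)" for s
  define v2 where "v2 s = x s * ((u2 s - \<i> * \<omega> * u1 s) - \<i> * \<omega> * (u1 s - \<i> * \<omega> * u s))" for s
  have dv: "(v has_vector_derivative v1 s) (at s)" for s
    using has_vector_derivative_mult[OF dx u] unfolding v_def v1_def by (simp add: algebra_simps)
  have "((\<lambda>s. u1 s - \<i> * \<omega> * u s) has_vector_derivative (u2 s - \<i> * \<omega> * u1 s)) (at s)" for s
    by (intro has_vector_derivative_diff has_vector_derivative_mult_right u u1)
  then have dv1: "(v1 has_vector_derivative v2 s) (at s)" for s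
    using has_vector_derivative_mult[OF dx] unfolding v1_def v2_def by (fastforce simp: algebra_simps)
  obtain C :: "nat \<Rightarrow> complex" where C: "\<forall>N\<ge>1. \<exists>K. \<forall>\<^sub>F r in at_top.
      norm (u (rs r) - exp (\<i> * of_real \<omega> * of_real (rs r)) * (\<Sum>i\<le>N. C i / of_real (r ^ i))) \<le> K * (1 / r) ^ (N + 1)"
    using bc unfolding infinity_bc_def by (elim exE)
  \<comment> \<open>The expansion with N = 1; it is only used to see that \<open>v\<close> tends to
    \<open>C 0\<close>.\<close>
  obtain K where K: "\<forall>\<^sub>F r in at_top. norm (u (rs r) - exp (\<i> * of_real \<omega> * of_real (rs r)) * (\<Sum>i\<le>1. C i / of_real (r ^ i)))
                      \<le> K * (1 / r) ^ (1 + 1)"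
    using C[rule_format, OF order_refl] by (elim exE)
  have lv: "((\<lambda>r. v (rs r)) \<longlongrightarrow> C 0) at_top"
  proof -
    have "((\<lambda>r. v (rs r) - (\<Sum>i\<le>1. C i / of_real (r ^ i))) \<longlongrightarrow> 0) at_top"
    proof (rule Lim_null_comparison)
      show "\<forall>\<^sub>F r in at_top. norm (v (rs r) - (\<Sum>i\<le>1. C i / of_real (r ^ i))) \<le> K * (1 / r) ^ (1 + 1)"
        using K
      proof eventually_elim
        case (elim r)
        have "v (rs r) - S = x (rs r) * (u (rs r) - exp (\<i> * of_real \<omega> * of_real (rs r)) * S)" for S
          unfolding v_def right_diff_distrib mult.assoc[symmetric] xx by simp
        then show ?case using elim by (simp only: norm_mult nx mult_1)
      qed
      show "((\<lambda>r. K * (1 / r) ^ (1 + 1)) \<longlongrightarrow> 0) at_top" by real_asymp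
    qed
    moreover have "((\<lambda>r. \<Sum>i\<le>1. C i / of_real (r ^ i)) \<longlongrightarrow> C 0) at_top"
    proof -
      have i: "((\<lambda>r::real. 1 / r) \<longlongrightarrow> 0) at_top" by real_asymp
      have "((\<lambda>r. C 0 + C 1 * of_real (1 / r)) \<longlongrightarrow> C 0 + C 1 * of_real 0) at_top"
        by (intro tendsto_intros tendsto_of_real i)
      then show ?thesis by simp
    qed
    ultimately show ?thesis using tendsto_add by fastforce
  qed
  \<comment> \<open>An increasing bijection onto the reals sends limits at infinity in r to limits
    in the tortoise coordinate and back.\<close>
  define ri where "ri = the_inv_into {p<..} rs"
  have ri: "ri s > p" "rs (ri s) = s" for s
    using bij f_the_inv_into_f_bij_betw[OF bij] the_inv_into_into[of rs "{p<..}" s "{p<..}"]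
    unfolding ri_def bij_betw_def by auto
  have rle: "r \<le> r'" if "rs r \<le> rs r'" "p < r" "p < r'" for r r'
    using mono that unfolding strict_mono_on_def by (metis greaterThan_iff linorder_not_less)
  have rle': "rs r \<le> rs r'" if "r \<le> r'" "p < r" for r r'
    using mono that unfolding strict_mono_on_def by (metis greaterThan_iff le_less less_le_trans)
  have riT: "filterlim ri at_top at_top"
    unfolding filterlim_at_top eventually_at_top_linorder
  proof (intro allI)
    fix Z :: real
    show "\<exists>N. \<forall>s\<ge>N. Z \<le> ri s"
      using rle[of "max Z (p + 1)" "ri s" for s] ri by (intro exI[of _ "rs (max Z (p + 1))"]) force
  qed
  have rsT: "filterlim rs at_top at_top"
    unfolding filterlim_at_top eventually_at_top_linorder
  proof (intro allI)
    fix Z :: real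
    show "\<exists>N. \<forall>r\<ge>N. Z \<le> rs r"
      using rle'[OF _ ri(1), of Z] ri(2)[of Z] by (intro exI[of _ "ri Z"]) force
  qed
  have ubd: "\<forall>\<^sub>F r in at_top. norm (u (rs r)) \<le> norm (C 0) + 1"
    using order_tendstoD(2)[OF tendsto_norm[OF lv], of "norm (C 0) + 1"]
    by (auto simp: v_def norm_mult nx elim!: eventually_mono)
  then show "\<exists>K. \<forall>\<^sub>F r in at_top. norm (u (rs r)) \<le> K" by blast
  have "((\<lambda>r. v2 (rs r) + \<i> * of_real (2 * \<omega>) * v1 (rs r)) \<longlongrightarrow> 0) at_top"
  proof (rule Lim_null_comparison)
    show "\<forall>\<^sub>F r in at_top. norm (v2 (rs r) + \<i> * of_real (2 * \<omega>) * v1 (rs r)) \<le> norm (V r) * (norm (C 0) + 1)"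
      using ubd eventually_gt_at_top[of p]
    proof eventually_elim
      case (elim r)
      have "u2 (rs r) + \<omega>^2 * u (rs r) = V r * u (rs r)"
        using ode[OF elim(2)] by (simp add: algebra_simps eq_neg_iff_add_eq_0)
      moreover have "v2 (rs r) + \<i> * of_real (2 * \<omega>) * v1 (rs r) = x (rs r) * (u2 (rs r) + \<omega>^2 * u (rs r))"
        unfolding v2_def v1_def by (simp add: algebra_simps power2_eq_square)
      ultimately have "norm (v2 (rs r) + \<i> * of_real (2 * \<omega>) * v1 (rs r)) = norm (V r) * norm (u (rs r))"
        by (simp add: norm_mult nx)
      then show ?case using elim(1) by (simp add: mult_left_mono)
    qed
    show "((\<lambda>r. norm (V r) * (norm (C 0) + 1)) \<longlongrightarrow> 0) at_top"
      by (intro tendsto_mult_left_zero tendsto_norm_zero V)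
  qed
  from filterlim_compose[OF this riT] have "((\<lambda>s. v2 s + \<i> * of_real (2 * \<omega>) * v1 s) \<longlongrightarrow> 0) at_top"
    by (simp add: ri(2))
  moreover from filterlim_compose[OF lv riT] have "(v \<longlongrightarrow> C 0) at_top" by (simp add: ri(2))
  ultimately have "(v1 \<longlongrightarrow> 0) at_top" using deriv_tendsto_0_of_convergent[OF dv dv1] by blast
  from tendsto_norm_zero[OF filterlim_compose[OF this rsT]]
  show "((\<lambda>r. u1 (rs r) - \<i> * \<omega> * u (rs r)) \<longlongrightarrow> 0) at_top"
    unfolding v1_def norm_mult nx by (simp add: tendsto_norm_zero_iff)
qed

text \<open>The quotient is the derivative in the tortoise coordinate of the logarithm of the factor
  split off; its limit i w matches the outgoing phase of \<open>u\<close>.\<close>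

lemma kerr_N_tendsto: "((\<lambda>r. kerr_N p q k w r / of_real (r^2 + p * q)) \<longlongrightarrow> \<i> * of_real w) at_top"
proof -
  have l: "((\<lambda>r. (r - p) * (r - q) / (r^2 + p * q)) \<longlongrightarrow> 1) at_top" "((\<lambda>r. (r - q) / (r^2 + p * q)) \<longlongrightarrow> 0) at_top"
    "((\<lambda>r. (r - p) / (r^2 + p * q)) \<longlongrightarrow> 0) at_top"
    "((\<lambda>r. (r - p) * (r - q) * r / (r^2 + p * q) / (r^2 + p * q)) \<longlongrightarrow> 0) at_top"
    by real_asymp+
  have "((\<lambda>r. \<i> * w * complex_of_real ((r - p) * (r - q) / (r^2 + p * q)) + \<i> * k * of_real ((r - q) / (r^2 + p * q))
     + (- 1 + \<i> * of_real ((p + q) * w) - \<i> * k) * of_real ((r - p) / (r^2 + p * q))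
     + of_real ((r - p) * (r - q) * r / (r^2 + p * q) / (r^2 + p * q))) \<longlongrightarrow>
     \<i> * w * of_real 1 + \<i> * k * of_real 0 + (- 1 + \<i> * of_real ((p + q) * w) - \<i> * k) * of_real 0 + of_real 0) at_top"
    by (intro tendsto_add tendsto_mult tendsto_const tendsto_of_real l)
  then show ?thesis
    unfolding kerr_N_def kerr_Lam_def add_divide_distrib times_divide_eq_right[symmetric] of_real_divide[symmetric] by simp
qed

section \<open>Assembly for the Kerr radial equation\<close>

theorem mainTheorem3:
  fixes M a \<omega> :: real and m :: int and lam :: complex
    and rs :: "real \<Rightarrow> real" and u :: "real \<Rightarrow> complex"
  assumes "M > 0" and "\<bar>a\<bar> < M"
    and "tortoise M a rs"
    and "\<omega> \<noteq> 0"
    and "angular_eigenvalue a (of_real \<omega>) m lam"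
    and "radial_solution M a (of_real \<omega>) m lam rs (\<lambda>_. 0) u"
    and "mode_bc M a (of_real \<omega>) m rs u"
  shows "\<forall>s. u s = 0"
proof -
  define p where "p = kerr_rp M a"
  define q where "q = kerr_rm M a"
  note h = kerr_horizons[OF assms(1,2), folded p_def q_def]
  have pq: "0 \<le> q" "q < p" using h by auto
  define n where "n = a * of_int m"
  define k where "k = (n - 2 * M * p * \<omega>) / (p - q)"
  have n: "n = k * (p - q) + (p + q) * p * \<omega>" using pq h(1) by (simp add: k_def)
  have rho: "r^2 + p * q > 0" if "r > p" for r using pq that by (simp add: add_pos_nonneg)
  have bij: "bij_betw rs {p<..} UNIV" and mono: "strict_mono_on {p<..} rs"
    and drs: "\<And>r. r > p \<Longrightarrow> (rs has_real_derivative (r^2 + p * q) / ((r - p) * (r - q))) (at r)"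
    using assms(3) h(2,5) unfolding tortoise_def p_def by auto
  obtain u1 u2 where du: "\<And>s. (u has_vector_derivative u1 s) (at s)" and du1: "\<And>s. (u1 has_vector_derivative u2 s) (at s)"
    and ode: "\<And>r. r > p \<Longrightarrow> u2 (rs r) + ((of_real \<omega>)^2 - kerr_V M a (of_real \<omega>) m lam r) * u (rs r) = 0"
    using assms(6) unfolding radial_solution_def p_def by blast
  have V: "kerr_V M a (of_real \<omega>) m lam r
      = (of_real (2 * (p + q) * r * n * \<omega> - n^2) + of_real ((r - p) * (r - q)) * (lam + of_real (p * q * \<omega>^2)))
        / of_real ((r^2 + p * q)^2)
      + of_real ((r - p) * (r - q) / (r^2 + p * q) ^ 4 * (p * q * ((r - p) * (r - q)) + (p + q) * r * (r^2 - p * q)))" for r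
    unfolding kerr_V_def h(5) h(1,2) n_def by (simp add: power_mult_distrib mult_ac)
  define C where "C r = (kerr_Lam p q k \<omega> r)^2 + of_real ((r - p) * (r - q)) * (2 * \<i> * \<omega> * r - 1) + of_real (\<omega>^2 * (r^2 + p * q)^2)
       - of_real (2 * (p + q) * r * n * \<omega>) + of_real (n^2) - of_real ((r - p) * (r - q)) * (lam + of_real (p * q * \<omega>^2))" for r :: real
  define f0 where "f0 r = u (rs r) * kerr_E p q k \<omega> r" for r
  define f1 where "f1 r = (of_real (r^2 + p * q) * u1 (rs r) - kerr_N p q k \<omega> r * u (rs r)) * kerr_E p q k \<omega> r / of_real (p - q)" for r
  define f2 where "f2 r = - (2 * kerr_Lam p q k \<omega> r * of_real (p - q) * f1 r + C r * f0 r) / (of_real (p - q))^2" for r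
  have df0: "(f0 has_vector_derivative (of_real ((p - q) / ((r - p) * (r - q))) * f1 r)) (at r)"
    and df1: "(f1 has_vector_derivative (of_real ((p - q) / ((r - p) * (r - q))) * f2 r)) (at r)" if r: "r > p" for r
    unfolding f0_def f1_def f2_def C_def
    using kerr_radial_to_heun_derivs[OF pq r drs[OF r] du du1 _ V, where k = k] ode[OF r] by simp_all
  define R where "R = kerr_r p q"
  note R = kerr_r_facts[OF pq(2), folded R_def]
  \<comment> \<open>The derivative of \<open>R\<close> cancels the weight, so d/ds acts on functions
    of r as \<theta>.\<close>
  have chain: "((\<lambda>s. f (R s)) has_vector_derivative g (R s)) (at s)"
    if s: "s < 0" and d: "\<And>r. r > p \<Longrightarrow> (f has_vector_derivative (of_real ((p - q) / ((r - p) * (r - q))) * g r)) (at r)"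
    for f g :: "real \<Rightarrow> complex" and s
  proof -
    have "((f \<circ> R) has_vector_derivative ((R s - p) * (R s - q) / (p - q)) *\<^sub>R (of_real ((p - q) / ((R s - p) * (R s - q))) * g (R s))) (at s)"
      by (rule vector_diff_chain_at[OF R(4)[OF s, unfolded has_real_derivative_iff_has_vector_derivative] d[OF R(1)[OF s]]])
    moreover have "(R s - p) * (R s - q) / (p - q) * ((p - q) / ((R s - p) * (R s - q))) = 1"
      using R(1)[OF s] pq by simp
    ultimately show ?thesis
      unfolding o_def scaleR_conv_of_real mult.assoc[symmetric] of_real_mult[symmetric] by simp
  qed
  define F0 where "F0 s = f0 (R s)" for s
  define F1 where "F1 s = f1 (R s)" for s
  define F2 where "F2 s = f2 (R s)" for s
  have dF0: "(F0 has_vector_derivative F1 s) (at s)" and dF1: "(F1 has_vector_derivative F2 s) (at s)" if "s < 0" for s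
    unfolding F0_def F1_def F2_def using that by (auto intro!: chain df0 df1)
  have heun: "of_real ((1 - exp s)^2) * F2 s + (heun_B (2 * k) (2 * (p + q) * \<omega>) (\<omega> * (p - q)) s * F1 s
      + heun_C (2 * k) (2 * (p + q) * \<omega>) (kerr_c p q k \<omega> lam) s * F0 s) = 0" if s: "s < 0" for s
  proof -
    have C': "heun_C (2 * k) (2 * (p + q) * \<omega>) (kerr_c p q k \<omega> lam) s = C (R s) / (of_real (R s - q))^2"
      unfolding heun_C_kerr[OF pq(2) s] C_def R_def n ..
    have e: "complex_of_real ((1 - exp s)^2) = (of_real (p - q))^2 / (of_real (R s - q))^2"
      unfolding R(3)[OF s] power_divide of_real_divide of_real_power ..
    have "complex_of_real (p - q) \<noteq> 0" "complex_of_real (R s - q) \<noteq> 0"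
      using pq R(1)[OF s] by (simp_all del: of_real_diff)
    moreover have "b \<noteq> 0 \<Longrightarrow> x \<noteq> 0 \<Longrightarrow> b^2 / x^2 * (- (2 * l * b * y1 + c * y0) / b^2) + (2 * b * l / x^2 * y1 + c / x^2 * y0) = 0"
      for b x l c y1 y0 :: complex
      by (simp add: field_simps)
    ultimately show ?thesis
      unfolding heun_B_kerr[OF pq(2) s] C' e F0_def F1_def F2_def f2_def R_def by blast
  qed
  have horizon: "horizon_bc M a (of_real \<omega>) m rs u" and inf: "infinity_bc (of_real \<omega>) rs u"
    using assms(7) by (auto simp: mode_bc_def)
  have xi: "kerr_xi M a (of_real \<omega>) m = \<i> * of_real k"
    unfolding kerr_xi_def k_def n_def p_def[symmetric] q_def[symmetric] by simp
  obtain e G where e: "e > 0" "smooth_on (ball p e) G"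
    and G: "\<And>r. r \<in> {p<..<p+e} \<Longrightarrow> G r = rcpow (r - p) (- (\<i> * of_real k)) * u (rs r)"
    using horizon unfolding horizon_bc_def p_def[symmetric] xi by blast
  note hl = horizon_limits[OF pq e G f0_def df0]
  obtain L where L: "(f0 \<longlongrightarrow> L) (at_right p)" using hl(1) by blast
  note Rbot = kerr_r_at_bot[OF pq(2), folded R_def]
  have lim0: "(F0 \<longlongrightarrow> L) at_bot" unfolding F0_def by (rule filterlim_compose[OF L Rbot])
  have lim1: "(F1 \<longlongrightarrow> 0) at_bot" unfolding F1_def by (rule filterlim_compose[OF hl(2) Rbot])
  have ode': "u2 (rs r) + (\<omega>^2 - kerr_V M a (of_real \<omega>) m lam r) * u (rs r) = 0" if "r > p" for r
    using ode[OF that] by simp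
  note decay = infinity_derivative_decay[OF du du1 bij mono ode' kerr_V_tendsto_0 inf]
  obtain K where K: "\<forall>\<^sub>F r in at_top. norm (u (rs r)) \<le> K" using decay(1) by blast
  note Rtop = kerr_r_at_left[OF pq(2), folded R_def]
  have f0K: "\<forall>\<^sub>F r in at_top. norm (f0 r) \<le> K"
    using K eventually_gt_at_top[of p]
  proof eventually_elim
    case (elim r)
    have "norm (f0 r) \<le> norm (u (rs r)) * 1"
      unfolding f0_def norm_mult using norm_kerr_E_le_1[OF pq elim(2)] by (intro mult_left_mono) auto
    then show ?case using elim by simp
  qed
  have bdd: "\<forall>\<^sub>F s in at_left 0. norm (F0 s) \<le> K"
    unfolding F0_def using filterlim_iff[THEN iffD1, OF Rtop, rule_format, OF f0K] .
  \<comment> \<open>The slope condition at y = 1 in terms of r, since 1 - y = (p - q) / (r - q). The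
    square offsets the factor r^2 + p q in \<open>f1\<close>.\<close>
  have "((\<lambda>r. of_real (((p - q) / (r - q))^2) * f1 r) \<longlongrightarrow> 0) at_top"
  proof (rule Lim_null_comparison)
    \<comment> \<open>Comparing both u' and the logarithmic derivative with i w splits u' - (N /
      (r^2 + p q)) u into two parts that each tend to 0.\<close>
    let ?D = "\<lambda>r. (u1 (rs r) - \<i> * \<omega> * u (rs r)) + (\<i> * \<omega> - kerr_N p q k \<omega> r / of_real (r^2 + p * q)) * u (rs r)"
    let ?D' = "\<lambda>r. norm (u1 (rs r) - \<i> * \<omega> * u (rs r)) + norm (\<i> * \<omega> - kerr_N p q k \<omega> r / of_real (r^2 + p * q)) * K"
    show "\<forall>\<^sub>F r in at_top. norm (of_real (((p - q) / (r - q))^2) * f1 r)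
        \<le> ((p - q) * (r^2 + p * q) / (r - q)^2) * ?D' r"
      using K eventually_gt_at_top[of p]
    proof eventually_elim
      case (elim r)
      have nz: "complex_of_real (r^2 + p * q) \<noteq> 0" using rho[OF elim(2)] by (simp del: of_real_add)
      have "of_real (r^2 + p * q) * ?D r = of_real (r^2 + p * q) * u1 (rs r) - kerr_N p q k \<omega> r * u (rs r)"
      proof -
        have "t \<noteq> 0 \<Longrightarrow> t * ((y1 - z * y0) + (z - x / t) * y0) = t * y1 - x * y0" for t y1 z y0 x :: complex
          by (simp add: field_simps)
        from this[OF nz] show ?thesis .
      qed
      then have "f1 r = of_real (r^2 + p * q) * ?D r * kerr_E p q k \<omega> r / of_real (p - q)" by (simp add: f1_def)
      then have "norm (of_real (((p - q) / (r - q))^2) * f1 r)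
         = ((p - q) / (r - q))^2 * ((r^2 + p * q) * norm (?D r) * norm (kerr_E p q k \<omega> r) / (p - q))"
        using rho[OF elim(2)] pq by (simp only: norm_mult norm_divide norm_of_real abs_power2) simp
      also have "\<dots> = ((p - q) * (r^2 + p * q) / (r - q)^2) * (norm (?D r) * norm (kerr_E p q k \<omega> r))"
      proof -
        have "x \<noteq> 0 \<Longrightarrow> b \<noteq> 0 \<Longrightarrow> (b / x)^2 * (t * d * y / b) = (b * t / x^2) * (d * y)" for x b t d y :: real
          by (simp add: field_simps power2_eq_square)
        then show ?thesis using pq elim by simp
      qed
      also have "\<dots> \<le> ((p - q) * (r^2 + p * q) / (r - q)^2) * (?D' r * 1)"
      proof (intro mult_left_mono mult_mono)
        have "norm ((\<i> * \<omega> - kerr_N p q k \<omega> r / of_real (r^2 + p * q)) * u (rs r))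
          \<le> norm (\<i> * \<omega> - kerr_N p q k \<omega> r / of_real (r^2 + p * q)) * K"
          unfolding norm_mult using elim(1) by (intro mult_left_mono) auto
        then show "norm (?D r) \<le> ?D' r"
          using norm_triangle_ineq[of "u1 (rs r) - \<i> * \<omega> * u (rs r)"
              "(\<i> * \<omega> - kerr_N p q k \<omega> r / of_real (r^2 + p * q)) * u (rs r)"] by linarith
        then show "0 \<le> ?D' r" using norm_ge_zero order_trans by blast
      qed (use norm_kerr_E_le_1[OF pq elim(2)] rho[OF elim(2)] pq in auto)
      finally show ?case by simp
    qed
    have l1: "((\<lambda>r. (p - q) * (r^2 + p * q) / (r - q)^2) \<longlongrightarrow> p - q) at_top" by real_asymp
    have "((\<lambda>r. ((p - q) * (r^2 + p * q) / (r - q)^2) * ?D' r) \<longlongrightarrow> (p - q) * (norm (0::complex) + norm (\<i> * \<omega> - \<i> * \<omega>) * K)) at_top"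
      by (intro tendsto_mult tendsto_add tendsto_norm tendsto_diff tendsto_const l1 decay(2) kerr_N_tendsto)
    then show "((\<lambda>r. ((p - q) * (r^2 + p * q) / (r - q)^2) * ?D' r) \<longlongrightarrow> 0) at_top" by simp
  qed
  note slope0 = filterlim_compose[OF this Rtop]
  have slope: "((\<lambda>s. of_real ((1 - exp s)^2) * F1 s) \<longlongrightarrow> 0) (at_left 0)"
  proof (rule Lim_transform_eventually[OF slope0])
    show "\<forall>\<^sub>F s in at_left 0. of_real (((p - q) / (R s - q))^2) * f1 (R s) = of_real ((1 - exp s)^2) * F1 s"
      unfolding eventually_at_left_0 F1_def using R(3) by (intro exI[of _ "-1"]) simp
  qed
  \<comment> \<open>The reality of \<open>lam\<close> enters here.\<close>
  have Im_c: "Im (kerr_c p q k \<omega> lam) = 2 * (p + q) * \<omega> / 2 - 2 * k + \<omega> * (p - q)"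
    unfolding kerr_c_def using angular_eigenvalue_real[OF assms(5)] by (simp add: algebra_simps)
  \<comment> \<open>\<epsilon> \<delta> is a positive multiple of w^2, whatever the sign of a m w:
    there is no superradiant exception.\<close>
  have "2 * (p + q) * \<omega> * (\<omega> * (p - q)) = 2 * (p + q) * (p - q) * \<omega>^2"
    by (simp add: power2_eq_square)
  moreover have "2 * (p + q) * (p - q) * \<omega>^2 > 0"
    using assms(4) pq by (intro mult_pos_pos) auto
  ultimately have sgn: "2 * (p + q) * \<omega> * (\<omega> * (p - q)) > 0" by (simp only:)
  interpret confluent_heun "2 * k" "2 * (p + q) * \<omega>" "\<omega> * (p - q)" "kerr_c p q k \<omega> lam" F0 F1 F2
    by unfold_locales (fact dF0 dF1 heun)+
  have F0: "F0 s = 0" if "s < 0" for s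
    by (rule heun_solution_zero[OF lim0 lim1 bdd slope Im_c sgn that])
  show ?thesis
  proof
    fix s
    obtain r where r: "r > p" "s = rs r" using bij unfolding bij_betw_def by (metis UNIV_I greaterThan_iff imageE)
    \<comment> \<open>The value of s that corresponds to the radius r.\<close>
    define t where "t = ln ((r - p) / (r - q))"
    have rr: "(r - p) / (r - q) < 1" "(r - p) / (r - q) > 0" using r pq by auto
    then have t: "t < 0" by (simp add: t_def)
    have "R t = r"
    proof -
      have "1 - exp t = (p - q) / (r - q)" using rr r pq by (simp add: t_def field_simps)
      then show ?thesis unfolding R_def kerr_r_def using r pq by simp
    qed
    then have "u (rs r) * kerr_E p q k \<omega> r = 0" using F0[OF t] by (simp add: F0_def f0_def)
    then show "u s = 0" using r by (simp add: kerr_E_def)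
  qed
qed

end
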